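(* Let $u_0\in H^1(\mathbb S)$ with $h:=\int_{\mathbb S}u_{0x}^2\,dx\neq1$. Then the local solution $(\gamma,U,V,W,Q)$ of the system below, with the initial data below, is global. Moreover, $$(\gamma(t),U(t),V(t),W(t),Q(t))\in[W^{1,\infty}(\mathbb S)]^2\times[L^\infty(\mathbb S)]^3\quad\text{for all } t\ge0.$$ The system is $$\begin{aligned} \gamma_t&=-U^2,\\ U_t&=K(\xi)-P(1)(\gamma+\mathrm{Id})(\xi)-\frac{1}{1-h}\int_{\mathbb S}(2QV-Q)(\eta)\big(K(\eta)-P(1)(\gamma+\mathrm{Id})(\eta)\big)\,d\eta,\\ V_t&=-2UW+2WVP(1),\\ W_t&=2UV-U-2V^2P(1)+VP(1),\\ Q_t&=-2WQP(1). \end{aligned}$$ The initial data are $\gamma_0=y_0-\mathrm{Id}$ and $$y_0(\xi)+\int_0^{y_0(\xi)}u_{0x}^2\,dx=(1+h)\xi,\qquad U_0=u_0\circ y_0,\qquad V_0=\frac{1}{1+u_{0x}^2\circ y_0},\qquad W_0=\frac{u_{0x}\circ y_0}{1+u_{0x}^2\circ y_0},\qquad Q_0=1+h.$$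
   Context: $\mathbb S=\mathbb R/\mathbb Z$ (1-periodic functions on $\mathbb R$), $\xi\in\mathbb S$. The Banach space is $Y=H^1(\mathbb S)\times H^1(\mathbb S)\times L^\infty(\mathbb S)^3$. We write $y=\gamma+\mathrm{Id}$. In the system: - $P(1)=\int_{\mathbb S}(2UQV-UQ)(\zeta)\,d\zeta$; - $K(\xi)=\int_{y^{-1}(t,0)}^{\xi}(2UQV-UQ)(\eta)\,d\eta$, where $y^{-1}(t,0)$ denotes a point $\xi_0$ with $y(t,\xi_0)=0$. The "local solution" is a solution in $L^\infty([0,T];Y)$ for some $T>0$ (its existence is known). The claim asserts that it extends to all $t\ge0$. *)

theory Defs
  imports "HOL-Analysis.Analysis"
begin

text \<open>Functions on the circle S = R/Z are represented as 1-periodic functions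
real => real.  Time-dependent quantities are functions t => xi => value.\<close>

definition periodic1 :: "(real \<Rightarrow> real) \<Rightarrow> bool" where
  "periodic1 f \<longleftrightarrow> (\<forall>x. f (x + 1) = f x)"

definition Linf_bdd :: "real \<Rightarrow> (real \<Rightarrow> real) \<Rightarrow> bool" where
  "Linf_bdd C f \<longleftrightarrow> periodic1 f \<and> f \<in> borel_measurable lborel \<and>
     (AE x in lborel. \<bar>f x\<bar> \<le> C)"

definition is_H1_deriv :: "(real \<Rightarrow> real) \<Rightarrow> (real \<Rightarrow> real) \<Rightarrow> bool" where
  "is_H1_deriv f g \<longleftrightarrow> periodic1 f \<and> periodic1 g \<and> g \<in> borel_measurable lborel \<and>
     set_integrable lborel {0..1} (\<lambda>x. (g x)\<^sup>2) \<and>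
     (\<forall>x. f x = f 0 + (LBINT s=0..ereal x. g s))"

definition H1_bdd :: "real \<Rightarrow> (real \<Rightarrow> real) \<Rightarrow> bool" where
  "H1_bdd C f \<longleftrightarrow> (\<exists>g. is_H1_deriv f g \<and> (LBINT x=0..1. (f x)\<^sup>2 + (g x)\<^sup>2) \<le> C)"

definition P1 :: "(real \<Rightarrow> real) \<Rightarrow> (real \<Rightarrow> real) \<Rightarrow> (real \<Rightarrow> real) \<Rightarrow> real" where
  "P1 U V Q = (LBINT z=0..1. 2 * U z * Q z * V z - U z * Q z)"

text \<open>K(xi) = int_{xi0}^{xi} (2UQV - UQ), where xi0 is a point with y(xi0) = 0.\<close>
definition Kf :: "(real \<Rightarrow> real) \<Rightarrow> (real \<Rightarrow> real) \<Rightarrow> (real \<Rightarrow> real) \<Rightarrow> real \<Rightarrow> real \<Rightarrow> real" where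
  "Kf U V Q xi0 xi = (LBINT e=ereal xi0..ereal xi. 2 * U e * Q e * V e - U e * Q e)"

definition rhs_gamma :: "(real \<Rightarrow> real) \<Rightarrow> real \<Rightarrow> real" where
  "rhs_gamma U xi = - (U xi)\<^sup>2"

definition rhs_U :: "real \<Rightarrow> (real \<Rightarrow> real) \<Rightarrow> (real \<Rightarrow> real) \<Rightarrow> (real \<Rightarrow> real) \<Rightarrow>
    (real \<Rightarrow> real) \<Rightarrow> real \<Rightarrow> real \<Rightarrow> real" where
  "rhs_U h gam U V Q xi0 xi =
     Kf U V Q xi0 xi - P1 U V Q * (gam xi + xi)
     - 1 / (1 - h) * (LBINT e=0..1. (2 * Q e * V e - Q e) *
                         (Kf U V Q xi0 e - P1 U V Q * (gam e + e)))"

definition rhs_V :: "(real \<Rightarrow> real) \<Rightarrow> (real \<Rightarrow> real) \<Rightarrow> (real \<Rightarrow> real) \<Rightarrow> (real \<Rightarrow> real) \<Rightarrow> real \<Rightarrow> real" where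
  "rhs_V U V W Q xi = - 2 * U xi * W xi + 2 * W xi * V xi * P1 U V Q"

definition rhs_W :: "(real \<Rightarrow> real) \<Rightarrow> (real \<Rightarrow> real) \<Rightarrow> (real \<Rightarrow> real) \<Rightarrow> real \<Rightarrow> real" where
  "rhs_W U V Q xi = 2 * U xi * V xi - U xi - 2 * (V xi)\<^sup>2 * P1 U V Q + V xi * P1 U V Q"

definition rhs_Q :: "(real \<Rightarrow> real) \<Rightarrow> (real \<Rightarrow> real) \<Rightarrow> (real \<Rightarrow> real) \<Rightarrow> (real \<Rightarrow> real) \<Rightarrow> real \<Rightarrow> real" where
  "rhs_Q U V W Q xi = - 2 * W xi * Q xi * P1 U V Q"

text \<open>(gam,U,V,W,Q) is a solution on [0,T] in L^infty([0,T];Y) of the system with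
  initial data (gam0,U0,V0,W0,Q0), where xi0 t is a point with y(t,xi0 t) = 0.
  The equations are imposed in integrated (mild) form, for almost every xi.\<close>
definition sol_on :: "real \<Rightarrow> real \<Rightarrow>
    (real \<Rightarrow> real) \<Rightarrow> (real \<Rightarrow> real) \<Rightarrow> (real \<Rightarrow> real) \<Rightarrow> (real \<Rightarrow> real) \<Rightarrow> (real \<Rightarrow> real) \<Rightarrow>
    (real \<Rightarrow> real \<Rightarrow> real) \<Rightarrow> (real \<Rightarrow> real \<Rightarrow> real) \<Rightarrow> (real \<Rightarrow> real \<Rightarrow> real) \<Rightarrow>
    (real \<Rightarrow> real \<Rightarrow> real) \<Rightarrow> (real \<Rightarrow> real \<Rightarrow> real) \<Rightarrow> (real \<Rightarrow> real) \<Rightarrow> bool" where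
  "sol_on h T gam0 U0 V0 W0 Q0 gam U V W Q xi0 \<longleftrightarrow>
     (\<exists>C. \<forall>t\<in>{0..T}. H1_bdd C (gam t) \<and> H1_bdd C (U t) \<and>
          Linf_bdd C (V t) \<and> Linf_bdd C (W t) \<and> Linf_bdd C (Q t)) \<and>
     (\<forall>t\<in>{0..T}. gam t (xi0 t) + xi0 t = 0) \<and>
     (AE xi in lborel.
        set_integrable lborel {0..T} (\<lambda>s. rhs_gamma (U s) xi) \<and>
        set_integrable lborel {0..T} (\<lambda>s. rhs_U h (gam s) (U s) (V s) (Q s) (xi0 s) xi) \<and>
        set_integrable lborel {0..T} (\<lambda>s. rhs_V (U s) (V s) (W s) (Q s) xi) \<and>
        set_integrable lborel {0..T} (\<lambda>s. rhs_W (U s) (V s) (Q s) xi) \<and>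
        set_integrable lborel {0..T} (\<lambda>s. rhs_Q (U s) (V s) (W s) (Q s) xi) \<and>
        (\<forall>t\<in>{0..T}.
           gam t xi = gam0 xi + (LBINT s=0..ereal t. rhs_gamma (U s) xi) \<and>
           U t xi = U0 xi + (LBINT s=0..ereal t. rhs_U h (gam s) (U s) (V s) (Q s) (xi0 s) xi) \<and>
           V t xi = V0 xi + (LBINT s=0..ereal t. rhs_V (U s) (V s) (W s) (Q s) xi) \<and>
           W t xi = W0 xi + (LBINT s=0..ereal t. rhs_W (U s) (V s) (Q s) xi) \<and>
           Q t xi = Q0 xi + (LBINT s=0..ereal t. rhs_Q (U s) (V s) (W s) (Q s) xi)))"

definition global_sol :: "real \<Rightarrow>
    (real \<Rightarrow> real) \<Rightarrow> (real \<Rightarrow> real) \<Rightarrow> (real \<Rightarrow> real) \<Rightarrow> (real \<Rightarrow> real) \<Rightarrow> (real \<Rightarrow> real) \<Rightarrow>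
    (real \<Rightarrow> real \<Rightarrow> real) \<Rightarrow> (real \<Rightarrow> real \<Rightarrow> real) \<Rightarrow> (real \<Rightarrow> real \<Rightarrow> real) \<Rightarrow>
    (real \<Rightarrow> real \<Rightarrow> real) \<Rightarrow> (real \<Rightarrow> real \<Rightarrow> real) \<Rightarrow> (real \<Rightarrow> real) \<Rightarrow> bool" where
  "global_sol h gam0 U0 V0 W0 Q0 gam U V W Q xi0 \<longleftrightarrow>
     (\<forall>T>0. sol_on h T gam0 U0 V0 W0 Q0 gam U V W Q xi0) \<and>
     (\<forall>t\<ge>0. (\<exists>L. L-lipschitz_on UNIV (gam t)) \<and> (\<exists>L. L-lipschitz_on UNIV (U t)) \<and>
              (\<exists>C. Linf_bdd C (V t)) \<and> (\<exists>C. Linf_bdd C (W t)) \<and> (\<exists>C. Linf_bdd C (Q t)))"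

end

theory Submission
  imports Defs
begin

text \<open>Rewrite the system as an ordinary differential equation Z' = F(Z) for bounded Borel 1-periodic
  functions under the supremum norm; F is built from bounded linear and multilinear maps, so it is Lipschitz on balls.
  Along a solution V^2 + W^2 - V is constant, hence zero, and then the defects y - y(e) - int QV and U - U(e) - int QW
  solve a homogeneous linear system, hence vanish.  With the periodicity this gives int QV = 1, int QW = 0 and
  int Q = 1 + h, so the weight 2QV - Q has mean 1 - h and P(1) = int U(2QV - Q) is conserved.  Now V and W are bounded by
  the circle identity, Q grows at most exponentially, the oscillation of U is at most int |QW|, and since h is not 1 the
  value of P(1) bounds U itself.  These a priori bounds make the solution global.

  For an arbitrary solution the same invariants hold off a null set; they show that the choice of the base point
  in K is irrelevant, so that the solution solves Z' = F(Z) almost everywhere and a Gronwall argument applies.\<close>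

text \<open>The phase space carries no Sobolev regularity: F uses only products, means and
  primitives. The regularity of gamma and U returns at the end from the invariants, which present
  their increments as integrals of the bounded functions QV - 1 and QW. What shapes the proof is the
  base point of K. For a merely bounded Borel gamma the function y need not have a zero, and where
  zeros exist they need not be unique or depend continuously on the state; a field built on them
  would not be Lipschitz. With base point 0 it is, but the two right-hand sides agree only where 2QV
  - Q has mean 1 - h, and this mean is itself a consequence of the invariants. The circle is broken
  by deriving the invariants from an equation for differences of U, in which the base point cancels.
  The same derivation then serves the solution of Z' = F(Z), where the equations hold at every
  point, and an arbitrary solution, where they hold off a null set.\<close>

subsection \<open>Differential equations in Banach spaces\<close>

text \<open>Iterating over a whole family, instead of applying Gronwall to its supremum, avoids any
  measurability requirement on the supremum.\<close>

lemma gronwall_family: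
  fixes \<phi> \<psi> :: "'i \<Rightarrow> real \<Rightarrow> 'a::banach"
  assumes "0 \<le> C"
    and int: "\<And>i t. i \<in> S \<Longrightarrow> t \<in> {0..T} \<Longrightarrow> (\<psi> i has_integral \<phi> i t) {0..t}"
    and bd: "\<And>i t. i \<in> S \<Longrightarrow> t \<in> {0..T} \<Longrightarrow> norm (\<phi> i t) \<le> M"
    and lip: "\<And>t b i. t \<in> {0..T} \<Longrightarrow> (\<And>j. j \<in> S \<Longrightarrow> norm (\<phi> j t) \<le> b) \<Longrightarrow> i \<in> S \<Longrightarrow> norm (\<psi> i t) \<le> C * b"
    and "i \<in> S" "t \<in> {0..T}"
  shows "\<phi> i t = 0"
proof -
  \<comment> \<open>Integrating C times the n-th bound over [0,t] reproduces the bound with n + 1;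
    letting n tend to infinity leaves 0.\<close>
  have *: "norm (\<phi> i t) \<le> M * ((C * t) ^ n / fact n)" if "i \<in> S" "t \<in> {0..T}" for n i t
    using that
  proof (induction n arbitrary: i t)
    case 0
    then show ?case using bd by simp
  next
    case (Suc n)
    have t: "0 \<le> t" using Suc.prems by auto
    have "((\<lambda>s. C * (M * ((C * s) ^ n / fact n))) has_integral
        (M * ((C * t) ^ Suc n / fact (Suc n)) - M * ((C * 0) ^ Suc n / fact (Suc n)))) {0..t}"
    proof (rule fundamental_theorem_of_calculus[OF t])
      fix s
      have "((\<lambda>s. M * (C * s) ^ Suc n / fact (Suc n)) has_real_derivative
          M * (real (Suc n) * (C * s) ^ n * C) / fact (Suc n)) (at s within {0..t})"
        by (auto intro!: derivative_eq_intros simp del: power_Suc fact_Suc)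
      also have "M * (real (Suc n) * (C * s) ^ n * C) / fact (Suc n) = C * (M * ((C * s) ^ n / fact n))"
        by (simp add: fact_Suc del: of_nat_Suc)
      finally show "((\<lambda>s. M * ((C * s) ^ Suc n / fact (Suc n))) has_vector_derivative
          C * (M * ((C * s) ^ n / fact n))) (at s within {0..t})"
        by (simp add: has_real_derivative_iff_has_vector_derivative)
    qed
    then have I: "((\<lambda>s. C * (M * ((C * s) ^ n / fact n))) has_integral
        M * ((C * t) ^ Suc n / fact (Suc n))) {0..t}" by simp
    show ?case
    proof (rule integral_norm_bound_integral[of "\<psi> i" "{0..t}" "\<lambda>s. C * (M * ((C * s) ^ n / fact n))",
          unfolded integral_unique[OF int[OF Suc.prems]] integral_unique[OF I]])
      show "\<psi> i integrable_on {0..t}" using int[OF Suc.prems] by auto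
      show "(\<lambda>s. C * (M * ((C * s) ^ n / fact n))) integrable_on {0..t}" using I by auto
      fix s assume "s \<in> {0..t}"
      then have s: "s \<in> {0..T}" using Suc.prems by auto
      \<comment> \<open>The induction hypothesis covers every member of the family at the time s, as
        the premise of \<open>lip\<close> demands.\<close>
      show "norm (\<psi> i s) \<le> C * (M * ((C * s) ^ n / fact n))"
        by (rule lip[OF s _ Suc.prems(1)]) (rule Suc.IH[OF _ s])
    qed
  qed
  have "summable (\<lambda>n. (C * t) ^ n / fact n)"
    using summable_exp[of "C * t"] by (simp add: divide_inverse mult.commute)
  then have "(\<lambda>n. M * ((C * t) ^ n / fact n)) \<longlonglongrightarrow> M * 0"
    by (intro tendsto_mult tendsto_const) (rule summable_LIMSEQ_zero)
  then have "norm (\<phi> i t) \<le> M * 0"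
    by (rule LIMSEQ_le_const) (use * assms in blast)
  then show ?thesis by simp
qed

text \<open>Bounded continuous functions live on the whole line, while the Picard integral is meant
  for nonnegative times; clamping the upper limit at 0 extends it continuously.\<close>

lemma continuous_indefinite_integral_max:
  fixes g :: "real \<Rightarrow> 'a::banach"
  assumes "continuous_on UNIV g"
  shows "continuous_on UNIV (\<lambda>t. integral {0..max 0 t} g)"
proof -
  have "isCont (\<lambda>t. integral {0..max 0 t} g) x" for x :: real
  proof -
    define b where "b = \<bar>x\<bar> + 1"
    have "continuous_on {0..b} (\<lambda>t. integral {0..t} g)"
      by (intro indefinite_integral_continuous_1 integrable_continuous_real
          continuous_on_subset[OF assms]) auto
    then have "continuous_on {-b<..<b} (\<lambda>t. integral {0..max 0 t} g)"
      by (rule continuous_on_compose2) (auto intro!: continuous_intros simp: b_def)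
    then have "\<forall>r\<in>{-b<..<b}. isCont (\<lambda>t. integral {0..max 0 t} g) r"
      by (simp add: continuous_on_eq_continuous_at)
    moreover have "x \<in> {-b<..<b}" by (auto simp: b_def)
    ultimately show ?thesis by blast
  qed
  then show ?thesis by (simp add: continuous_on_eq_continuous_at)
qed

lemma has_integral_exp_scaled:
  fixes \<kappa> t :: real
  assumes "\<kappa> \<noteq> 0" "0 \<le> t"
  shows "((\<lambda>s. A * exp (\<kappa> * s)) has_integral A * (exp (\<kappa> * t) - 1) / \<kappa>) {0..t}"
proof -
  have "((\<lambda>s. A * exp (\<kappa> * s)) has_integral A * exp (\<kappa> * t) / \<kappa> - A * exp (\<kappa> * 0) / \<kappa>) {0..t}"
    using assms
    by (intro fundamental_theorem_of_calculus)
      (auto simp: has_real_derivative_iff_has_vector_derivative[symmetric] intro!: derivative_eq_intros)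
  then show ?thesis by (simp add: algebra_simps diff_divide_distrib)
qed

text \<open>Contraction in an exponentially weighted supremum norm: with x(t) = exp(\<kappa> t) z(t)
  and z bounded and continuous, the Picard map contracts on the whole half line at once, without
  continuation over short intervals.\<close>

lemma picard_global:
  fixes f :: "'a::banach \<Rightarrow> 'a"
  assumes lip: "L-lipschitz_on UNIV f"
  obtains x where "x 0 = x0"
    "\<And>T t. t \<in> {0..T} \<Longrightarrow> (x has_vector_derivative f (x t)) (at t within {0..T})"
proof -
  \<comment> \<open>The factor 2 makes the contraction constant L / \<kappa> at most 1/2; the added
    1 keeps \<kappa> positive when L = 0.\<close>
  define \<kappa> where "\<kappa> = 2 * (L + 1)"
  have L: "0 \<le> L" using lip by (rule lipschitz_on_nonneg)
  have \<kappa>: "\<kappa> > 0" "L / \<kappa> \<le> 1/2" using L by (auto simp: \<kappa>_def divide_simps)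
  have fc: "continuous_on UNIV f" using lip by (rule lipschitz_on_continuous_on)
  define g where "g z s = f (exp (\<kappa> * s) *\<^sub>R apply_bcontfun z s)" for z :: "real \<Rightarrow>\<^sub>C 'a" and s
  have gc: "continuous_on A (g z)" for z A
    unfolding g_def by (rule continuous_on_compose2[OF fc]) (auto intro!: continuous_intros)
  have gi: "g z integrable_on {0..t}" for z t
    by (intro integrable_continuous_real gc)
  \<comment> \<open>The Picard map rewritten for z. At negative times its value is x0, which keeps
    it continuous and bounded.\<close>
  define \<Psi> where "\<Psi> z t = exp (- \<kappa> * max 0 t) *\<^sub>R (x0 + integral {0..max 0 t} (g z))" for z t
  have gb: "norm (g z s) \<le> (norm (f 0) + L * norm z) * exp (\<kappa> * s)" if "0 \<le> s" for z s
  proof -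
    have "norm (g z s) \<le> norm (f 0) + norm (g z s - f 0)"
      by (metis norm_triangle_sub)
    also have "norm (g z s - f 0) \<le> L * norm (exp (\<kappa> * s) *\<^sub>R apply_bcontfun z s)"
      using lipschitz_onD[OF lip, of "exp (\<kappa> * s) *\<^sub>R apply_bcontfun z s" 0] by (simp add: g_def dist_norm)
    also have "\<dots> \<le> L * (exp (\<kappa> * s) * norm z)"
      using L by (auto intro!: mult_left_mono norm_bounded)
    also have "norm (f 0) \<le> norm (f 0) * exp (\<kappa> * s)"
      using that \<kappa> by (simp add: mult_le_cancel_left1)
    finally show ?thesis by (simp add: algebra_simps)
  qed
  have "\<Psi> z \<in> bcontfun" for z
  proof -
    have "norm (\<Psi> z t) \<le> norm x0 + (norm (f 0) + L * norm z) / \<kappa>" for t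
    proof -
      define \<tau> A where "\<tau> = max 0 t" and "A = norm (f 0) + L * norm z"
      have \<tau>: "0 \<le> \<tau>" and A: "0 \<le> A" using L by (auto simp: \<tau>_def A_def)
      have "norm (integral {0..\<tau>} (g z)) \<le> A * (exp (\<kappa> * \<tau>) - 1) / \<kappa>"
        using integral_norm_bound_integral[OF gi has_integral_integrable[OF has_integral_exp_scaled[of \<kappa> \<tau> A]], of z]
          integral_unique[OF has_integral_exp_scaled[of \<kappa> \<tau> A]] gb[of _ z] \<kappa> \<tau>
        by (auto simp: A_def)
      also have "\<dots> \<le> A * exp (\<kappa> * \<tau>) / \<kappa>" using A \<kappa> by (intro divide_right_mono mult_left_mono) auto
      finally have I: "norm (integral {0..\<tau>} (g z)) \<le> A * exp (\<kappa> * \<tau>) / \<kappa>" .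
      have "norm (\<Psi> z t) \<le> exp (- \<kappa> * \<tau>) * (norm x0 + norm (integral {0..\<tau>} (g z)))"
        unfolding \<Psi>_def \<tau>_def[symmetric] by (simp add: norm_triangle_ineq)
      also have "\<dots> \<le> exp (- \<kappa> * \<tau>) * (norm x0 + A * exp (\<kappa> * \<tau>) / \<kappa>)"
        using I by (intro mult_left_mono add_left_mono) auto
      also have "\<dots> = exp (- \<kappa> * \<tau>) * norm x0 + A / \<kappa>"
        by (simp add: algebra_simps exp_minus)
      also have "exp (- \<kappa> * \<tau>) * norm x0 \<le> 1 * norm x0"
        using \<kappa> \<tau> by (intro mult_right_mono) auto
      finally show ?thesis by (simp add: A_def)
    qed
    moreover have "continuous_on UNIV (\<Psi> z)"
      unfolding \<Psi>_def by (intro continuous_intros continuous_indefinite_integral_max gc)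
    ultimately show ?thesis by (auto intro!: bcontfun_normI)
  qed
  then have \<Phi>: "apply_bcontfun (Bcontfun (\<Psi> z)) = \<Psi> z" for z
    by (simp add: Bcontfun_inverse)
  have contr: "dist (Bcontfun (\<Psi> z)) (Bcontfun (\<Psi> w)) \<le> 1/2 * dist z w" for z w
  proof (rule dist_bound)
    fix t :: real
    define \<tau> where "\<tau> = max 0 t"
    have \<tau>: "0 \<le> \<tau>" unfolding \<tau>_def by (rule max.cobounded1)
    have d: "norm (g z s - g w s) \<le> (L * dist z w) * exp (\<kappa> * s)" for s
    proof -
      have "norm (g z s - g w s) \<le> L * dist (exp (\<kappa> * s) *\<^sub>R apply_bcontfun z s) (exp (\<kappa> * s) *\<^sub>R apply_bcontfun w s)"
        using lipschitz_onD[OF lip, of "exp (\<kappa> * s) *\<^sub>R apply_bcontfun z s" "exp (\<kappa> * s) *\<^sub>R apply_bcontfun w s"]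
        by (simp add: g_def dist_norm)
      also have "\<dots> = L * (exp (\<kappa> * s) * dist (apply_bcontfun z s) (apply_bcontfun w s))"
        by (simp add: dist_norm flip: scaleR_diff_right)
      also have "\<dots> \<le> L * (exp (\<kappa> * s) * dist z w)"
        using L by (intro mult_left_mono dist_bounded) auto
      finally show ?thesis by (simp add: algebra_simps)
    qed
    have I: "norm (integral {0..\<tau>} (\<lambda>s. g z s - g w s)) \<le> (L * dist z w) * (exp (\<kappa> * \<tau>) - 1) / \<kappa>"
      using integral_norm_bound_integral[OF integrable_diff[OF gi gi] has_integral_integrable[OF has_integral_exp_scaled[of \<kappa> \<tau> "L * dist z w"]], of z w]
        integral_unique[OF has_integral_exp_scaled[of \<kappa> \<tau> "L * dist z w"]] d \<kappa> \<tau>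
      by auto
    have "dist (\<Psi> z t) (\<Psi> w t) = exp (- \<kappa> * \<tau>) * norm (integral {0..\<tau>} (\<lambda>s. g z s - g w s))"
      unfolding \<Psi>_def \<tau>_def[symmetric] dist_norm scaleR_diff_right[symmetric] by (simp add: integral_diff gi)
    also have "\<dots> \<le> exp (- \<kappa> * \<tau>) * ((L * dist z w) * exp (\<kappa> * \<tau>) / \<kappa>)"
      using I L \<kappa> by (intro mult_left_mono order.trans[OF I] divide_right_mono) auto
    also have "\<dots> = (L / \<kappa>) * dist z w" by (simp add: exp_minus)
    also have "\<dots> \<le> 1/2 * dist z w" using \<kappa> by (intro mult_right_mono) auto
    finally show "dist (apply_bcontfun (Bcontfun (\<Psi> z)) t) (apply_bcontfun (Bcontfun (\<Psi> w)) t) \<le> 1/2 * dist z w"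
      by (simp add: \<Phi>)
  qed
  have "\<exists>!z. Bcontfun (\<Psi> z) = z"
    by (rule banach_fix_type[of "1/2"]) (use contr in auto)
  then obtain z where z: "Bcontfun (\<Psi> z) = z" by auto
  define x where "x t = exp (\<kappa> * t) *\<^sub>R apply_bcontfun z t" for t
  have x: "x t = x0 + integral {0..t} (\<lambda>s. f (x s))" if "0 \<le> t" for t
  proof -
    have "x t = exp (\<kappa> * t) *\<^sub>R \<Psi> z t" unfolding x_def using z \<Phi> by metis
    also have "\<dots> = x0 + integral {0..t} (g z)" using that by (simp add: \<Psi>_def exp_minus)
    also have "g z = (\<lambda>s. f (x s))" by (simp add: fun_eq_iff g_def x_def)
    finally show ?thesis .
  qed
  show ?thesis
  proof (rule that[of x])
    show "x 0 = x0" using x[of 0] by simp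
    fix T t :: real assume t: "t \<in> {0..T}"
    have "continuous_on {0..T} (\<lambda>s. f (x s))" using gc[of _ z] by (simp add: g_def x_def)
    from integral_has_vector_derivative[OF this t]
    have "((\<lambda>u. x0 + integral {0..u} (\<lambda>s. f (x s))) has_vector_derivative f (x t)) (at t within {0..T})"
      by (auto intro!: derivative_eq_intros)
    then show "(x has_vector_derivative f (x t)) (at t within {0..T})"
      by (rule has_vector_derivative_transform[OF t, rotated]) (use x in auto)
  qed
qed

section \<open>Fields that are Lipschitz only on balls: truncation, uniqueness, continuation\<close>

definition radial_proj :: "real \<Rightarrow> 'a::real_normed_vector \<Rightarrow> 'a" where
  "radial_proj R x = (R / max R (norm x)) *\<^sub>R x"

lemma radial_proj_id: "0 < R \<Longrightarrow> norm x \<le> R \<Longrightarrow> radial_proj R x = x"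
  by (simp add: radial_proj_def max_absorb1)

lemma norm_radial_proj: "0 < R \<Longrightarrow> norm (radial_proj R x) \<le> R"
  by (auto simp: radial_proj_def max_def)

text \<open>Composition with this retraction turns a field that is Lipschitz on balls into a
  globally Lipschitz one. The factor 2 is the price of a general norm: one part of the difference
  comes from x - y, the other from the change of the scaling factor, which contributes at most the
  difference of the norms.\<close>

lemma radial_proj_lipschitz:
  assumes "0 < R"
  shows "dist (radial_proj R x) (radial_proj R y) \<le> 2 * dist x y"
proof -
  define a b where "a = max R (norm x)" and "b = max R (norm y)"
  have a: "R \<le> a" "0 < a" and b: "0 < b" "norm y \<le> b" using assms by (auto simp: a_def b_def)
  have "radial_proj R x - radial_proj R y = (R / a) *\<^sub>R (x - y) + (R * (b - a) / (a * b)) *\<^sub>R y"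
    using a b by (simp add: radial_proj_def a_def[symmetric] b_def[symmetric] algebra_simps diff_divide_distrib)
  then have "dist (radial_proj R x) (radial_proj R y)
      \<le> norm ((R / a) *\<^sub>R (x - y)) + norm ((R * (b - a) / (a * b)) *\<^sub>R y)"
    by (metis dist_norm norm_triangle_ineq)
  also have "norm ((R / a) *\<^sub>R (x - y)) \<le> 1 * norm (x - y)"
    unfolding norm_scaleR using a assms by (intro mult_right_mono) auto
  also have "norm ((R * (b - a) / (a * b)) *\<^sub>R y) = (R / a) * \<bar>b - a\<bar> * (norm y / b)"
    using a b assms by (simp add: abs_mult)
  also have "\<dots> \<le> 1 * \<bar>b - a\<bar> * 1"
    using a b assms by (intro mult_mono) auto
  also have "\<bar>b - a\<bar> \<le> norm (x - y)"
    using norm_triangle_ineq3[of x y] by (auto simp: a_def b_def)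
  finally show ?thesis by (simp add: dist_norm)
qed

text \<open>For negative T only the initial value is prescribed, so quantification over all real T
  is harmless. At the end points the derivative is one-sided.\<close>

definition ode_sol :: "('a::real_normed_vector \<Rightarrow> 'a) \<Rightarrow> 'a \<Rightarrow> real \<Rightarrow> (real \<Rightarrow> 'a) \<Rightarrow> bool" where
  "ode_sol f x0 T x \<longleftrightarrow> x 0 = x0 \<and>
    (\<forall>t\<in>{0..T}. (x has_vector_derivative f (x t)) (at t within {0..T}))"

lemma ode_sol_subset: "ode_sol f x0 T x \<Longrightarrow> S \<le> T \<Longrightarrow> ode_sol f x0 S x"
  unfolding ode_sol_def
  by (auto intro: has_vector_derivative_within_subset[where S = "{0..T}"])

lemma ode_sol_continuous: "ode_sol f x0 T x \<Longrightarrow> continuous_on {0..T} x"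
  unfolding ode_sol_def continuous_on_eq_continuous_within
  by (auto intro: has_vector_derivative_continuous)

lemma ode_sol_has_integral:
  fixes f :: "'a::banach \<Rightarrow> 'a"
  assumes "ode_sol f x0 T x" "t \<in> {0..T}"
  shows "((\<lambda>s. f (x s)) has_integral x t - x0) {0..t}"
proof -
  have "ode_sol f x0 t x" using assms ode_sol_subset by auto
  then show ?thesis
    using fundamental_theorem_of_calculus[of 0 t x "\<lambda>s. f (x s)"] assms
    by (auto simp: ode_sol_def)
qed

lemma ode_sol_unique:
  fixes f :: "'a::banach \<Rightarrow> 'a"
  assumes lip: "\<And>R. \<exists>L. L-lipschitz_on (cball 0 R) f"
    and x: "ode_sol f x0 T x" and y: "ode_sol f x0 T y" and t: "t \<in> {0..T}"
  shows "x t = y t"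
proof -
  have "bounded (x ` {0..T} \<union> y ` {0..T})"
    using x y by (auto intro!: compact_imp_bounded compact_continuous_image ode_sol_continuous)
  then obtain R where R: "\<And>z. z \<in> x ` {0..T} \<union> y ` {0..T} \<Longrightarrow> norm z \<le> R"
    unfolding bounded_iff by blast
  obtain L where L: "L-lipschitz_on (cball 0 R) f" using lip by blast
  have "x t - y t = 0"
  proof (rule gronwall_family[where S = "{()}" and \<phi> = "\<lambda>_ t. x t - y t" and T = T
        and \<psi> = "\<lambda>_ t. f (x t) - f (y t)" and M = "2 * R" and C = L])
    show "0 \<le> L" using L by (rule lipschitz_on_nonneg)
    show "((\<lambda>t. f (x t) - f (y t)) has_integral x s - y s) {0..s}" if "s \<in> {0..T}" for s
      using has_integral_diff[OF ode_sol_has_integral[OF x that] ode_sol_has_integral[OF y that]] by simp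
    show "norm (x s - y s) \<le> 2 * R" if "s \<in> {0..T}" for s
      using R[of "x s"] R[of "y s"] norm_triangle_ineq4[of "x s" "y s"] that by auto
    fix s b assume s: "s \<in> {0..T}" and b: "\<And>j. j \<in> {()} \<Longrightarrow> norm (x s - y s) \<le> b"
    have "norm (f (x s) - f (y s)) \<le> L * norm (x s - y s)"
      using lipschitz_onD[OF L, of "x s" "y s"] R s by (auto simp: dist_norm)
    also have "\<dots> \<le> L * b" using b L by (auto intro!: mult_left_mono lipschitz_on_nonneg)
    finally show "norm (f (x s) - f (y s)) \<le> L * b" .
  qed (use t in auto)
  then show ?thesis by simp
qed

text \<open>The field is truncated outside a ball larger than the a priori bound. Up to its first
  arrival at the sphere the truncated solution solves the original equation, so the bound applies at
  that very time and contradicts the arrival. This is why the bound has to be uniform over all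
  solutions on shorter intervals. Uniqueness then glues the solutions on different
  intervals.\<close>

lemma ode_global_of_apriori_bound:
  fixes f :: "'a::banach \<Rightarrow> 'a"
  assumes lip: "\<And>R. \<exists>L. L-lipschitz_on (cball 0 R) f"
    and apriori: "\<And>T. \<exists>\<beta>. \<forall>\<tau> x. 0 \<le> \<tau> \<longrightarrow> \<tau> \<le> T \<longrightarrow> ode_sol f x0 \<tau> x \<longrightarrow> norm (x \<tau>) \<le> \<beta>"
  shows "\<exists>x. \<forall>T. ode_sol f x0 T x"
proof -
  have local: "\<exists>x. ode_sol f x0 T x" for T
  proof (cases "0 \<le> T")
    case False
    then show ?thesis by (auto simp: ode_sol_def)
  next
    case True
    obtain \<beta> where \<beta>: "\<And>\<tau> x. 0 \<le> \<tau> \<Longrightarrow> \<tau> \<le> T \<Longrightarrow> ode_sol f x0 \<tau> x \<Longrightarrow> norm (x \<tau>) \<le> \<beta>"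
      using apriori by blast
    \<comment> \<open>The added 1 separates the sphere of radius R strictly from the a priori bound
      and from the initial value.\<close>
    define R where "R = max \<beta> (norm x0) + 1"
    have R: "0 < R" "\<beta> < R" "norm x0 < R" by (auto simp: R_def)
       (smt (verit) norm_ge_zero)
    obtain L where L: "L-lipschitz_on (cball 0 R) f" using lip by blast
    have "(L * 2)-lipschitz_on UNIV (\<lambda>x. f (radial_proj R x))"
    proof (rule lipschitz_onI)
      fix x y :: 'a
      have "dist (f (radial_proj R x)) (f (radial_proj R y)) \<le> L * dist (radial_proj R x) (radial_proj R y)"
        by (rule lipschitz_onD[OF L]) (auto simp: norm_radial_proj R)
      also have "\<dots> \<le> L * (2 * dist x y)"
        using lipschitz_on_nonneg[OF L] by (intro mult_left_mono radial_proj_lipschitz R)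
      finally show "dist (f (radial_proj R x)) (f (radial_proj R y)) \<le> L * 2 * dist x y" by simp
    qed (use lipschitz_on_nonneg[OF L] in auto)
    then obtain x where x: "x 0 = x0" "\<And>T t. t \<in> {0..T} \<Longrightarrow>
        (x has_vector_derivative f (radial_proj R (x t))) (at t within {0..T})"
      using picard_global by blast
    have good: "ode_sol f x0 \<tau> x" if "\<And>s. s \<in> {0..\<tau>} \<Longrightarrow> norm (x s) \<le> R" for \<tau>
      unfolding ode_sol_def using x that radial_proj_id[OF R(1)] by metis
    have cx: "continuous_on {0..T} x"
      unfolding continuous_on_eq_continuous_within using x(2) has_vector_derivative_continuous by blast
    have "norm (x t) \<le> R" if t: "t \<in> {0..T}" for t
    proof (rule ccontr)
      assume neg: "\<not> norm (x t) \<le> R"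
      \<comment> \<open>The times at which the solution lies on the sphere; the least of them is the
        first arrival.\<close>
      define B where "B = {s \<in> {0..t}. norm (x s) = R}"
      have ct: "continuous_on {0..t} (\<lambda>s. norm (x s))"
        by (intro continuous_on_norm continuous_on_subset[OF cx]) (use t in auto)
      have hit: "\<exists>s\<in>B. s \<le> r" if "r \<in> {0..t}" "R \<le> norm (x r)" for r
        using IVT'[of "\<lambda>s. norm (x s)" 0 R r] that R x(1) continuous_on_subset[OF ct, of "{0..r}"]
        by (auto simp: B_def)
      have "closed B" unfolding B_def using ct
        by (intro continuous_closed_preimage_constant) auto
      moreover have "bounded B" by (rule bounded_subset[of "{0..t}"]) (auto simp: B_def)
      moreover have "B \<noteq> {}" using hit[of t] neg t by auto
      ultimately obtain s where s: "s \<in> B" "\<And>r. r \<in> B \<Longrightarrow> s \<le> r"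
        using compact_attains_inf[of B] compact_eq_bounded_closed by auto
      have "norm (x r) \<le> R" if "r \<in> {0..s}" for r
      proof (rule ccontr)
        assume "\<not> norm (x r) \<le> R"
        moreover have "r \<in> {0..t}" using that s(1) by (auto simp: B_def)
        ultimately obtain q where q: "q \<in> B" "q \<le> r" using hit[of r] by auto
        then have "q = r" using s(2)[of q] that by auto
        then show False using q \<open>\<not> norm (x r) \<le> R\<close> by (auto simp: B_def)
      qed
      then have "norm (x s) \<le> \<beta>" using \<beta>[OF _ _ good] s(1) t by (auto simp: B_def)
      then show False using s(1) R by (auto simp: B_def)
    qed
    then show ?thesis using good by blast
  qed
  then obtain X where X: "\<And>T. ode_sol f x0 T (X T)" by metis
  \<comment> \<open>The glued solution takes at time t the value of the solution on [0,t], which by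
    uniqueness every longer solution shares.\<close>
  have eq: "X \<bar>t\<bar> t = X T t" if "t \<in> {0..T}" for T t
    by (rule ode_sol_unique[OF lip ode_sol_subset[OF X] ode_sol_subset[OF X], of t]) (use that in auto)
  show ?thesis
  proof (intro exI[of _ "\<lambda>t. X \<bar>t\<bar> t"] allI)
    fix T
    show "ode_sol f x0 T (\<lambda>t. X \<bar>t\<bar> t)"
      unfolding ode_sol_def
    proof (intro conjI ballI)
      show "X \<bar>0\<bar> 0 = x0" using X by (auto simp: ode_sol_def)
      fix t assume t: "t \<in> {0..T}"
      have "(X T has_vector_derivative f (X T t)) (at t within {0..T})"
        using X[of T] t by (auto simp: ode_sol_def)
      then have "((\<lambda>t. X \<bar>t\<bar> t) has_vector_derivative f (X T t)) (at t within {0..T})"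
        by (rule has_vector_derivative_transform[OF t, rotated]) (use eq in auto)
      then show "((\<lambda>t. X \<bar>t\<bar> t) has_vector_derivative f (X \<bar>t\<bar> t)) (at t within {0..T})"
        using eq[OF t] by simp
    qed
  qed
qed

subsection \<open>Integrals of locally essentially bounded functions\<close>

text \<open>Boundedness is asked for locally because the equation contains the unbounded function xi
  next to periodic ones, and almost everywhere because V, W and Q are bounded only in that sense.
  The class is closed under sums and products, and its members are integrable between any two finite
  end points.\<close>

definition locbm :: "(real \<Rightarrow> real) \<Rightarrow> bool" where
  "locbm f \<longleftrightarrow> f \<in> borel_measurable borel \<and> (\<forall>R. \<exists>C. AE x in lborel. \<bar>x\<bar> \<le> R \<longrightarrow> \<bar>f x\<bar> \<le> C)"

lemma locbm_measurable: "locbm f \<Longrightarrow> f \<in> borel_measurable borel"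
  by (simp add: locbm_def)

lemma locbm_I: "f \<in> borel_measurable borel \<Longrightarrow> AE x in lborel. \<bar>f x\<bar> \<le> C \<Longrightarrow> locbm f"
  unfolding locbm_def by (auto elim: eventually_mono)

lemma locbm_const [intro, simp]: "locbm (\<lambda>x. c)"
  by (rule locbm_I[of _ "\<bar>c\<bar>"]) auto

lemma locbm_id [intro, simp]: "locbm (\<lambda>x. x)"
  unfolding locbm_def by auto

lemma locbm_add [intro]:
  assumes "locbm f" "locbm g" shows "locbm (\<lambda>x. f x + g x)"
  unfolding locbm_def
proof (intro conjI allI)
  show "(\<lambda>x. f x + g x) \<in> borel_measurable borel"
    using locbm_measurable[OF assms(1)] locbm_measurable[OF assms(2)] by measurable
  fix R
  obtain C D where "AE x in lborel. \<bar>x\<bar> \<le> R \<longrightarrow> \<bar>f x\<bar> \<le> C" "AE x in lborel. \<bar>x\<bar> \<le> R \<longrightarrow> \<bar>g x\<bar> \<le> D"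
    using assms unfolding locbm_def by meson
  then have "AE x in lborel. \<bar>x\<bar> \<le> R \<longrightarrow> \<bar>f x + g x\<bar> \<le> C + D"
    by eventually_elim auto
  then show "\<exists>C. AE x in lborel. \<bar>x\<bar> \<le> R \<longrightarrow> \<bar>f x + g x\<bar> \<le> C" by blast
qed

lemma locbm_mult [intro]:
  assumes "locbm f" "locbm g" shows "locbm (\<lambda>x. f x * g x)"
  unfolding locbm_def
proof (intro conjI allI)
  show "(\<lambda>x. f x * g x) \<in> borel_measurable borel"
    using locbm_measurable[OF assms(1)] locbm_measurable[OF assms(2)] by measurable
  fix R
  obtain C D where "AE x in lborel. \<bar>x\<bar> \<le> R \<longrightarrow> \<bar>f x\<bar> \<le> C" "AE x in lborel. \<bar>x\<bar> \<le> R \<longrightarrow> \<bar>g x\<bar> \<le> D"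
    using assms unfolding locbm_def by meson
  then have "AE x in lborel. \<bar>x\<bar> \<le> R \<longrightarrow> \<bar>f x * g x\<bar> \<le> \<bar>C\<bar> * \<bar>D\<bar>"
  proof eventually_elim
    case (elim x)
    then show ?case unfolding abs_mult by (intro impI mult_mono) auto
  qed
  then show "\<exists>C. AE x in lborel. \<bar>x\<bar> \<le> R \<longrightarrow> \<bar>f x * g x\<bar> \<le> C" by blast
qed

lemma locbm_diff [intro]: "locbm f \<Longrightarrow> locbm g \<Longrightarrow> locbm (\<lambda>x. f x - g x)"
  using locbm_add[of f "\<lambda>x. - 1 * g x"] locbm_mult[of "\<lambda>x. - 1" g] by simp

lemma locbm_power [intro]: "locbm f \<Longrightarrow> locbm (\<lambda>x. (f x) ^ n)"
  by (induction n) auto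

lemma locbm_cont [intro]:
  assumes "continuous_on UNIV f" shows "locbm f"
  unfolding locbm_def
proof (intro conjI allI)
  show "f \<in> borel_measurable borel" using assms by (rule borel_measurable_continuous_onI)
  fix R :: real
  have "compact (f ` {-R..R})"
    by (intro compact_continuous_image continuous_on_subset[OF assms]) auto
  then obtain C where C: "\<And>z. z \<in> f ` {-R..R} \<Longrightarrow> norm z \<le> C"
    using compact_imp_bounded bounded_iff by meson
  show "\<exists>C. AE x in lborel. \<bar>x\<bar> \<le> R \<longrightarrow> \<bar>f x\<bar> \<le> C"
    using C by (intro exI[of _ C] AE_I2) (auto simp: abs_le_iff)
qed

lemma integrable_indicator_Icc_const: "integrable lborel (\<lambda>x::real. indicator {a..b} x *\<^sub>R (C::real))"
  by (intro integrable_scaleR_left) (auto simp: integrable_indicator_iff emeasure_lborel_Icc_eq)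

lemma locbm_set_integrable:
  fixes a b :: real
  assumes "locbm f" shows "set_integrable lborel {a..b} f"
proof -
  obtain C where C: "AE x in lborel. \<bar>x\<bar> \<le> max \<bar>a\<bar> \<bar>b\<bar> \<longrightarrow> \<bar>f x\<bar> \<le> C"
    using assms unfolding locbm_def by meson
  have [measurable]: "f \<in> borel_measurable borel" using assms by (rule locbm_measurable)
  show ?thesis unfolding set_integrable_def
  proof (rule Bochner_Integration.integrable_bound)
    show "integrable lborel (\<lambda>x. indicator {a..b} x * \<bar>C\<bar>)"
      using integrable_indicator_Icc_const[of a b "\<bar>C\<bar>"] by simp
    show "(\<lambda>x. indicator {a..b} x *\<^sub>R f x) \<in> borel_measurable lborel" by measurable
    show "AE x in lborel. norm (indicator {a..b} x *\<^sub>R f x) \<le> norm (indicator {a..b} x * \<bar>C\<bar>)"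
      using C by eventually_elim (auto simp: indicator_def abs_le_iff)
  qed
qed

lemma locbm_interval_integrable [intro]:
  fixes a b :: real
  assumes "locbm f" shows "interval_lebesgue_integrable lborel (ereal a) (ereal b) f"
  using locbm_set_integrable[OF assms]
  unfolding interval_lebesgue_integrable_def
  by (auto intro!: set_integrable_subset[OF locbm_set_integrable[OF assms, of "min a b" "max a b"]] simp: einterval_iff)

lemma interval_integral_combine:
  fixes a b c :: real
  assumes "\<And>a b. interval_lebesgue_integrable lborel (ereal a) (ereal b) f"
  shows "(LBINT x=ereal a..ereal b. f x) + (LBINT x=ereal b..ereal c. f x) = (LBINT x=ereal a..ereal c. f x)"
proof (rule interval_integral_sum)
  have "min (ereal a) (min (ereal b) (ereal c)) = ereal (min a (min b c))"
     "max (ereal a) (max (ereal b) (ereal c)) = ereal (max a (max b c))"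
    by (auto simp: min_def max_def)
  then show "interval_lebesgue_integrable lborel (min (ereal a) (min (ereal b) (ereal c))) (max (ereal a) (max (ereal b) (ereal c))) f"
    using assms by metis
qed

lemmas locbm_integral_combine = interval_integral_combine[OF locbm_interval_integrable]

lemma interval_integral_cong_AE_lborel:
  fixes f g :: "real \<Rightarrow> real"
  assumes "locbm f" "locbm g" "AE x in lborel. f x = g x"
  shows "interval_lebesgue_integral lborel a b f = interval_lebesgue_integral lborel a b g"
  using assms by (intro interval_integral_cong_AE) (auto dest: locbm_measurable)

lemma interval_integral_AE_bound:
  fixes a b :: real and f :: "real \<Rightarrow> real"
  assumes f: "f \<in> borel_measurable borel"
    and bd: "AE x in lborel. x \<in> {min a b..max a b} \<longrightarrow> \<bar>f x\<bar> \<le> C"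
  shows "\<bar>LBINT x=ereal a..ereal b. f x\<bar> \<le> C * \<bar>b - a\<bar>"
proof -
  have *: "\<bar>LBINT x=ereal a..ereal b. f x\<bar> \<le> C * \<bar>b - a\<bar>"
    if "a \<le> b" "AE x in lborel. x \<in> {a..b} \<longrightarrow> \<bar>f x\<bar> \<le> C" for a b
  proof -
    have bint: "set_integrable lborel {a..b} (\<lambda>x. C)"
      unfolding set_integrable_def by (rule integrable_indicator_Icc_const)
    have int: "set_integrable lborel {a..b} f"
      unfolding set_integrable_def
    proof (rule Bochner_Integration.integrable_bound)
      show "integrable lborel (\<lambda>x. indicator {a..b} x *\<^sub>R C)" using bint by (simp add: set_integrable_def)
      show "(\<lambda>x. indicator {a..b} x *\<^sub>R f x) \<in> borel_measurable lborel" using f by measurable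
      show "AE x in lborel. norm (indicator {a..b} x *\<^sub>R f x) \<le> norm (indicator {a..b} x *\<^sub>R C)"
        using that(2) by eventually_elim (auto simp: indicator_def)
    qed
    have "\<bar>LBINT x=ereal a..ereal b. f x\<bar> = norm (LINT x:{a..b}|lborel. f x)"
      using that(1) by (simp add: interval_integral_Icc)
    also have "\<dots> \<le> (LINT x:{a..b}|lborel. norm (f x))"
      by (rule set_integral_norm_bound[OF int])
    also have "\<dots> \<le> (LINT x:{a..b}|lborel. C)"
    proof (rule set_integral_mono_AE)
      show "set_integrable lborel {a..b} (\<lambda>x. norm (f x))" by (rule set_integrable_norm[OF int])
      show "AE x\<in>{a..b} in lborel. norm (f x) \<le> C" using that(2) by simp
    qed (rule bint)
    also have "\<dots> = C * \<bar>b - a\<bar>" using that(1) by (simp add: set_lebesgue_integral_def)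
    finally show ?thesis .
  qed
  show ?thesis
  proof (cases "a \<le> b")
    case True
    then show ?thesis using *[OF True] bd by (simp add: min_absorb1 max_absorb2)
  next
    case False
    have "\<bar>LBINT x=ereal a..ereal b. f x\<bar> = \<bar>LBINT x=ereal b..ereal a. f x\<bar>"
      by (subst interval_integral_endpoints_reverse) simp
    also have "\<dots> \<le> C * \<bar>a - b\<bar>" using *[of b a] False bd by (simp add: min_absorb2 max_absorb1)
    finally show ?thesis by (simp add: abs_minus_commute)
  qed
qed

lemma continuous_on_of_lipschitz_bound:
  fixes f :: "real \<Rightarrow> real"
  assumes "\<And>a b. a \<in> S \<Longrightarrow> b \<in> S \<Longrightarrow> \<bar>f b - f a\<bar> \<le> C * \<bar>b - a\<bar>"
  shows "continuous_on S f"
proof -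
  have "\<bar>C\<bar>-lipschitz_on S f"
  proof (rule lipschitz_onI)
    fix x y assume "x \<in> S" "y \<in> S"
    then have "\<bar>f x - f y\<bar> \<le> C * \<bar>x - y\<bar>" using assms by blast
    also have "\<dots> \<le> \<bar>C\<bar> * \<bar>x - y\<bar>" by (intro mult_right_mono) auto
    finally show "dist (f x) (f y) \<le> \<bar>C\<bar> * dist x y" by (simp add: dist_real_def)
  qed auto
  then show ?thesis by (rule lipschitz_on_continuous_on)
qed

lemma continuous_on_indefinite_LBINT:
  fixes g :: "real \<Rightarrow> real"
  assumes "\<And>a b. set_integrable lborel {a..b} g"
  shows "continuous_on UNIV (\<lambda>x. LBINT s=ereal a..ereal x. g s)"
proof -
  have i: "interval_lebesgue_integrable lborel (ereal a) (ereal b) g" for a b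
    unfolding interval_lebesgue_integrable_def
    by (auto intro!: set_integrable_subset[OF assms[of "min a b" "max a b"]] simp: einterval_iff)
  have "isCont (\<lambda>x. LBINT s=ereal a..ereal x. g s) x" for x
  proof -
    define R where "R = \<bar>x\<bar> + 1"
    have "g integrable_on {-R..R}" by (rule set_borel_integral_eq_integral(1)[OF assms])
    then have "continuous_on {-R..R} (\<lambda>x. (LBINT s=ereal a..ereal (-R). g s) + integral {-R..x} g)"
      by (intro continuous_intros indefinite_integral_continuous_1)
    moreover have "(LBINT s=ereal a..ereal (-R). g s) + integral {-R..y} g = (LBINT s=ereal a..ereal y. g s)" if "y \<in> {-R..R}" for y
      using interval_integral_combine[OF i, of a "-R" y] interval_integral_eq_integral[OF _ assms, of "-R" y] that by simp
    ultimately have "continuous_on {-R..R} (\<lambda>x. LBINT s=ereal a..ereal x. g s)"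
      by (rule continuous_on_eq)
    then have "continuous_on {-R<..<R} (\<lambda>x. LBINT s=ereal a..ereal x. g s)"
      by (rule continuous_on_subset) auto
    moreover have "x \<in> {-R<..<R}" by (auto simp: R_def)
    ultimately show ?thesis by (simp add: continuous_on_eq_continuous_at)
  qed
  then show ?thesis by (simp add: continuous_on_eq_continuous_at)
qed

lemmas continuous_on_indefinite_integral_locbm = continuous_on_indefinite_LBINT[OF locbm_set_integrable]

text \<open>An increment bounded by the square of the step forces a zero derivative; this replaces
  almost-everywhere differentiation of Lipschitz functions.\<close>

lemma locbm_product_rule:
  fixes f g f' g' :: "real \<Rightarrow> real"
  assumes C: "0 \<le> C" and f': "f' \<in> borel_measurable borel" "AE x in lborel. \<bar>f' x\<bar> \<le> C"
    and g': "g' \<in> borel_measurable borel" "AE x in lborel. \<bar>g' x\<bar> \<le> C"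
    and f: "\<And>x y. f y - f x = (LBINT s=ereal x..ereal y. f' s)"
    and g: "\<And>x y. g y - g x = (LBINT s=ereal x..ereal y. g' s)"
  shows "f b * g b - f a * g a = (LBINT s=ereal a..ereal b. f' s * g s + f s * g' s)"
proof -
  have lf': "locbm f'" and lg': "locbm g'" using locbm_I f' g' by blast+
  have lip: "\<bar>f y - f x\<bar> \<le> C * \<bar>y - x\<bar>" "\<bar>g y - g x\<bar> \<le> C * \<bar>y - x\<bar>" for x y
    unfolding f g
    by (rule interval_integral_AE_bound[OF f'(1)], use f'(2) in eventually_elim, simp)
      (rule interval_integral_AE_bound[OF g'(1)], use g'(2) in eventually_elim, simp)
  have cf: "continuous_on UNIV f" and cg: "continuous_on UNIV g"
    using lip by (auto intro!: continuous_on_of_lipschitz_bound)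
  then have lf: "locbm f" and lg: "locbm g" by auto
  define h where "h s = f' s * g s + f s * g' s" for s
  have lh: "locbm h" unfolding h_def using lf lg lf' lg' by auto
  define F where "F x = f x * g x - (LBINT s=ereal a..ereal x. h s)" for x
  \<comment> \<open>Freezing g at y and f at x writes the increment of the product as one integral.
    Its integrand differs from h by f' (g y - g s) - (f s - f x) g', which the Lipschitz bounds make
    at most 2 C^2 |y - x|.\<close>
  have key: "\<bar>F y - F x\<bar> \<le> 2 * C\<^sup>2 * \<bar>y - x\<bar>\<^sup>2" for x y
  proof -
    have "F y - F x = (f y - f x) * g y + f x * (g y - g x) - (LBINT s=ereal x..ereal y. h s)"
      using locbm_integral_combine[OF lh, of a x y] by (simp add: F_def algebra_simps)
    also have "(f y - f x) * g y = (LBINT s=ereal x..ereal y. f' s * g y)" using f by simp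
    also have "f x * (g y - g x) = (LBINT s=ereal x..ereal y. f x * g' s)" using g by simp
    also have "(LBINT s=ereal x..ereal y. f' s * g y) + (LBINT s=ereal x..ereal y. f x * g' s) - (LBINT s=ereal x..ereal y. h s)
       = (LBINT s=ereal x..ereal y. f' s * g y + f x * g' s - h s)"
    proof -
      have i: "interval_lebesgue_integrable lborel (ereal x) (ereal y) (\<lambda>s. f' s * g y)"
        "interval_lebesgue_integrable lborel (ereal x) (ereal y) (\<lambda>s. f x * g' s)"
        "interval_lebesgue_integrable lborel (ereal x) (ereal y) h"
        by (intro locbm_interval_integrable locbm_mult lf' lg' lh locbm_const)+
      show ?thesis
        unfolding interval_lebesgue_integral_diff(2)[OF interval_lebesgue_integral_add(1)[OF i(1,2)] i(3)]
          interval_lebesgue_integral_add(2)[OF i(1,2)] ..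
    qed
    also have "\<bar>\<dots>\<bar> \<le> 2 * C\<^sup>2 * \<bar>y - x\<bar> * \<bar>y - x\<bar>"
    proof (rule interval_integral_AE_bound)
      show "(\<lambda>s. f' s * g y + f x * g' s - h s) \<in> borel_measurable borel"
        using lf'[THEN locbm_measurable] lg'[THEN locbm_measurable] lh[THEN locbm_measurable] by measurable
      show "AE s in lborel. s \<in> {min x y..max x y} \<longrightarrow> \<bar>f' s * g y + f x * g' s - h s\<bar> \<le> 2 * C\<^sup>2 * \<bar>y - x\<bar>"
        using f'(2) g'(2)
      proof eventually_elim
        case (elim s)
        show ?case
        proof
          assume s: "s \<in> {min x y..max x y}"
          then have d: "\<bar>y - s\<bar> \<le> \<bar>y - x\<bar>" "\<bar>s - x\<bar> \<le> \<bar>y - x\<bar>" by (auto simp: min_def max_def split: if_splits)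
          have "\<bar>f' s * g y + f x * g' s - h s\<bar> = \<bar>f' s * (g y - g s) - (f s - f x) * g' s\<bar>"
            by (simp add: h_def algebra_simps)
          also have "\<dots> \<le> \<bar>f' s\<bar> * \<bar>g y - g s\<bar> + \<bar>f s - f x\<bar> * \<bar>g' s\<bar>"
            by (metis abs_mult abs_triangle_ineq4)
          also have "\<dots> \<le> C * (C * \<bar>y - x\<bar>) + (C * \<bar>y - x\<bar>) * C"
          proof (intro add_mono mult_mono)
            show "\<bar>g y - g s\<bar> \<le> C * \<bar>y - x\<bar>" by (rule order.trans[OF lip(2) mult_left_mono[OF d(1) C]])
            show "\<bar>f s - f x\<bar> \<le> C * \<bar>y - x\<bar>" by (rule order.trans[OF lip(1) mult_left_mono[OF d(2) C]])
          qed (use elim C in auto)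
          finally show "\<bar>f' s * g y + f x * g' s - h s\<bar> \<le> 2 * C\<^sup>2 * \<bar>y - x\<bar>"
            by (simp add: power2_eq_square algebra_simps)
        qed
      qed
    qed
    also have "2 * C\<^sup>2 * \<bar>y - x\<bar> * \<bar>y - x\<bar> = 2 * C\<^sup>2 * \<bar>y - x\<bar>\<^sup>2"
      unfolding power2_eq_square[of "\<bar>y - x\<bar>"] by (simp only: mult.assoc)
    finally show ?thesis .
  qed
  have "(F has_real_derivative 0) (at x)" for x
  proof -
    have "((\<lambda>y. (F y - F x) / (y - x)) \<longlongrightarrow> 0) (at x)"
    proof (rule Lim_null_comparison)
      show "\<forall>\<^sub>F y in at x. norm ((F y - F x) / (y - x)) \<le> 2 * C\<^sup>2 * \<bar>y - x\<bar>"
        unfolding eventually_at_filter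
      proof (rule always_eventually, intro allI impI)
        fix y assume "y \<noteq> x"
        show "norm ((F y - F x) / (y - x)) \<le> 2 * C\<^sup>2 * \<bar>y - x\<bar>"
        proof -
          have "\<bar>F y - F x\<bar> \<le> (2 * C\<^sup>2 * \<bar>y - x\<bar>) * \<bar>y - x\<bar>"
            using key[where x = x and y = y] unfolding power2_eq_square[of "\<bar>y - x\<bar>"] by (simp only: mult.assoc)
          then show ?thesis using \<open>y \<noteq> x\<close> by (simp add: pos_divide_le_eq)
        qed
      qed
      have "((\<lambda>y. 2 * C\<^sup>2 * \<bar>y - x\<bar>) \<longlongrightarrow> 2 * C\<^sup>2 * \<bar>x - x\<bar>) (at x)" by (intro tendsto_intros)
      then show "((\<lambda>y. 2 * C\<^sup>2 * \<bar>y - x\<bar>) \<longlongrightarrow> 0) (at x)" by simp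
    qed
    then show ?thesis by (simp add: has_field_derivative_iff)
  qed
  then have "F b = F a" by (metis DERIV_isconst_all)
  then show ?thesis by (simp add: F_def h_def)
qed

lemma continuous_on_param_integral:
  fixes f :: "real \<Rightarrow> real \<Rightarrow> real" and a b :: real
  assumes m: "\<And>t. t \<in> S \<Longrightarrow> f t \<in> borel_measurable borel"
    and c: "AE x in lborel. continuous_on S (\<lambda>t. f t x)"
    and bd: "AE x in lborel. x \<in> {min a b..max a b} \<longrightarrow> (\<forall>t\<in>S. \<bar>f t x\<bar> \<le> C)"
  shows "continuous_on S (\<lambda>t. LBINT x=ereal a..ereal b. f t x)"
proof -
  have *: "continuous_on S (\<lambda>t. LBINT x=ereal a..ereal b. f t x)"
    if ab: "a \<le> b" and bd: "AE x in lborel. x \<in> {a..b} \<longrightarrow> (\<forall>t\<in>S. \<bar>f t x\<bar> \<le> C)" for a b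
    unfolding continuous_on_sequentially
  proof (intro allI ballI impI, elim conjE)
    fix X l assume l: "l \<in> S" and X: "\<forall>n. X n \<in> S" "X \<longlonglongrightarrow> l"
    have "(\<lambda>n. LINT x|lborel. indicator {a..b} x *\<^sub>R f (X n) x) \<longlonglongrightarrow> (LINT x|lborel. indicator {a..b} x *\<^sub>R f l x)"
    proof (rule integral_dominated_convergence[where w = "\<lambda>x. indicator {a..b} x *\<^sub>R C"])
      show "(\<lambda>x. indicator {a..b} x *\<^sub>R f l x) \<in> borel_measurable lborel" using m[OF l] by measurable
      show "(\<lambda>x. indicator {a..b} x *\<^sub>R f (X n) x) \<in> borel_measurable lborel" for n
      proof -
        have "f (X n) \<in> borel_measurable borel" using m X by blast
        then show ?thesis by measurable
      qed
      show "integrable lborel (\<lambda>x. indicator {a..b} x *\<^sub>R C)"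
        by (rule integrable_indicator_Icc_const)
      show "AE x in lborel. (\<lambda>n. indicator {a..b} x *\<^sub>R f (X n) x) \<longlonglongrightarrow> indicator {a..b} x *\<^sub>R f l x"
        using c
      proof eventually_elim
        case (elim x)
        then have "(\<lambda>n. f (X n) x) \<longlonglongrightarrow> f l x"
          using X l unfolding continuous_on_sequentially comp_def by blast
        then show ?case by (intro tendsto_intros)
      qed
      show "AE x in lborel. norm (indicator {a..b} x *\<^sub>R f (X n) x) \<le> indicator {a..b} x *\<^sub>R C" for n
        using bd by eventually_elim (use X in \<open>auto simp: indicator_def\<close>)
    qed
    then show "((\<lambda>t. LBINT x=ereal a..ereal b. f t x) \<circ> X) \<longlonglongrightarrow> (LBINT x=ereal a..ereal b. f l x)"
      using ab by (simp add: interval_integral_Icc comp_def set_lebesgue_integral_def)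
  qed
  show ?thesis
  proof (cases "a \<le> b")
    case True
    then show ?thesis using *[OF True] bd by (simp add: min_absorb1 max_absorb2)
  next
    case False
    have "continuous_on S (\<lambda>t. - (LBINT x=ereal b..ereal a. f t x))"
      by (intro continuous_on_minus *) (use False bd in \<open>auto simp: min_absorb2 max_absorb1\<close>)
    then show ?thesis by (subst interval_integral_endpoints_reverse)
  qed
qed

text \<open>By the mean value inequality in t, C dominates the difference quotients as well as the
  derivative, so dominated convergence applies along every sequence of times; at 0 and T the
  derivative is one-sided.\<close>

lemma has_derivative_param_integral:
  fixes f f' :: "real \<Rightarrow> real \<Rightarrow> real" and a b :: real
  assumes m: "\<And>t. t \<in> {0..T} \<Longrightarrow> f t \<in> borel_measurable borel"
    and d: "AE x in lborel. \<forall>t\<in>{0..T}. ((\<lambda>t. f t x) has_real_derivative f' t x) (at t within {0..T})"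
    and li: "\<And>t. t \<in> {0..T} \<Longrightarrow> locbm (f t)"
    and m': "f' t \<in> borel_measurable borel"
    and bd: "AE x in lborel. x \<in> {min a b..max a b} \<longrightarrow> (\<forall>t\<in>{0..T}. \<bar>f' t x\<bar> \<le> C)"
    and t: "t \<in> {0..T}"
  shows "((\<lambda>t. LBINT x=ereal a..ereal b. f t x) has_real_derivative (LBINT x=ereal a..ereal b. f' t x)) (at t within {0..T})"
proof -
  have *: "((\<lambda>t. LBINT x=ereal a..ereal b. f t x) has_real_derivative (LBINT x=ereal a..ereal b. f' t x)) (at t within {0..T})"
    if ab: "a \<le> b" and bd: "AE x in lborel. x \<in> {a..b} \<longrightarrow> (\<forall>t\<in>{0..T}. \<bar>f' t x\<bar> \<le> C)" for a b
    unfolding has_field_derivative_iff tendsto_at_iff_sequentially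
  proof (intro allI impI)
    fix X :: "nat \<Rightarrow> real" assume X: "\<forall>i. X i \<in> {0..T} - {t}" and lim: "X \<longlonglongrightarrow> t"
    have XT: "X n \<in> {0..T}" "X n \<noteq> t" for n using X by auto
    let ?q = "\<lambda>n x. (f (X n) x - f t x) / (X n - t)"
    have "(\<lambda>n. LINT x|lborel. indicator {a..b} x *\<^sub>R ?q n x) \<longlonglongrightarrow> (LINT x|lborel. indicator {a..b} x *\<^sub>R f' t x)"
    proof (rule integral_dominated_convergence[where w = "\<lambda>x. indicator {a..b} x *\<^sub>R C"])
      show "(\<lambda>x. indicator {a..b} x *\<^sub>R f' t x) \<in> borel_measurable lborel" using m' by measurable
      show "(\<lambda>x. indicator {a..b} x *\<^sub>R ?q n x) \<in> borel_measurable lborel" for n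
        using m[OF XT(1), of n] m[OF t] by measurable
      show "integrable lborel (\<lambda>x. indicator {a..b} x *\<^sub>R C)"
        by (rule integrable_indicator_Icc_const)
      show "AE x in lborel. (\<lambda>n. indicator {a..b} x *\<^sub>R ?q n x) \<longlonglongrightarrow> indicator {a..b} x *\<^sub>R f' t x"
        using d
      proof eventually_elim
        case (elim x)
        then have "((\<lambda>s. (f s x - f t x) / (s - t)) \<longlongrightarrow> f' t x) (at t within {0..T})"
          using t by (simp add: has_field_derivative_iff)
        then have "(\<lambda>n. ?q n x) \<longlonglongrightarrow> f' t x"
          using X lim unfolding tendsto_at_iff_sequentially comp_def by blast
        then show ?case by (intro tendsto_intros)
      qed
      show "AE x in lborel. norm (indicator {a..b} x *\<^sub>R ?q n x) \<le> indicator {a..b} x *\<^sub>R C" for n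
        using bd d
      proof eventually_elim
        case (elim x)
        have "\<bar>f (X n) x - f t x\<bar> \<le> C * \<bar>X n - t\<bar>" if "x \<in> {a..b}"
          using field_differentiable_bound[of "{0..T}" "\<lambda>t. f t x" "\<lambda>t. f' t x" C "X n" t] elim that XT t
          by (auto simp: convex_real_interval)
        then show ?case using XT(2)[of n] by (auto simp: indicator_def divide_simps)
      qed
    qed
    moreover have q: "(LINT x|lborel. indicator {a..b} x *\<^sub>R ?q n x) =
        ((LBINT x=ereal a..ereal b. f (X n) x) - (LBINT x=ereal a..ereal b. f t x)) / (X n - t)" for n
    proof -
      have "(LINT x|lborel. indicator {a..b} x *\<^sub>R ?q n x) = (LBINT x=ereal a..ereal b. ?q n x)"
        using ab by (simp add: interval_integral_Icc set_lebesgue_integral_def)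
      also have "\<dots> = (LBINT x=ereal a..ereal b. f (X n) x - f t x) / (X n - t)" by simp
      also have "(LBINT x=ereal a..ereal b. f (X n) x - f t x) = (LBINT x=ereal a..ereal b. f (X n) x) - (LBINT x=ereal a..ereal b. f t x)"
        using li[OF XT(1)] li[OF t] by (intro interval_lebesgue_integral_diff) auto
      finally show ?thesis .
    qed
    moreover have q': "(LINT x|lborel. indicator {a..b} x *\<^sub>R f' t x) = (LBINT x=ereal a..ereal b. f' t x)"
      using ab by (simp add: interval_integral_Icc set_lebesgue_integral_def)
    ultimately have "(\<lambda>n. ((LBINT x=ereal a..ereal b. f (X n) x) - (LBINT x=ereal a..ereal b. f t x)) / (X n - t))
        \<longlonglongrightarrow> (LBINT x=ereal a..ereal b. f' t x)" by (simp only: q q')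
    then show "((\<lambda>s. ((LBINT x=ereal a..ereal b. f s x) - (LBINT x=ereal a..ereal b. f t x)) / (s - t)) \<circ> X)
        \<longlonglongrightarrow> (LBINT x=ereal a..ereal b. f' t x)" by (simp add: comp_def)
  qed
  show ?thesis
  proof (cases "a \<le> b")
    case True
    then show ?thesis using *[OF True] bd by (simp add: min_absorb1 max_absorb2)
  next
    case False
    have "((\<lambda>t. - (LBINT x=ereal b..ereal a. f t x)) has_real_derivative - (LBINT x=ereal b..ereal a. f' t x)) (at t within {0..T})"
      by (intro DERIV_minus *) (use False bd in \<open>auto simp: min_absorb2 max_absorb1\<close>)
    then show ?thesis
      by (simp add: interval_integral_endpoints_reverse[of "ereal a" "ereal b"])
  qed
qed

lemma interval_integral_shift:
  fixes f :: "real \<Rightarrow> real" and a b c :: real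
  shows "(LBINT x=ereal (a + c)..ereal (b + c). f x) = (LBINT x=ereal a..ereal b. f (x + c))"
proof -
  have *: "(LBINT x=ereal (a + c)..ereal (b + c). f x) = (LBINT x=ereal a..ereal b. f (x + c))" if "a \<le> b" for a b
  proof -
    have "(LINT x|lborel. indicator {a+c..b+c} x *\<^sub>R f x)
        = (LINT x|lborel. indicator {a+c..b+c} (c + 1 * x) *\<^sub>R f (c + 1 * x))"
      using lborel_integral_real_affine[of 1 "\<lambda>x. indicator {a+c..b+c} x *\<^sub>R f x" c] by simp
    also have "\<dots> = (LINT x|lborel. indicator {a..b} x *\<^sub>R f (x + c))"
      by (intro Bochner_Integration.integral_cong) (auto simp: indicator_def add.commute)
    finally show ?thesis using that by (simp add: interval_integral_Icc set_lebesgue_integral_def)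
  qed
  show ?thesis
  proof (cases "a \<le> b")
    case False
    then show ?thesis using *[of b a]
      by (subst (1 2) interval_integral_endpoints_reverse) simp
  qed (rule *)
qed

subsection \<open>Bounded periodic functions\<close>

lemma periodic1_shift: "periodic1 f \<Longrightarrow> f (x + 1) = f x"
  by (simp add: periodic1_def)

lemma interval_integral_period:
  fixes a :: real
  assumes p: "periodic1 f" and f: "\<And>a b. interval_lebesgue_integrable lborel (ereal a) (ereal b) f"
  shows "(LBINT x=ereal a..ereal (a + 1). f x) = (LBINT x=0..1. f x)"
proof -
  have "(LBINT x=ereal (0 + 1)..ereal (a + 1). f x) = (LBINT x=ereal 0..ereal a. f (x + 1))"
    by (rule interval_integral_shift)
  then have 1: "(LBINT x=ereal 1..ereal (a + 1). f x) = (LBINT x=ereal 0..ereal a. f x)"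
    using p by (simp add: periodic1_def)
  have 2: "(LBINT x=ereal a..ereal 0. f x) = - (LBINT x=ereal 0..ereal a. f x)"
    by (rule interval_integral_endpoints_reverse)
  show ?thesis
    unfolding zero_ereal_def one_ereal_def
    using interval_integral_combine[OF f, of a 0 1] interval_integral_combine[OF f, of a 1 "a + 1"] 1 2
    by linarith
qed

lemmas periodic1_integral_period = interval_integral_period[OF _ locbm_interval_integrable]

text \<open>Functions rather than classes modulo null sets, so that evaluation at a point is a bounded linear map.\<close>

typedef bmf = "{f :: real \<Rightarrow> real. periodic1 f \<and> f \<in> borel_measurable borel \<and> bounded (range f)}"
  morphisms bmf_app Bmf
  by (rule exI[of _ "\<lambda>x. 0"]) (auto simp: periodic1_def)

setup_lifting type_definition_bmf

lemma bmf_eqI: "(\<And>x. bmf_app f x = bmf_app g x) \<Longrightarrow> f = g"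
  by transfer auto

lemma bmf_app_props [simp]: "periodic1 (bmf_app f)" "bmf_app f \<in> borel_measurable borel" "bounded (range (bmf_app f))"
  using bmf_app[of f] by auto

lemma bmf_bounded: "bdd_above (range (\<lambda>x. \<bar>bmf_app f x\<bar>))"
proof -
  obtain C where "\<And>x. \<bar>bmf_app f x\<bar> \<le> C" using bmf_app_props(3)[of f] by (auto simp: bounded_iff)
  then show ?thesis by (auto intro!: bdd_aboveI)
qed

lemma bmf_mem_I:
  assumes "periodic1 f" "f \<in> borel_measurable borel" "\<And>x. \<bar>f x\<bar> \<le> C"
  shows "f \<in> {f. periodic1 f \<and> f \<in> borel_measurable borel \<and> bounded (range f)}"
  using assms by (auto simp: bounded_iff)

instantiation bmf :: real_normed_algebra
begin

lift_definition zero_bmf :: bmf is "\<lambda>x. 0" by (auto simp: periodic1_def)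
lift_definition plus_bmf :: "bmf \<Rightarrow> bmf \<Rightarrow> bmf" is "\<lambda>f g x. f x + g x"
  by (auto simp: periodic1_def intro: bounded_plus_comp)
lift_definition minus_bmf :: "bmf \<Rightarrow> bmf \<Rightarrow> bmf" is "\<lambda>f g x. f x - g x"
  by (auto simp: periodic1_def intro: bounded_minus_comp)
lift_definition uminus_bmf :: "bmf \<Rightarrow> bmf" is "\<lambda>f x. - f x"
  by (auto simp: periodic1_def)
lift_definition scaleR_bmf :: "real \<Rightarrow> bmf \<Rightarrow> bmf" is "\<lambda>c f x. c * f x"
  by (auto simp: periodic1_def intro: bounded_scaleR_comp[where 'b = real, simplified])
lift_definition times_bmf :: "bmf \<Rightarrow> bmf \<Rightarrow> bmf" is "\<lambda>f g x. f x * g x"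
proof -
  fix f g :: "real \<Rightarrow> real"
  assume "periodic1 f \<and> f \<in> borel_measurable borel \<and> bounded (range f)"
    "periodic1 g \<and> g \<in> borel_measurable borel \<and> bounded (range g)"
  moreover then obtain B C where "\<And>x. \<bar>f x\<bar> \<le> B" "\<And>x. \<bar>g x\<bar> \<le> C"
    by (auto simp: bounded_iff)
  then have "\<bar>f x * g x\<bar> \<le> \<bar>B\<bar> * \<bar>C\<bar>" for x
    unfolding abs_mult by (intro mult_mono) (auto intro: order.trans[OF _ abs_ge_self])
  then have "bounded (range (\<lambda>x. f x * g x))" by (auto simp: bounded_iff)
  ultimately show "periodic1 (\<lambda>x. f x * g x) \<and> (\<lambda>x. f x * g x) \<in> borel_measurable borel \<and> bounded (range (\<lambda>x. f x * g x))"
    by (auto simp: periodic1_def)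
qed

definition norm_bmf :: "bmf \<Rightarrow> real" where "norm_bmf f = (SUP x. \<bar>bmf_app f x\<bar>)"
definition dist_bmf :: "bmf \<Rightarrow> bmf \<Rightarrow> real" where "dist_bmf f g = norm (f - g)"
definition sgn_bmf :: "bmf \<Rightarrow> bmf" where "sgn_bmf f = inverse (norm f) *\<^sub>R f"
definition uniformity_bmf :: "(bmf \<times> bmf) filter"
  where "uniformity_bmf = (INF e\<in>{0 <..}. principal {(x, y). dist x y < e})"
definition open_bmf :: "bmf set \<Rightarrow> bool"
  where "open_bmf S = (\<forall>x\<in>S. \<forall>\<^sub>F (x', y) in uniformity. x' = x \<longrightarrow> y \<in> S)"

lemmas bmf_app_simps [simp] = zero_bmf.rep_eq plus_bmf.rep_eq minus_bmf.rep_eq uminus_bmf.rep_eq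
  scaleR_bmf.rep_eq times_bmf.rep_eq

lemma abs_bmf_app_le: "\<bar>bmf_app f x\<bar> \<le> norm f"
  unfolding norm_bmf_def by (rule cSUP_upper2[OF bmf_bounded]) auto

lemma norm_bmf_le: "(\<And>x. \<bar>bmf_app f x\<bar> \<le> C) \<Longrightarrow> norm f \<le> C"
  unfolding norm_bmf_def by (rule cSUP_least) auto

instance
proof
  fix a b :: real and f g h :: bmf
  show "f + g + h = f + (g + h)" "f + g = g + f" "0 + f = f" "- f + f = 0" "f - g = f + - g"
    "a *\<^sub>R (f + g) = a *\<^sub>R f + a *\<^sub>R g" "(a + b) *\<^sub>R f = a *\<^sub>R f + b *\<^sub>R f" "a *\<^sub>R b *\<^sub>R f = (a * b) *\<^sub>R f"
    "1 *\<^sub>R f = f" "f * g * h = f * (g * h)" "(f + g) * h = f * h + g * h" "f * (g + h) = f * g + f * h"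
    "a *\<^sub>R f * g = a *\<^sub>R (f * g)" "f * a *\<^sub>R g = a *\<^sub>R (f * g)"
    by (auto intro!: bmf_eqI simp: algebra_simps)
  show "dist f g = norm (f - g)" "sgn f = inverse (norm f) *\<^sub>R f"
    by (auto simp: dist_bmf_def sgn_bmf_def)
  show "uniformity = (INF e\<in>{0<..}. principal {(x :: bmf, y). dist x y < e})"
    by (rule uniformity_bmf_def)
  show "open U = (\<forall>x\<in>U. \<forall>\<^sub>F (x', y) in uniformity. x' = x \<longrightarrow> y \<in> U)" for U :: "bmf set"
    by (rule open_bmf_def)
  show "norm f = 0 \<longleftrightarrow> f = 0"
  proof
    assume "norm f = 0"
    then show "f = 0" using abs_bmf_app_le[of f] by (auto intro!: bmf_eqI)
  qed (auto simp: norm_bmf_def)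
  show "norm (f + g) \<le> norm f + norm g"
    by (rule norm_bmf_le) (use abs_bmf_app_le[of f] abs_bmf_app_le[of g] in
      \<open>auto intro: order.trans[OF abs_triangle_ineq] add_mono\<close>)
  show "norm (f * g) \<le> norm f * norm g"
    by (rule norm_bmf_le) (auto simp: abs_mult intro!: mult_mono abs_bmf_app_le order.trans[OF abs_ge_zero abs_bmf_app_le])
  have le: "norm (a *\<^sub>R f) \<le> \<bar>a\<bar> * norm f" for a and f :: bmf
    by (rule norm_bmf_le) (auto simp: abs_mult intro!: mult_left_mono abs_bmf_app_le)
  show "norm (a *\<^sub>R f) = \<bar>a\<bar> * norm f"
  proof (cases "a = 0")
    case True
    then show ?thesis by (simp add: norm_bmf_def)
  next
    case False
    have "(1 / a) *\<^sub>R (a *\<^sub>R f) = f" using False by (auto intro!: bmf_eqI)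
    then have "norm f \<le> \<bar>1 / a\<bar> * norm (a *\<^sub>R f)" using le[of "1/a" "a *\<^sub>R f"] by simp
    then have "\<bar>a\<bar> * norm f \<le> norm (a *\<^sub>R f)" using False by (simp add: field_simps)
    then show ?thesis using le[of a f] by simp
  qed
qed

end

lemma bounded_linear_bmf_app: "bounded_linear (\<lambda>f. bmf_app f x)"
  by (rule bounded_linear_intro[where K = 1]) (auto simp: abs_bmf_app_le)

text \<open>A Cauchy sequence in the supremum norm converges at every point, without an exceptional
  set, so the limit is again Borel and periodic; letting m tend to infinity in the Cauchy estimate
  makes the convergence uniform.\<close>

instance bmf :: banach
proof
  fix X :: "nat \<Rightarrow> bmf"
  assume X: "Cauchy X"
  have "Cauchy (\<lambda>n. bmf_app (X n) x)" for x
    by (rule bounded_linear.Cauchy[OF bounded_linear_bmf_app X])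
  then obtain g where g: "\<And>x. (\<lambda>n. bmf_app (X n) x) \<longlonglongrightarrow> g x"
    unfolding Cauchy_convergent_iff convergent_def by metis
  obtain B where B: "\<And>n. norm (X n) \<le> B"
    using cauchy_imp_bounded[OF X] by (auto simp: bounded_iff)
  have "g \<in> {f. periodic1 f \<and> f \<in> borel_measurable borel \<and> bounded (range f)}"
  proof (rule bmf_mem_I)
    show "periodic1 g"
      unfolding periodic1_def
    proof
      fix x
      have "(\<lambda>n. bmf_app (X n) (x + 1)) = (\<lambda>n. bmf_app (X n) x)"
        using bmf_app_props(1) by (simp add: periodic1_def)
      then show "g (x + 1) = g x" using g[of "x + 1"] g[of x] LIMSEQ_unique by metis
    qed
    show "g \<in> borel_measurable borel"
      by (rule borel_measurable_LIMSEQ_real[OF g]) auto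
    show "\<bar>g x\<bar> \<le> B" for x
    proof (rule LIMSEQ_le_const2[OF tendsto_rabs[OF g]])
      show "\<exists>N. \<forall>n\<ge>N. \<bar>bmf_app (X n) x\<bar> \<le> B" using B abs_bmf_app_le order.trans by blast
    qed
  qed
  then obtain G where G: "bmf_app G = g" using Bmf_inverse by blast
  have "X \<longlonglongrightarrow> G"
  proof (rule LIMSEQ_I)
    fix e :: real assume e: "0 < e"
    then obtain N where N: "\<And>m n. m \<ge> N \<Longrightarrow> n \<ge> N \<Longrightarrow> norm (X m - X n) < e / 2"
      using X unfolding Cauchy_iff by (meson half_gt_zero)
    have "norm (X n - G) \<le> e / 2" if n: "n \<ge> N" for n
    proof (rule norm_bmf_le)
      fix x
      have "(\<lambda>m. \<bar>bmf_app (X n) x - bmf_app (X m) x\<bar>) \<longlonglongrightarrow> \<bar>bmf_app (X n) x - g x\<bar>"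
        by (intro tendsto_intros g)
      moreover have "\<bar>bmf_app (X n) x - bmf_app (X m) x\<bar> \<le> e / 2" if "m \<ge> N" for m
        using N[OF n that] abs_bmf_app_le[of "X n - X m" x] by simp
      ultimately have "\<bar>bmf_app (X n) x - g x\<bar> \<le> e / 2"
        by (intro LIMSEQ_le_const2[where X = "\<lambda>m. \<bar>bmf_app (X n) x - bmf_app (X m) x\<bar>"]) blast+
      then show "\<bar>bmf_app (X n - G) x\<bar> \<le> e / 2" by (simp add: G)
    qed
    then show "\<exists>N. \<forall>n\<ge>N. norm (X n - G) < e" using e by (intro exI[of _ N]) fastforce
  qed
  then show "convergent X" by (auto simp: convergent_def)
qed

lift_definition bmf_const :: "real \<Rightarrow> bmf" is "\<lambda>c x. c" by (auto simp: periodic1_def)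

lemma bmf_const_app [simp]: "bmf_app (bmf_const c) x = c"
  by (simp add: bmf_const.rep_eq)

lemma bounded_linear_bmf_const: "bounded_linear bmf_const"
  by (rule bounded_linear_intro[where K = 1]) (auto intro!: bmf_eqI norm_bmf_le)

lemma locbm_bmf_app [simp, intro]: "locbm (bmf_app f)"
  by (rule locbm_I[of _ "norm f"]) (auto simp: abs_bmf_app_le)

definition bmf_int :: "bmf \<Rightarrow> real" where
  "bmf_int f = (LBINT x=0..1. bmf_app f x)"

lemma interval_integral_bmf_bound: "\<bar>LBINT x=ereal a..ereal b. bmf_app f x\<bar> \<le> norm f * \<bar>b - a\<bar>"
  by (rule interval_integral_AE_bound) (auto simp: abs_bmf_app_le)

text \<open>Bridges the end points 0 and 1 of the extended reals and the embedded reals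
  \<open>ereal 0\<close> and \<open>ereal 1\<close>, to which the rules with real end points
  apply.\<close>

lemma bmf_int_eq: "bmf_int f = (LBINT x=ereal 0..ereal 1. bmf_app f x)"
  by (simp only: bmf_int_def zero_ereal_def one_ereal_def)

lemma interval_integral_bmf_add:
  "(LBINT x=ereal a..ereal b. bmf_app (f + g) x) = (LBINT x=ereal a..ereal b. bmf_app f x) + (LBINT x=ereal a..ereal b. bmf_app g x)"
  unfolding bmf_app_simps by (rule interval_lebesgue_integral_add(2)) auto

lemma interval_integral_bmf_scaleR:
  "(LBINT x=ereal a..ereal b. bmf_app (c *\<^sub>R f) x) = c * (LBINT x=ereal a..ereal b. bmf_app f x)"
  unfolding bmf_app_simps by (rule interval_lebesgue_integral_mult_right)

lemma bounded_linear_bmf_int: "bounded_linear bmf_int"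
proof (rule bounded_linear_intro[where K = 1])
  show "norm (bmf_int f) \<le> norm f * 1" for f
    using interval_integral_bmf_bound[of 0 1 f] by (simp only: bmf_int_eq) simp
  show "bmf_int (f + g) = bmf_int f + bmf_int g" for f g
    unfolding bmf_int_eq by (rule interval_integral_bmf_add)
  show "bmf_int (c *\<^sub>R f) = c *\<^sub>R bmf_int f" for c f
    unfolding bmf_int_eq interval_integral_bmf_scaleR by simp
qed

lemma periodic1_add_int: "periodic1 f \<Longrightarrow> f (x + of_int n) = f x"
proof (induction n rule: int_induct[where k = 0])
  case (step1 i)
  then show ?case using periodic1_shift[of f "x + of_int i"] by (simp add: add.assoc)
next
  case (step2 i)
  then show ?case using periodic1_shift[of f "x + of_int (i - 1)"] by (simp add: add.assoc)
qed simp

lemma periodic1_frac: "periodic1 f \<Longrightarrow> f (frac x) = f x"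
  using periodic1_add_int[of f "frac x" "floor x"] by (simp add: frac_def)

text \<open>The subtracted linear term cancels the growth of the primitive over one period, so that
  a periodic f has a periodic and hence bounded primitive.\<close>

definition prim :: "(real \<Rightarrow> real) \<Rightarrow> real \<Rightarrow> real" where
  "prim f x = (LBINT s=ereal 0..ereal x. f s) - x * (LBINT s=ereal 0..ereal 1. f s)"

lemma periodic1_prim:
  assumes "periodic1 f" "locbm f"
  shows "periodic1 (prim f)"
  unfolding periodic1_def
proof
  fix x
  have "(LBINT s=ereal x..ereal (x + 1). f s) = (LBINT s=ereal 0..ereal 1. f s)"
    using periodic1_integral_period[OF assms] by (simp only: zero_ereal_def one_ereal_def)
  then show "prim f (x + 1) = prim f x"
    using locbm_integral_combine[OF assms(2), of 0 x "x + 1"] unfolding prim_def distrib_right by linarith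
qed

lemma prim_bound:
  assumes f: "periodic1 f" "f \<in> borel_measurable borel" "\<And>x. \<bar>f x\<bar> \<le> C"
  shows "\<bar>prim f x\<bar> \<le> 2 * C"
proof -
  have lf: "locbm f" using f by (auto intro!: locbm_I)
  have 0: "0 \<le> frac x" "frac x \<le> 1" using frac_lt_1[of x] by auto
  have C: "0 \<le> C" using f(3)[of 0] by simp
  have "\<bar>LBINT s=ereal 0..ereal (frac x). f s\<bar> \<le> C * \<bar>frac x - 0\<bar>"
    by (rule interval_integral_AE_bound) (use f in auto)
  moreover have "\<bar>LBINT s=ereal 0..ereal 1. f s\<bar> \<le> C * \<bar>1 - 0\<bar>"
    by (rule interval_integral_AE_bound) (use f in auto)
  then have "\<bar>frac x * (LBINT s=ereal 0..ereal 1. f s)\<bar> \<le> frac x * C"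
    unfolding abs_mult using 0 by (intro mult_mono) auto
  ultimately have "\<bar>prim f (frac x)\<bar> \<le> 2 * (C * frac x)" using 0 by (simp add: prim_def abs_le_iff mult.commute)
  also have "\<dots> \<le> 2 * C" using 0 C by (simp add: mult_left_le)
  finally show ?thesis by (simp only: periodic1_frac[OF periodic1_prim[OF f(1) lf]])
qed

lift_definition bmf_prim :: "bmf \<Rightarrow> bmf" is prim
proof -
  fix f :: "real \<Rightarrow> real"
  assume f: "periodic1 f \<and> f \<in> borel_measurable borel \<and> bounded (range f)"
  then obtain C where C: "\<And>x. \<bar>f x\<bar> \<le> C" by (auto simp: bounded_iff)
  then have lf: "locbm f" using f by (auto intro!: locbm_I)
  have "continuous_on UNIV (prim f)"
    unfolding prim_def by (intro continuous_intros continuous_on_indefinite_integral_locbm[OF lf])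
  then have "prim f \<in> borel_measurable borel" by (rule borel_measurable_continuous_onI)
  then show "periodic1 (prim f) \<and> prim f \<in> borel_measurable borel \<and> bounded (range (prim f))"
    using periodic1_prim[OF _ lf] prim_bound[of f C] C f by (auto simp: bounded_iff)
qed

lemma bmf_prim_app: "bmf_app (bmf_prim f) x = (LBINT s=ereal 0..ereal x. bmf_app f s) - x * bmf_int f"
  by (simp only: bmf_prim.rep_eq bmf_int_eq prim_def)

lemma bounded_linear_bmf_prim: "bounded_linear bmf_prim"
proof (rule bounded_linear_intro[where K = 2])
  show "bmf_prim (f + g) = bmf_prim f + bmf_prim g" for f g
  proof (rule bmf_eqI)
    fix x
    have "bmf_int (f + g) = bmf_int f + bmf_int g"
      using bounded_linear.linear[OF bounded_linear_bmf_int, THEN linear_add] .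
    then show "bmf_app (bmf_prim (f + g)) x = bmf_app (bmf_prim f + bmf_prim g) x"
      unfolding plus_bmf.rep_eq[of "bmf_prim f"] bmf_prim_app interval_integral_bmf_add
      by (simp add: distrib_left)
  qed
  show "bmf_prim (c *\<^sub>R f) = c *\<^sub>R bmf_prim f" for c f
  proof (rule bmf_eqI)
    fix x
    have "bmf_int (c *\<^sub>R f) = c * bmf_int f"
      using bounded_linear.linear[OF bounded_linear_bmf_int, THEN linear_scale] by simp
    then show "bmf_app (bmf_prim (c *\<^sub>R f)) x = bmf_app (c *\<^sub>R bmf_prim f) x"
      unfolding scaleR_bmf.rep_eq[of c "bmf_prim f"] bmf_prim_app interval_integral_bmf_scaleR
      by (simp add: right_diff_distrib)
  qed
  show "norm (bmf_prim f) \<le> norm f * 2" for f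
    unfolding mult.commute[of _ 2]
    by (rule norm_bmf_le) (auto simp: bmf_prim.rep_eq abs_bmf_app_le intro!: prim_bound)
qed

subsection \<open>The vector field\<close>

text \<open>Products are not globally Lipschitz, but this property survives sums, pairs, bounded
  linear maps and bounded bilinear maps, so for the vector field it follows from the shape of the
  formula.\<close>

definition lip_on_balls :: "('a::real_normed_vector \<Rightarrow> 'b::real_normed_vector) \<Rightarrow> bool" where
  "lip_on_balls f \<longleftrightarrow> (\<forall>R. \<exists>L. L-lipschitz_on (cball 0 R) f)"

lemma lip_on_ballsI:
  assumes "\<And>R. 0 \<le> R \<Longrightarrow> \<exists>L. \<forall>x y. norm x \<le> R \<longrightarrow> norm y \<le> R \<longrightarrow> norm (f x - f y) \<le> L * norm (x - y)"
  shows "lip_on_balls f"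
  unfolding lip_on_balls_def
proof
  fix R :: real
  show "\<exists>L. L-lipschitz_on (cball 0 R) f"
  proof (cases "0 \<le> R")
    case True
    then obtain L where L: "\<And>x y. norm x \<le> R \<Longrightarrow> norm y \<le> R \<Longrightarrow> norm (f x - f y) \<le> L * norm (x - y)"
      using assms by blast
    have "\<bar>L\<bar>-lipschitz_on (cball 0 R) f"
    proof (rule lipschitz_onI)
      fix x y :: 'a assume "x \<in> cball 0 R" "y \<in> cball 0 R"
      then have "norm (f x - f y) \<le> L * norm (x - y)" using L by auto
      also have "\<dots> \<le> \<bar>L\<bar> * norm (x - y)" by (intro mult_right_mono) auto
      finally show "dist (f x) (f y) \<le> \<bar>L\<bar> * dist x y" by (simp add: dist_norm)
    qed auto
    then show ?thesis ..
  next
    case False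
    then show ?thesis by (intro exI[of _ 0]) (auto intro!: lipschitz_onI)
  qed
qed

lemma lip_on_ballsD:
  assumes "lip_on_balls f"
  shows "\<exists>L\<ge>0. \<forall>x y. norm x \<le> R \<longrightarrow> norm y \<le> R \<longrightarrow> norm (f x - f y) \<le> L * norm (x - y)"
proof -
  obtain L where L: "L-lipschitz_on (cball 0 R) f" using assms by (auto simp: lip_on_balls_def)
  have "norm (f x - f y) \<le> L * norm (x - y)" if "norm x \<le> R" "norm y \<le> R" for x y
    using lipschitz_onD[OF L, of x y] that by (simp add: dist_norm)
  then show ?thesis using lipschitz_on_nonneg[OF L] by blast
qed

lemma lip_on_balls_bound:
  assumes "lip_on_balls f"
  shows "\<exists>B\<ge>0. \<forall>x. norm x \<le> R \<longrightarrow> norm (f x) \<le> B"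
proof -
  obtain L where L: "0 \<le> L" "\<forall>x y. norm x \<le> max 0 R \<longrightarrow> norm y \<le> max 0 R \<longrightarrow> norm (f x - f y) \<le> L * norm (x - y)"
    using lip_on_ballsD[OF assms, of "max 0 R"] by blast
  have "norm (f x) \<le> norm (f 0) + L * \<bar>R\<bar>" if "norm x \<le> R" for x
  proof -
    have "norm (f x) \<le> norm (f 0) + norm (f x - f 0)" by (rule norm_triangle_sub)
    also have "norm (f x - f 0) \<le> L * norm (x - 0)" using L(2)[rule_format, of x 0] that by simp
    also have "\<dots> \<le> L * \<bar>R\<bar>" using that L(1) by (intro mult_left_mono) auto
    finally show ?thesis by simp
  qed
  then show ?thesis using L(1) by (intro exI[of _ "norm (f 0) + L * \<bar>R\<bar>"]) auto
qed

lemma lip_on_balls_linear: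
  assumes "bounded_linear f" shows "lip_on_balls f"
proof (rule lip_on_ballsI)
  obtain K where K: "\<And>x. norm (f x) \<le> norm x * K" using assms bounded_linear.bounded by blast
  show "\<exists>L. \<forall>x y. norm x \<le> R \<longrightarrow> norm y \<le> R \<longrightarrow> norm (f x - f y) \<le> L * norm (x - y)" for R
    using K[of "_ - _"] bounded_linear.linear[OF assms, THEN linear_diff]
    by (intro exI[of _ K]) (auto simp: mult.commute)
qed

lemma lip_on_balls_linear_comp:
  assumes g: "bounded_linear g" and f: "lip_on_balls f" shows "lip_on_balls (\<lambda>x. g (f x))"
proof (rule lip_on_ballsI)
  fix R :: real
  obtain K where K: "0 \<le> K" "\<And>x. norm (g x) \<le> norm x * K" using bounded_linear.nonneg_bounded[OF g] by blast
  obtain L where L: "0 \<le> L" "\<forall>x y. norm x \<le> R \<longrightarrow> norm y \<le> R \<longrightarrow> norm (f x - f y) \<le> L * norm (x - y)"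
    using lip_on_ballsD[OF f, of R] by blast
  have "norm (g (f x) - g (f y)) \<le> (L * K) * norm (x - y)" if "norm x \<le> R" "norm y \<le> R" for x y
  proof -
    have "norm (g (f x) - g (f y)) = norm (g (f x - f y))"
      by (simp add: bounded_linear.linear[OF g, THEN linear_diff])
    also have "\<dots> \<le> norm (f x - f y) * K" by (rule K)
    also have "\<dots> \<le> L * norm (x - y) * K" using L(2) that K(1) by (intro mult_right_mono) blast+
    finally show ?thesis by (simp add: mult_ac)
  qed
  then show "\<exists>L. \<forall>x y. norm x \<le> R \<longrightarrow> norm y \<le> R \<longrightarrow> norm (g (f x) - g (f y)) \<le> L * norm (x - y)" by blast
qed

lemma lip_on_balls_add:
  assumes f: "lip_on_balls f" and g: "lip_on_balls g" shows "lip_on_balls (\<lambda>x. f x + g x)"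
proof (rule lip_on_ballsI)
  fix R :: real
  obtain L where L: "\<forall>x y. norm x \<le> R \<longrightarrow> norm y \<le> R \<longrightarrow> norm (f x - f y) \<le> L * norm (x - y)"
    using lip_on_ballsD[OF f, of R] by blast
  obtain M where M: "\<forall>x y. norm x \<le> R \<longrightarrow> norm y \<le> R \<longrightarrow> norm (g x - g y) \<le> M * norm (x - y)"
    using lip_on_ballsD[OF g, of R] by blast
  have "norm (f x + g x - (f y + g y)) \<le> (L + M) * norm (x - y)" if "norm x \<le> R" "norm y \<le> R" for x y
  proof -
    have "norm (f x + g x - (f y + g y)) = norm ((f x - f y) + (g x - g y))" by (simp add: algebra_simps)
    also have "\<dots> \<le> norm (f x - f y) + norm (g x - g y)" by (rule norm_triangle_ineq)
    also have "\<dots> \<le> L * norm (x - y) + M * norm (x - y)" using L M that by (intro add_mono) blast+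
    finally show ?thesis by (simp add: distrib_right)
  qed
  then show "\<exists>L. \<forall>x y. norm x \<le> R \<longrightarrow> norm y \<le> R \<longrightarrow> norm (f x + g x - (f y + g y)) \<le> L * norm (x - y)" by blast
qed

lemma lip_on_balls_uminus: "lip_on_balls f \<Longrightarrow> lip_on_balls (\<lambda>x. - f x)"
  by (rule lip_on_balls_linear_comp[of uminus]) (auto intro: bounded_linear_minus)

lemma lip_on_balls_diff: "lip_on_balls f \<Longrightarrow> lip_on_balls g \<Longrightarrow> lip_on_balls (\<lambda>x. f x - g x)"
  using lip_on_balls_add[OF _ lip_on_balls_uminus] by simp

lemma lip_on_balls_bilinear:
  assumes b: "bounded_bilinear b" and f: "lip_on_balls f" and g: "lip_on_balls g"
  shows "lip_on_balls (\<lambda>x. b (f x) (g x))"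
proof (rule lip_on_ballsI)
  interpret bounded_bilinear b by (rule b)
  fix R :: real
  obtain K where K: "0 \<le> K" "\<And>x y. norm (b x y) \<le> norm x * norm y * K" using nonneg_bounded by blast
  obtain L where L: "0 \<le> L" "\<forall>x y. norm x \<le> R \<longrightarrow> norm y \<le> R \<longrightarrow> norm (f x - f y) \<le> L * norm (x - y)"
    using lip_on_ballsD[OF f, of R] by blast
  obtain M where M: "0 \<le> M" "\<forall>x y. norm x \<le> R \<longrightarrow> norm y \<le> R \<longrightarrow> norm (g x - g y) \<le> M * norm (x - y)"
    using lip_on_ballsD[OF g, of R] by blast
  obtain B where B: "0 \<le> B" "\<forall>x. norm x \<le> R \<longrightarrow> norm (f x) \<le> B"
    using lip_on_balls_bound[OF f, of R] by blast
  obtain C where C: "0 \<le> C" "\<forall>x. norm x \<le> R \<longrightarrow> norm (g x) \<le> C"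
    using lip_on_balls_bound[OF g, of R] by blast
  have "norm (b (f x) (g x) - b (f y) (g y)) \<le> (L * C * K + B * M * K) * norm (x - y)"
    if x: "norm x \<le> R" and y: "norm y \<le> R" for x y
  proof -
    have "b (f x) (g x) - b (f y) (g y) = b (f x - f y) (g x) + b (f y) (g x - g y)"
      by (simp add: diff_left diff_right)
    also have "norm \<dots> \<le> norm (b (f x - f y) (g x)) + norm (b (f y) (g x - g y))"
      by (rule norm_triangle_ineq)
    also have "\<dots> \<le> norm (f x - f y) * norm (g x) * K + norm (f y) * norm (g x - g y) * K"
      by (intro add_mono K)
    also have "\<dots> \<le> (L * norm (x - y)) * C * K + B * (M * norm (x - y)) * K"
      by (intro add_mono mult_right_mono mult_mono L(2)[rule_format] M(2)[rule_format]
          B(2)[rule_format] C(2)[rule_format] x y) (use K B L in auto)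
    finally show ?thesis by (simp add: algebra_simps)
  qed
  then show "\<exists>L. \<forall>x y. norm x \<le> R \<longrightarrow> norm y \<le> R \<longrightarrow> norm (b (f x) (g x) - b (f y) (g y)) \<le> L * norm (x - y)"
    by blast
qed

lemma lip_on_balls_Pair:
  assumes f: "lip_on_balls f" and g: "lip_on_balls g" shows "lip_on_balls (\<lambda>x. (f x, g x))"
proof (rule lip_on_ballsI)
  fix R :: real
  obtain L where L: "\<forall>x y. norm x \<le> R \<longrightarrow> norm y \<le> R \<longrightarrow> norm (f x - f y) \<le> L * norm (x - y)"
    using lip_on_ballsD[OF f, of R] by blast
  obtain M where M: "\<forall>x y. norm x \<le> R \<longrightarrow> norm y \<le> R \<longrightarrow> norm (g x - g y) \<le> M * norm (x - y)"
    using lip_on_ballsD[OF g, of R] by blast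
  have "norm ((f x, g x) - (f y, g y)) \<le> (L + M) * norm (x - y)" if "norm x \<le> R" "norm y \<le> R" for x y
  proof -
    have "norm ((f x, g x) - (f y, g y)) = norm (f x - f y, g x - g y)" by simp
    also have "\<dots> \<le> norm (f x - f y) + norm (g x - g y)" by (rule norm_Pair_le)
    also have "\<dots> \<le> L * norm (x - y) + M * norm (x - y)" using L M that by (intro add_mono) blast+
    finally show ?thesis by (simp add: distrib_right)
  qed
  then show "\<exists>L. \<forall>x y. norm x \<le> R \<longrightarrow> norm y \<le> R \<longrightarrow> norm ((f x, g x) - (f y, g y)) \<le> L * norm (x - y)" by blast
qed

type_synonym state = "bmf \<times> bmf \<times> bmf \<times> bmf \<times> bmf"

abbreviation cg :: "state \<Rightarrow> bmf" where "cg Z \<equiv> fst Z"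
abbreviation cU :: "state \<Rightarrow> bmf" where "cU Z \<equiv> fst (snd Z)"
abbreviation cV :: "state \<Rightarrow> bmf" where "cV Z \<equiv> fst (snd (snd Z))"
abbreviation cW :: "state \<Rightarrow> bmf" where "cW Z \<equiv> fst (snd (snd (snd Z)))"
abbreviation cQ :: "state \<Rightarrow> bmf" where "cQ Z \<equiv> snd (snd (snd (snd Z)))"

abbreviation gam_of :: "state \<Rightarrow> real \<Rightarrow> real" where "gam_of Z \<equiv> bmf_app (cg Z)"
abbreviation U_of :: "state \<Rightarrow> real \<Rightarrow> real" where "U_of Z \<equiv> bmf_app (cU Z)"
abbreviation V_of :: "state \<Rightarrow> real \<Rightarrow> real" where "V_of Z \<equiv> bmf_app (cV Z)"
abbreviation W_of :: "state \<Rightarrow> real \<Rightarrow> real" where "W_of Z \<equiv> bmf_app (cW Z)"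
abbreviation Q_of :: "state \<Rightarrow> real \<Rightarrow> real" where "Q_of Z \<equiv> bmf_app (cQ Z)"

definition omf :: "state \<Rightarrow> bmf" where
  "omf Z = 2 *\<^sub>R (cU Z * cQ Z * cV Z) - cU Z * cQ Z"

text \<open>At time 0, QV is the density of y0, so the weight is (1 - u0x^2) composed with y0 times
  that density; this is the source of its mean 1 - h. Since \<open>omf\<close> is U times this
  weight, P(1) is a weighted mean of U.\<close>

definition wgt :: "state \<Rightarrow> bmf" where
  "wgt Z = 2 *\<^sub>R (cQ Z * cV Z) - cQ Z"

definition pf :: "state \<Rightarrow> real" where "pf Z = bmf_int (omf Z)"

text \<open>K(xi) - P(1)(gamma(xi) + xi) with base point 0: the term P(1) xi turns the primitive into a periodic function.\<close>

definition Gf :: "state \<Rightarrow> bmf" where "Gf Z = bmf_prim (omf Z) - pf Z *\<^sub>R cg Z"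

text \<open>Written with the algebra operations, the scalar \<open>pf\<close> and the linear maps
  \<open>bmf_int\<close>, \<open>bmf_prim\<close> and \<open>bmf_const\<close>, so that the closure
  rules of \<open>lip_on_balls\<close> can take it apart.\<close>

definition vecfield :: "real \<Rightarrow> state \<Rightarrow> state" where
  "vecfield h Z =
    (- (cU Z * cU Z),
     Gf Z - (1 / (1 - h)) *\<^sub>R bmf_const (bmf_int (wgt Z * Gf Z)),
     pf Z *\<^sub>R (2 *\<^sub>R (cW Z * cV Z)) - 2 *\<^sub>R (cU Z * cW Z),
     2 *\<^sub>R (cU Z * cV Z) - cU Z - pf Z *\<^sub>R (2 *\<^sub>R (cV Z * cV Z)) + pf Z *\<^sub>R cV Z,
     - (pf Z *\<^sub>R (2 *\<^sub>R (cW Z * cQ Z))))"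

lemma lip_components:
  "lip_on_balls cg" "lip_on_balls cU" "lip_on_balls cV" "lip_on_balls cW" "lip_on_balls cQ"
  by (intro lip_on_balls_linear bounded_linear_fst bounded_linear_snd
      bounded_linear_fst_comp bounded_linear_snd_comp bounded_linear_ident)+

lemma lip_vecfield: "lip_on_balls (vecfield h)"
proof -
  note I = lip_on_balls_diff lip_on_balls_add lip_on_balls_uminus lip_on_balls_Pair
    lip_on_balls_bilinear[OF bounded_bilinear_mult]
    lip_on_balls_bilinear[OF bounded_bilinear_scaleR]
    lip_on_balls_linear_comp[OF bounded_linear_scaleR_right]
    lip_components
  have om: "lip_on_balls omf" unfolding omf_def by (intro I)
  have w: "lip_on_balls wgt" unfolding wgt_def by (intro I)
  have p: "lip_on_balls pf"
    unfolding pf_def by (rule lip_on_balls_linear_comp[OF bounded_linear_bmf_int om])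
  have G: "lip_on_balls Gf" unfolding Gf_def
    by (intro I p lip_on_balls_linear_comp[OF bounded_linear_bmf_prim om])
  show ?thesis unfolding vecfield_def
    by (intro I p G w lip_on_balls_linear_comp[OF bounded_linear_bmf_const]
       lip_on_balls_linear_comp[OF bounded_linear_bmf_int])
qed

lemma omf_app [simp]: "bmf_app (omf Z) x = 2 * U_of Z x * Q_of Z x * V_of Z x
    - U_of Z x * Q_of Z x"
  by (simp add: omf_def mult_ac)

lemma wgt_app [simp]: "bmf_app (wgt Z) x = 2 * Q_of Z x * V_of Z x - Q_of Z x"
  by (simp add: wgt_def mult_ac)

lemma pf_eq: "pf Z = P1 (U_of Z) (V_of Z) (Q_of Z)"
  by (simp add: pf_def bmf_int_def P1_def)

lemma Gf_app: "bmf_app (Gf Z) x = Kf (U_of Z) (V_of Z) (Q_of Z) 0 x -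
    P1 (U_of Z) (V_of Z) (Q_of Z) * (gam_of Z x + x)"
  by (simp add: Gf_def bmf_prim_app Kf_def pf_eq pf_def[symmetric] algebra_simps)

lemma vecfield_app:
  "gam_of (vecfield h Z) x = rhs_gamma (U_of Z) x"
  "U_of (vecfield h Z) x =
     rhs_U h (gam_of Z) (U_of Z) (V_of Z) (Q_of Z) 0 x"
  "V_of (vecfield h Z) x = rhs_V (U_of Z) (V_of Z) (W_of Z) (Q_of Z) x"
  "W_of (vecfield h Z) x = rhs_W (U_of Z) (V_of Z) (Q_of Z) x"
  "Q_of (vecfield h Z) x = rhs_Q (U_of Z) (V_of Z) (W_of Z) (Q_of Z) x"
  by (auto simp: vecfield_def rhs_gamma_def rhs_U_def rhs_V_def rhs_W_def rhs_Q_def power2_eq_square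
      pf_eq bmf_int_def Gf_app algebra_simps)

subsection \<open>Invariants of the flow\<close>

lemmas locbm_intros = locbm_interval_integrable locbm_add locbm_diff locbm_mult locbm_const

text \<open>The pointwise identities hold off a null set only, and their use over one period
  [e, e + 1] requires both end points to be good. The union of N with its translate by -1 is null
  and so cannot be the whole line.\<close>

lemma ex_notin_null_set_shift:
  assumes "N \<in> null_sets lborel"
  obtains e :: real where "e \<notin> N" "e + 1 \<notin> N"
proof -
  have "{x. x + 1 \<in> N} \<in> null_sets lborel"
    using null_sets_translation[OF assms, of "-1"] by simp
  then have "AE x in lborel. x \<notin> N \<and> x + 1 \<notin> N"
    using AE_not_in[OF assms] AE_not_in[of "{x. x + 1 \<in> N}"] by auto
  then have "\<exists>x::real. x \<notin> N \<and> x + 1 \<notin> N"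
    using eventually_happens[of "\<lambda>x. x \<notin> N \<and> x + 1 \<notin> N" "ae_filter (lborel :: real measure)"]
      ae_filter_eq_bot_iff[of "lborel :: real measure"] by auto
  then show ?thesis using that by blast
qed

text \<open>One null set serves all times, so that at a fixed point outside it the functions of t
  are bounded on the whole interval. For the solution of the differential equation it is
  empty.\<close>

locale bounded_family =
  fixes N :: "real set" and T C :: real and gam U V W Q :: "real \<Rightarrow> real \<Rightarrow> real"
  assumes null: "N \<in> null_sets lborel" and T: "0 \<le> T" and C: "0 \<le> C"
    and meas: "\<And>t. t \<in> {0..T} \<Longrightarrow> gam t \<in> borel_measurable borel"
      "\<And>t. t \<in> {0..T} \<Longrightarrow> U t \<in> borel_measurable borel" "\<And>t. t \<in> {0..T} \<Longrightarrow> V t \<in> borel_measurable borel"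
      "\<And>t. t \<in> {0..T} \<Longrightarrow> W t \<in> borel_measurable borel" "\<And>t. t \<in> {0..T} \<Longrightarrow> Q t \<in> borel_measurable borel"
    and per: "\<And>t. t \<in> {0..T} \<Longrightarrow> periodic1 (gam t)" "\<And>t. t \<in> {0..T} \<Longrightarrow> periodic1 (U t)"
      "\<And>t. t \<in> {0..T} \<Longrightarrow> periodic1 (V t)" "\<And>t. t \<in> {0..T} \<Longrightarrow> periodic1 (W t)" "\<And>t. t \<in> {0..T} \<Longrightarrow> periodic1 (Q t)"
    and bd: "\<And>t x. t \<in> {0..T} \<Longrightarrow> x \<notin> N \<Longrightarrow> \<bar>gam t x\<bar> \<le> C" "\<And>t x. t \<in> {0..T} \<Longrightarrow> x \<notin> N \<Longrightarrow> \<bar>U t x\<bar> \<le> C"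
      "\<And>t x. t \<in> {0..T} \<Longrightarrow> x \<notin> N \<Longrightarrow> \<bar>V t x\<bar> \<le> C" "\<And>t x. t \<in> {0..T} \<Longrightarrow> x \<notin> N \<Longrightarrow> \<bar>W t x\<bar> \<le> C"
      "\<And>t x. t \<in> {0..T} \<Longrightarrow> x \<notin> N \<Longrightarrow> \<bar>Q t x\<bar> \<le> C"
begin

lemma AE_N: "AE x in lborel. x \<notin> N"
  using null by (rule AE_not_in)

lemma locbm: "t \<in> {0..T} \<Longrightarrow> locbm (gam t)" "t \<in> {0..T} \<Longrightarrow> locbm (U t)" "t \<in> {0..T} \<Longrightarrow> locbm (V t)"
    "t \<in> {0..T} \<Longrightarrow> locbm (W t)" "t \<in> {0..T} \<Longrightarrow> locbm (Q t)"
  using AE_N by (auto intro!: locbm_I[where C = C] meas elim!: eventually_mono simp: bd)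

lemma omega_bound:
  assumes t: "t \<in> {0..T}" and s: "s \<notin> N"
  shows "\<bar>2 * U t s * Q t s * V t s - U t s * Q t s\<bar> \<le> 2 * C * C * C + C * C"
proof -
  have "\<bar>2 * U t s * Q t s * V t s - U t s * Q t s\<bar> \<le> 2 * \<bar>U t s\<bar> * \<bar>Q t s\<bar> * \<bar>V t s\<bar> + \<bar>U t s\<bar> * \<bar>Q t s\<bar>"
    by (rule order.trans[OF abs_triangle_ineq4]) (simp add: abs_mult)
  also have "\<dots> \<le> 2 * C * C * C + C * C"
    using bd[OF t s] C by (intro add_mono mult_mono) auto
  finally show ?thesis .
qed

end

text \<open>Only differences of U are prescribed: they are insensitive to the terms of the equation that do not
  depend on xi, among them the contribution of the base point of K.\<close>

locale lagrangian_flow = bounded_family +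
  fixes h :: real
  assumes dgam: "\<And>t x. t \<in> {0..T} \<Longrightarrow> x \<notin> N \<Longrightarrow>
      ((\<lambda>t. gam t x) has_real_derivative rhs_gamma (U t) x) (at t within {0..T})"
    and dU: "\<And>t x e. t \<in> {0..T} \<Longrightarrow> x \<notin> N \<Longrightarrow> e \<notin> N \<Longrightarrow>
      ((\<lambda>t. U t x - U t e) has_real_derivative
        Kf (U t) (V t) (Q t) e x - P1 (U t) (V t) (Q t) * (gam t x + x - (gam t e + e))) (at t within {0..T})"
    and dV: "\<And>t x. t \<in> {0..T} \<Longrightarrow> x \<notin> N \<Longrightarrow>
      ((\<lambda>t. V t x) has_real_derivative rhs_V (U t) (V t) (W t) (Q t) x) (at t within {0..T})"
    and dW: "\<And>t x. t \<in> {0..T} \<Longrightarrow> x \<notin> N \<Longrightarrow>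
      ((\<lambda>t. W t x) has_real_derivative rhs_W (U t) (V t) (Q t) x) (at t within {0..T})"
    and dQ: "\<And>t x. t \<in> {0..T} \<Longrightarrow> x \<notin> N \<Longrightarrow>
      ((\<lambda>t. Q t x) has_real_derivative rhs_Q (U t) (V t) (W t) (Q t) x) (at t within {0..T})"
    and init_VW: "\<And>x. x \<notin> N \<Longrightarrow> (V 0 x)\<^sup>2 + (W 0 x)\<^sup>2 = V 0 x"
    and init_y: "\<And>x e. x \<notin> N \<Longrightarrow> e \<notin> N \<Longrightarrow>
      gam 0 x + x - (gam 0 e + e) = (LBINT s=ereal e..ereal x. Q 0 s * V 0 s)"
    and init_U: "\<And>x e. x \<notin> N \<Longrightarrow> e \<notin> N \<Longrightarrow> U 0 x - U 0 e = (LBINT s=ereal e..ereal x. Q 0 s * W 0 s)"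
    and init_Q: "(LBINT s=0..1. Q 0 s) = 1 + h"
begin

abbreviation "p t \<equiv> P1 (U t) (V t) (Q t)"

text \<open>Both equations share the factor U - V P(1): they read V' = -2 W (U - V P(1)) and W' =
  (2V - 1) (U - V P(1)). Hence (V, W) moves on a circle about (1/2, 0), and the initial data select
  the one of radius 1/2, which also yields the bounds on V and W.\<close>

lemma VW_circle:
  assumes "t \<in> {0..T}" "x \<notin> N"
  shows "(V t x)\<^sup>2 + (W t x)\<^sup>2 = V t x"
proof -
  have "\<exists>c. \<forall>t\<in>{0..T}. (V t x)\<^sup>2 + (W t x)\<^sup>2 - V t x = c"
  proof (rule has_field_derivative_zero_constant)
    fix t assume t: "t \<in> {0..T}"
    show "((\<lambda>t. (V t x)\<^sup>2 + (W t x)\<^sup>2 - V t x) has_real_derivative 0) (at t within {0..T})"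
      by (rule derivative_eq_intros dV[OF t assms(2)] dW[OF t assms(2)] refl)+
        (simp add: rhs_V_def rhs_W_def algebra_simps power2_eq_square)
  qed simp
  then have "(V t x)\<^sup>2 + (W t x)\<^sup>2 - V t x = (V 0 x)\<^sup>2 + (W 0 x)\<^sup>2 - V 0 x"
    using assms(1) T by (metis atLeastAtMost_iff order_refl)
  then show ?thesis using init_VW[OF assms(2)] by simp
qed

lemma VW_bounds:
  assumes "t \<in> {0..T}" "x \<notin> N"
  shows "0 \<le> V t x" "V t x \<le> 1" "\<bar>W t x\<bar> \<le> 1/2"
proof -
  note e = VW_circle[OF assms]
  show "0 \<le> V t x" using e by (metis sum_power2_ge_zero)
  have "V t x * V t x \<le> V t x" using e zero_le_power2[of "W t x"] unfolding power2_eq_square by linarith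
  then show "V t x \<le> 1" using \<open>0 \<le> V t x\<close> by (cases "V t x = 0") auto
  have "(W t x)\<^sup>2 + (V t x - 1/2)\<^sup>2 = (1/2)\<^sup>2" using e by (simp add: power2_eq_square algebra_simps)
  then have "(W t x)\<^sup>2 \<le> (1/2)\<^sup>2" using zero_le_power2[of "V t x - 1/2"] by linarith
  then show "\<bar>W t x\<bar> \<le> 1/2" by (simp add: abs_le_square_iff[symmetric])
qed

text \<open>The P(1) terms cancel. If QV = y_xi and QW = U_xi, this is the xi-derivative of y_t =
  -U^2.\<close>

lemma dQV:
  assumes "t \<in> {0..T}" "x \<notin> N"
  shows "((\<lambda>t. Q t x * V t x) has_real_derivative - 2 * U t x * Q t x * W t x) (at t within {0..T})"
  by (rule derivative_eq_intros dV[OF assms] dQ[OF assms] refl)+ (simp add: rhs_V_def rhs_Q_def algebra_simps)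

text \<open>The circle identity turns V - 2 (V^2 + W^2) into -V. If QV = y_xi and QW = U_xi, the
  result is the xi-derivative of the equation for U, whose normalising integral does not depend on
  xi.\<close>

lemma dQW:
  assumes "t \<in> {0..T}" "x \<notin> N"
  shows "((\<lambda>t. Q t x * W t x) has_real_derivative
    2 * U t x * Q t x * V t x - U t x * Q t x - p t * (Q t x * V t x)) (at t within {0..T})"
proof -
  have "((\<lambda>t. Q t x * W t x) has_real_derivative
      rhs_Q (U t) (V t) (W t) (Q t) x * W t x + rhs_W (U t) (V t) (Q t) x * Q t x) (at t within {0..T})"
    by (intro DERIV_mult dQ dW assms)
  also have "rhs_Q (U t) (V t) (W t) (Q t) x * W t x + rhs_W (U t) (V t) (Q t) x * Q t x
     = 2 * U t x * Q t x * V t x - U t x * Q t x + p t * Q t x * (V t x - 2 * ((V t x)\<^sup>2 + (W t x)\<^sup>2))"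
    by (simp add: rhs_Q_def rhs_W_def algebra_simps power2_eq_square)
  also have "\<dots> = 2 * U t x * Q t x * V t x - U t x * Q t x - p t * (Q t x * V t x)"
    unfolding VW_circle[OF assms] by (simp add: algebra_simps)
  finally show ?thesis .
qed

lemma p_bound:
  assumes "t \<in> {0..T}"
  shows "\<bar>p t\<bar> \<le> 2 * C * C * C + C * C"
proof -
  have "\<bar>LBINT z=ereal 0..ereal 1. 2 * U t z * Q t z * V t z - U t z * Q t z\<bar> \<le> (2 * C * C * C + C * C) * \<bar>1 - 0\<bar>"
  proof (rule interval_integral_AE_bound)
    show "(\<lambda>z. 2 * U t z * Q t z * V t z - U t z * Q t z) \<in> borel_measurable borel"
      using meas[OF assms] by measurable
    show "AE z in lborel. z \<in> {min 0 1..max 0 1} \<longrightarrow> \<bar>2 * U t z * Q t z * V t z - U t z * Q t z\<bar> \<le> 2 * C * C * C + C * C"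
      using AE_N by eventually_elim (use omega_bound[OF assms] in blast)
  qed
  then show ?thesis unfolding P1_def zero_ereal_def one_ereal_def by simp
qed

lemma dint_QV:
  assumes "t \<in> {0..T}"
  shows "((\<lambda>t. LBINT s=ereal e..ereal x. Q t s * V t s) has_real_derivative
    (LBINT s=ereal e..ereal x. - 2 * U t s * Q t s * W t s)) (at t within {0..T})"
proof (rule has_derivative_param_integral[where C = "2 * C * C * C", OF _ _ _ _ _ assms])
  show "(\<lambda>s. Q t s * V t s) \<in> borel_measurable borel" if "t \<in> {0..T}" for t using meas[OF that] by measurable
  show "(\<lambda>s. - 2 * U t s * Q t s * W t s) \<in> borel_measurable borel" using meas[OF assms] by measurable
  show "locbm (\<lambda>s. Q t s * V t s)" if "t \<in> {0..T}" for t using locbm[OF that] by auto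
  show "AE s in lborel. \<forall>t\<in>{0..T}. ((\<lambda>t. Q t s * V t s) has_real_derivative - 2 * U t s * Q t s * W t s) (at t within {0..T})"
    using AE_N by eventually_elim (blast intro: dQV)
  show "AE s in lborel. s \<in> {min e x..max e x} \<longrightarrow> (\<forall>t\<in>{0..T}. \<bar>- 2 * U t s * Q t s * W t s\<bar> \<le> 2 * C * C * C)"
    using AE_N
  proof eventually_elim
    case (elim s)
    then show ?case using bd C by (auto simp: abs_mult intro!: mult_mono)
  qed
qed

lemma dint_QW:
  assumes "t \<in> {0..T}"
  shows "((\<lambda>t. LBINT s=ereal e..ereal x. Q t s * W t s) has_real_derivative
    (LBINT s=ereal e..ereal x. 2 * U t s * Q t s * V t s - U t s * Q t s - p t * (Q t s * V t s))) (at t within {0..T})"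
proof (rule has_derivative_param_integral[where C = "2 * C * C * C + C * C + (2 * C * C * C + C * C) * (C * C)", OF _ _ _ _ _ assms])
  show "(\<lambda>s. Q t s * W t s) \<in> borel_measurable borel" if "t \<in> {0..T}" for t using meas[OF that] by measurable
  show "(\<lambda>s. 2 * U t s * Q t s * V t s - U t s * Q t s - p t * (Q t s * V t s)) \<in> borel_measurable borel"
    using meas[OF assms] by measurable
  show "locbm (\<lambda>s. Q t s * W t s)" if "t \<in> {0..T}" for t using locbm[OF that] by auto
  show "AE s in lborel. \<forall>t\<in>{0..T}. ((\<lambda>t. Q t s * W t s) has_real_derivative
      2 * U t s * Q t s * V t s - U t s * Q t s - p t * (Q t s * V t s)) (at t within {0..T})"
    using AE_N by eventually_elim (blast intro: dQW)
  show "AE s in lborel. s \<in> {min e x..max e x} \<longrightarrow> (\<forall>t\<in>{0..T}.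
      \<bar>2 * U t s * Q t s * V t s - U t s * Q t s - p t * (Q t s * V t s)\<bar>
        \<le> 2 * C * C * C + C * C + (2 * C * C * C + C * C) * (C * C))"
    using AE_N
  proof (eventually_elim, intro impI ballI)
    fix s t assume s: "s \<notin> N" and t: "t \<in> {0..T}"
    have "\<bar>2 * U t s * Q t s * V t s - U t s * Q t s - p t * (Q t s * V t s)\<bar>
      \<le> 2 * \<bar>U t s\<bar> * \<bar>Q t s\<bar> * \<bar>V t s\<bar> + \<bar>U t s\<bar> * \<bar>Q t s\<bar> + \<bar>p t\<bar> * (\<bar>Q t s\<bar> * \<bar>V t s\<bar>)"
      by (rule order.trans[OF abs_triangle_ineq4], rule add_mono, rule order.trans[OF abs_triangle_ineq4])
        (simp_all add: abs_mult)
    also have "\<dots> \<le> 2 * C * C * C + C * C + (2 * C * C * C + C * C) * (C * C)"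
      using bd[OF t s] C p_bound[OF t] by (intro add_mono mult_mono) auto
    finally show "\<bar>2 * U t s * Q t s * V t s - U t s * Q t s - p t * (Q t s * V t s)\<bar>
        \<le> 2 * C * C * C + C * C + (2 * C * C * C + C * C) * (C * C)" .
  qed
qed

text \<open>\<open>Adef\<close> and \<open>Bdef\<close> measure the failure of y_xi = QV and U_xi =
  QW, integrated between two points so that no derivative in xi is taken. Both vanish at time 0 off
  N.\<close>

definition "Adef t x e = gam t x + x - (gam t e + e) - (LBINT s=ereal e..ereal x. Q t s * V t s)"
definition "Bdef t x e = U t x - U t e - (LBINT s=ereal e..ereal x. Q t s * W t s)"

text \<open>The time derivative of int QW contains exactly the K that drives the difference of U.
  After this cancellation only P(1) times the defect of y survives.\<close>

lemma dB:
  assumes t: "t \<in> {0..T}" and x: "x \<notin> N" "e \<notin> N"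
  shows "((\<lambda>t. Bdef t x e) has_real_derivative - p t * Adef t x e) (at t within {0..T})"
proof -
  have "((\<lambda>t. Bdef t x e) has_real_derivative
      Kf (U t) (V t) (Q t) e x - p t * (gam t x + x - (gam t e + e)) -
      (LBINT s=ereal e..ereal x. 2 * U t s * Q t s * V t s - U t s * Q t s - p t * (Q t s * V t s))) (at t within {0..T})"
    unfolding Bdef_def by (intro DERIV_diff dU dint_QW assms)
  also have "(LBINT s=ereal e..ereal x. 2 * U t s * Q t s * V t s - U t s * Q t s - p t * (Q t s * V t s))
     = Kf (U t) (V t) (Q t) e x - p t * (LBINT s=ereal e..ereal x. Q t s * V t s)"
    unfolding Kf_def using locbm[OF t]
    by (subst interval_lebesgue_integral_diff) (intro locbm_intros | simp)+
  finally show ?thesis by (simp add: Adef_def algebra_simps)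
qed

text \<open>Here u is what U would be if \<open>Bdef\<close> vanished. The chain rule is available
  for u, which is Lipschitz, whereas U is so far only measurable and bounded.\<close>

lemma square_increment:
  fixes e x :: real
  assumes t: "t \<in> {0..T}"
  defines "u \<equiv> \<lambda>z. U t e + (LBINT s=ereal e..ereal z. Q t s * W t s)"
  shows "(u x)\<^sup>2 - (U t e)\<^sup>2 = 2 * (LBINT s=ereal e..ereal x. u s * (Q t s * W t s))"
proof -
  have li: "locbm (\<lambda>s. Q t s * W t s)" using locbm[OF t] by auto
  have b: "AE s in lborel. \<bar>Q t s * W t s\<bar> \<le> C * C"
    using AE_N by eventually_elim (use bd[OF t] C in \<open>auto simp: abs_mult intro!: mult_mono\<close>)
  have inc: "u y - u x = (LBINT s=ereal x..ereal y. Q t s * W t s)" for x y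
    using locbm_integral_combine[OF li, of e x y] by (simp add: u_def)
  have "u x * u x - u e * u e = (LBINT s=ereal e..ereal x. Q t s * W t s * u s + u s * (Q t s * W t s))"
    by (rule locbm_product_rule[OF _ locbm_measurable[OF li] b locbm_measurable[OF li] b inc inc]) (use C in simp)
  also have "\<dots> = (LBINT s=ereal e..ereal x. 2 * (u s * (Q t s * W t s)))"
    by (rule arg_cong[where f = "interval_lebesgue_integral lborel _ _"]) auto
  also have "\<dots> = 2 * (LBINT s=ereal e..ereal x. u s * (Q t s * W t s))" by simp
  finally show ?thesis by (simp add: u_def power2_eq_square)
qed

text \<open>With U = u + B, where B is the defect of U, the part of 2 int U QW that contains u is
  the increment of u^2. It cancels the increment of U^2 up to U^2 - u^2 = (2U - B) B, so every
  remaining term carries the defect.\<close>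

lemma dA:
  assumes t: "t \<in> {0..T}" and x: "x \<notin> N" "e \<notin> N"
  shows "((\<lambda>t. Adef t x e) has_real_derivative
    - (2 * U t x - Bdef t x e) * Bdef t x e + 2 * (LBINT s=ereal e..ereal x. Bdef t s e * (Q t s * W t s))) (at t within {0..T})"
proof -
  define u where "u z = U t e + (LBINT s=ereal e..ereal z. Q t s * W t s)" for z
  have li: "locbm (\<lambda>s. Q t s * W t s)" using locbm[OF t] by auto
  have lu: "locbm u" unfolding u_def
    by (intro locbm_cont continuous_intros continuous_on_indefinite_integral_locbm[OF li])
  have u: "U t z = u z + Bdef t z e" for z by (simp add: u_def Bdef_def)
  have "((\<lambda>t. Adef t x e) has_real_derivative
      rhs_gamma (U t) x - rhs_gamma (U t) e - (LBINT s=ereal e..ereal x. - 2 * U t s * Q t s * W t s)) (at t within {0..T})"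
    unfolding Adef_def by (rule derivative_eq_intros dgam assms dint_QV refl)+ simp
  also have "(LBINT s=ereal e..ereal x. - 2 * U t s * Q t s * W t s)
     = (LBINT s=ereal e..ereal x. - 2 * (u s * (Q t s * W t s)) + - 2 * (Bdef t s e * (Q t s * W t s)))"
    unfolding u by (rule arg_cong[where f = "interval_lebesgue_integral lborel _ _"]) (auto simp: algebra_simps)
  also have "\<dots> = - 2 * (LBINT s=ereal e..ereal x. u s * (Q t s * W t s)) - 2 * (LBINT s=ereal e..ereal x. Bdef t s e * (Q t s * W t s))"
  proof -
    have m: "(LBINT s=ereal e..ereal x. - 2 * f s) = - 2 * (LBINT s=ereal e..ereal x. f s)" for f :: "real \<Rightarrow> real"
      by (rule interval_lebesgue_integral_mult_right)
    have "(\<lambda>s. Bdef t s e) = (\<lambda>s. U t s - u s)" using u by (auto simp: fun_eq_iff)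
    then have "locbm (\<lambda>s. Bdef t s e)" using locbm(2)[OF t] lu by (auto simp only: locbm_diff)
    then have 1: "interval_lebesgue_integrable lborel (ereal e) (ereal x) (\<lambda>s. - 2 * (Bdef t s e * (Q t s * W t s)))"
      by (intro locbm_interval_integrable locbm_mult li) auto
    have 2: "interval_lebesgue_integrable lborel (ereal e) (ereal x) (\<lambda>s. - 2 * (u s * (Q t s * W t s)))"
      by (intro locbm_interval_integrable locbm_mult li lu) auto
    show ?thesis unfolding interval_lebesgue_integral_add(2)[OF 2 1] m by simp
  qed
  also have "- 2 * (LBINT s=ereal e..ereal x. u s * (Q t s * W t s)) = (U t e)\<^sup>2 - (u x)\<^sup>2"
    using square_increment[OF t, of e x] by (simp add: u_def)
  finally show ?thesis by (simp add: rhs_gamma_def u[of x] algebra_simps power2_eq_square)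
qed

text \<open>The derivatives of the two defects are bounded combinations of the defects themselves,
  once the factor 2U - B is bounded in advance, and both defects start at 0.\<close>

lemma AB_zero:
  assumes t: "t \<in> {0..T}" and x: "x \<notin> N" "e \<notin> N"
  shows "Adef t x e = 0" "Bdef t x e = 0"
proof -
  define R where "R = max \<bar>x\<bar> \<bar>e\<bar>"
  \<comment> \<open>The derivative of \<open>Adef\<close> at (x, e) involves \<open>Bdef\<close> at
    all points between e and x, so the family has to contain every good pair from the window
    [-R, R].\<close>
  define S where "S = {z. fst z \<notin> N \<and> snd z \<notin> N \<and> \<bar>fst z\<bar> \<le> R \<and> \<bar>snd z\<bar> \<le> R}"
  \<comment> \<open>A crude bound for both defects: two values of gamma or U, the distance of the
    points, and an integrand at most C^2 over a length at most 2R.\<close>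
  define b0 where "b0 = 2 * C + 2 * R + C * C * (2 * R)"
  define P where "P = 2 * C * C * C + C * C"
  \<comment> \<open>P bounds |P(1)|, 2 C + b0 bounds the factor 2U - B, and the last term bounds
    twice the integral of QW times the defect.\<close>
  define D where "D = P + (2 * C + b0 + 2 * (C * C) * (2 * R))"
  define \<phi> where "\<phi> z t = (Adef t (fst z) (snd z), Bdef t (fst z) (snd z))" for z t
  define \<psi> where "\<psi> z t = (- (2 * U t (fst z) - Bdef t (fst z) (snd z)) * Bdef t (fst z) (snd z)
     + 2 * (LBINT s=ereal (snd z)..ereal (fst z). Bdef t s (snd z) * (Q t s * W t s)), - p t * Adef t (fst z) (snd z))" for z t
  have R: "0 \<le> R" by (simp add: R_def)
  have P: "0 \<le> P" using C by (simp add: P_def)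
  have b0: "0 \<le> b0" using C R by (simp add: b0_def)
  have AB: "\<bar>Adef t x e\<bar> \<le> b0" "\<bar>Bdef t x e\<bar> \<le> b0"
    if t: "t \<in> {0..T}" and x: "x \<notin> N" "e \<notin> N" "\<bar>x\<bar> \<le> R" "\<bar>e\<bar> \<le> R" for t x e
  proof -
    have r: "\<bar>x - e\<bar> \<le> 2 * R" using x by linarith
    have "\<bar>LBINT s=ereal e..ereal x. Q t s * V t s\<bar> \<le> C * C * \<bar>x - e\<bar>"
      using meas[OF t] AE_N
      by (intro interval_integral_AE_bound) (auto elim!: eventually_mono simp: abs_mult bd[OF t] C intro!: mult_mono)
    also have "\<dots> \<le> C * C * (2 * R)" using r by (intro mult_left_mono) auto
    finally show "\<bar>Adef t x e\<bar> \<le> b0" using bd(1)[OF t x(1)] bd(1)[OF t x(2)] x unfolding Adef_def b0_def by linarith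
    have "\<bar>LBINT s=ereal e..ereal x. Q t s * W t s\<bar> \<le> C * C * \<bar>x - e\<bar>"
      using meas[OF t] AE_N
      by (intro interval_integral_AE_bound) (auto elim!: eventually_mono simp: abs_mult bd[OF t] C intro!: mult_mono)
    also have "\<dots> \<le> C * C * (2 * R)" using r by (intro mult_left_mono) auto
    finally show "\<bar>Bdef t x e\<bar> \<le> b0" using bd(2)[OF t x(1)] bd(2)[OF t x(2)] x R unfolding Bdef_def b0_def by linarith
  qed
  have "\<phi> (x, e) t = 0"
  proof (rule gronwall_family[where S = S and \<phi> = \<phi> and i = "(x, e)" and \<psi> = \<psi> and C = D and M = "2 * b0" and T = T])
    show "0 \<le> D" using P C b0 R by (simp add: D_def)
    show "(x, e) \<in> S" using x by (simp add: S_def R_def)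
    show "t \<in> {0..T}" by (rule t)
    fix z t assume z: "z \<in> S" and t: "t \<in> {0..T}"
    have zN: "fst z \<notin> N" "snd z \<notin> N" and zR: "\<bar>fst z\<bar> \<le> R" "\<bar>snd z\<bar> \<le> R" using z by (auto simp: S_def)
    show "norm (\<phi> z t) \<le> 2 * b0"
      unfolding \<phi>_def using AB[OF t zN zR] by (intro order.trans[OF norm_Pair_le]) auto
    have "\<phi> z 0 = 0" using init_y[OF zN] init_U[OF zN] by (simp add: \<phi>_def Adef_def Bdef_def zero_prod_def)
    moreover have "(\<psi> z has_integral \<phi> z t - \<phi> z 0) {0..t}"
    proof (rule fundamental_theorem_of_calculus)
      fix s assume s: "s \<in> {0..t}"
      then have sT: "s \<in> {0..T}" using t by auto
      have "(\<phi> z has_vector_derivative \<psi> z s) (at s within {0..T})"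
        unfolding \<phi>_def \<psi>_def
        using dA[OF sT zN] dB[OF sT zN]
        by (intro has_vector_derivative_Pair) (simp_all add: has_real_derivative_iff_has_vector_derivative)
      then show "(\<phi> z has_vector_derivative \<psi> z s) (at s within {0..t})"
        by (rule has_vector_derivative_within_subset) (use t in auto)
    qed (use t in simp)
    ultimately show "(\<psi> z has_integral \<phi> z t) {0..t}" by simp
  next
    fix t b z assume t: "t \<in> {0..T}" and b: "\<And>j. j \<in> S \<Longrightarrow> norm (\<phi> j t) \<le> b" and z: "z \<in> S"
    obtain x e where ze: "z = (x, e)" by (cases z)
    have x: "x \<notin> N" "e \<notin> N" "\<bar>x\<bar> \<le> R" "\<bar>e\<bar> \<le> R" using z by (auto simp: S_def ze)
    have bA: "\<bar>Adef t x e\<bar> \<le> b" and bB: "\<bar>Bdef t s e\<bar> \<le> b" if "s \<notin> N" "\<bar>s\<bar> \<le> R" for s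
      using b[of "(x, e)"] b[of "(s, e)"] x that norm_fst_le[of "Adef t x e" "Bdef t x e"]
        norm_snd_le[of "Bdef t s e" "Adef t s e"] by (auto simp: S_def \<phi>_def)
    have bA: "\<bar>Adef t x e\<bar> \<le> b" using bA x by blast
    have b: "0 \<le> b" using bA by linarith
    have "\<bar>LBINT s=ereal e..ereal x. Bdef t s e * (Q t s * W t s)\<bar> \<le> b * (C * C) * \<bar>x - e\<bar>"
    proof (rule interval_integral_AE_bound)
      have "locbm (\<lambda>s. Q t s * W t s)" using locbm[OF t] by auto
      then have "(\<lambda>s. LBINT s=ereal e..ereal s. Q t s * W t s) \<in> borel_measurable borel"
        by (intro borel_measurable_continuous_onI continuous_on_indefinite_integral_locbm)
      then show "(\<lambda>s. Bdef t s e * (Q t s * W t s)) \<in> borel_measurable borel"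
        unfolding Bdef_def using meas[OF t] by measurable
      show "AE s in lborel. s \<in> {min e x..max e x} \<longrightarrow> \<bar>Bdef t s e * (Q t s * W t s)\<bar> \<le> b * (C * C)"
        using AE_N
      proof (eventually_elim, intro impI)
        fix s assume s: "s \<notin> N" "s \<in> {min e x..max e x}"
        then have "\<bar>s\<bar> \<le> R" using x by (auto simp: min_def max_def abs_le_iff split: if_splits)
        then show "\<bar>Bdef t s e * (Q t s * W t s)\<bar> \<le> b * (C * C)"
          unfolding abs_mult using bB s(1) bd[OF t s(1)] b C by (intro mult_mono) auto
      qed
    qed
    also have "\<dots> \<le> b * (C * C) * (2 * R)" using x b by (intro mult_left_mono) auto
    finally have I: "\<bar>LBINT s=ereal e..ereal x. Bdef t s e * (Q t s * W t s)\<bar> \<le> b * (C * C) * (2 * R)" .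
    have "\<bar>(2 * U t x - Bdef t x e) * Bdef t x e\<bar> \<le> (2 * C + b0) * b"
      unfolding abs_mult using bd(2)[OF t x(1)] AB(2)[OF t x] bB[OF x(1,3)] C b0
      by (intro mult_mono) linarith+
    then have 1: "\<bar>fst (\<psi> z t)\<bar> \<le> (2 * C + b0) * b + 2 * (b * (C * C) * (2 * R))"
      using I unfolding \<psi>_def ze fst_conv snd_conv mult_minus_left by linarith
    have 2: "\<bar>snd (\<psi> z t)\<bar> \<le> P * b"
      unfolding \<psi>_def ze using p_bound[OF t] bA P by (simp add: abs_mult P_def mult_mono)
    have "norm (\<psi> z t) \<le> \<bar>fst (\<psi> z t)\<bar> + \<bar>snd (\<psi> z t)\<bar>"
      using norm_Pair_le[of "fst (\<psi> z t)" "snd (\<psi> z t)"] by simp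
    then show "norm (\<psi> z t) \<le> D * b" using 1 2 by (simp add: D_def algebra_simps)
  qed
  then show "Adef t x e = 0" "Bdef t x e = 0" by (auto simp: \<phi>_def zero_prod_def)
qed

lemma y_diff:
  assumes "t \<in> {0..T}" "x \<notin> N" "e \<notin> N"
  shows "gam t x + x - (gam t e + e) = (LBINT s=ereal e..ereal x. Q t s * V t s)"
  using AB_zero(1)[OF assms] by (simp add: Adef_def)

lemma U_diff:
  assumes "t \<in> {0..T}" "x \<notin> N" "e \<notin> N"
  shows "U t x - U t e = (LBINT s=ereal e..ereal x. Q t s * W t s)"
  using AB_zero(2)[OF assms] by (simp add: Bdef_def)

text \<open>Because gamma is periodic, y grows by exactly 1 over a period, and QV is the density of
  y.\<close>

lemma int_QV:
  assumes t: "t \<in> {0..T}"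
  shows "(LBINT s=0..1. Q t s * V t s) = 1"
proof -
  obtain e where e: "e \<notin> N" "e + 1 \<notin> N" by (rule ex_notin_null_set_shift[OF null])
  have "(LBINT s=0..1. Q t s * V t s) = (LBINT s=ereal e..ereal (e + 1). Q t s * V t s)"
    by (rule periodic1_integral_period[symmetric]) (use per[OF t] locbm[OF t] in \<open>auto simp: periodic1_def\<close>)
  also have "\<dots> = 1" using y_diff[OF t e(2,1)] periodic1_shift[OF per(1)[OF t]] by simp
  finally show ?thesis .
qed

lemma int_QW:
  assumes t: "t \<in> {0..T}"
  shows "(LBINT s=0..1. Q t s * W t s) = 0"
proof -
  obtain e where e: "e \<notin> N" "e + 1 \<notin> N" by (rule ex_notin_null_set_shift[OF null])
  have "(LBINT s=0..1. Q t s * W t s) = (LBINT s=ereal e..ereal (e + 1). Q t s * W t s)"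
    by (rule periodic1_integral_period[symmetric]) (use per[OF t] locbm[OF t] in \<open>auto simp: periodic1_def\<close>)
  also have "\<dots> = 0" using U_diff[OF t e(2,1)] periodic1_shift[OF per(2)[OF t]] by simp
  finally show ?thesis .
qed

text \<open>The time derivative is -2 P(1) int QW, and int QW is the increment of the periodic U
  over one period.\<close>

lemma int_Q:
  assumes t: "t \<in> {0..T}"
  shows "(LBINT s=0..1. Q t s) = 1 + h"
proof -
  have "\<exists>c. \<forall>t\<in>{0..T}. (LBINT s=ereal 0..ereal 1. Q t s) = c"
  proof (rule has_field_derivative_zero_constant)
    fix t assume t: "t \<in> {0..T}"
    have "((\<lambda>t. LBINT s=ereal 0..ereal 1. Q t s) has_real_derivative
        (LBINT s=ereal 0..ereal 1. rhs_Q (U t) (V t) (W t) (Q t) s)) (at t within {0..T})"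
    proof (rule has_derivative_param_integral[where C = "2 * C * C * (2 * C * C * C + C * C)", OF _ _ _ _ _ t])
      show "Q t \<in> borel_measurable borel" if "t \<in> {0..T}" for t by (rule meas(5)[OF that])
      show "rhs_Q (U t) (V t) (W t) (Q t) \<in> borel_measurable borel"
        using meas[OF t] unfolding rhs_Q_def by measurable
      show "locbm (Q t)" if "t \<in> {0..T}" for t using locbm[OF that] by auto
      show "AE s in lborel. \<forall>t\<in>{0..T}. ((\<lambda>t. Q t s) has_real_derivative rhs_Q (U t) (V t) (W t) (Q t) s) (at t within {0..T})"
        using AE_N by eventually_elim (blast intro: dQ)
      show "AE s in lborel. s \<in> {min 0 1..max 0 1} \<longrightarrow> (\<forall>t\<in>{0..T}. \<bar>rhs_Q (U t) (V t) (W t) (Q t) s\<bar> \<le> 2 * C * C * (2 * C * C * C + C * C))"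
        using AE_N
      proof (eventually_elim, intro impI ballI)
        fix s t assume s: "s \<notin> N" and t: "t \<in> {0..T}"
        have "\<bar>rhs_Q (U t) (V t) (W t) (Q t) s\<bar> = 2 * \<bar>W t s\<bar> * \<bar>Q t s\<bar> * \<bar>p t\<bar>"
          by (simp add: rhs_Q_def abs_mult)
        also have "\<dots> \<le> 2 * C * C * (2 * C * C * C + C * C)"
          using bd[OF t s] C p_bound[OF t] by (intro mult_mono) auto
        finally show "\<bar>rhs_Q (U t) (V t) (W t) (Q t) s\<bar> \<le> 2 * C * C * (2 * C * C * C + C * C)" .
      qed
    qed
    also have "(LBINT s=ereal 0..ereal 1. rhs_Q (U t) (V t) (W t) (Q t) s)
      = (LBINT s=ereal 0..ereal 1. - 2 * p t * (Q t s * W t s))"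
      by (rule arg_cong[where f = "interval_lebesgue_integral lborel _ _"]) (auto simp: rhs_Q_def)
    also have "\<dots> = - 2 * p t * (LBINT s=ereal 0..ereal 1. Q t s * W t s)"
      by (rule interval_lebesgue_integral_mult_right)
    also have "\<dots> = 0"
      using int_QW[OF t] unfolding zero_ereal_def one_ereal_def by simp
    finally show "((\<lambda>t. LBINT s=ereal 0..ereal 1. Q t s) has_real_derivative 0) (at t within {0..T})" .
  qed simp
  then have "(LBINT s=ereal 0..ereal 1. Q t s) = (LBINT s=ereal 0..ereal 1. Q 0 s)"
    using t T by (metis atLeastAtMost_iff order_refl)
  then show ?thesis using init_Q unfolding zero_ereal_def one_ereal_def by simp
qed

lemma int_w:
  assumes t: "t \<in> {0..T}"
  shows "(LBINT s=0..1. 2 * Q t s * V t s - Q t s) = 1 - h"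
proof -
  have "(LBINT s=ereal 0..ereal 1. 2 * Q t s * V t s - Q t s)
     = (LBINT s=ereal 0..ereal 1. 2 * (Q t s * V t s) - Q t s)"
    by (rule arg_cong[where f = "interval_lebesgue_integral lborel _ _"]) auto
  also have "\<dots> = (LBINT s=ereal 0..ereal 1. 2 * (Q t s * V t s)) - (LBINT s=ereal 0..ereal 1. Q t s)"
    by (intro interval_lebesgue_integral_diff locbm_intros locbm[OF t])
  also have "(LBINT s=ereal 0..ereal 1. 2 * (Q t s * V t s)) = 2 * (LBINT s=ereal 0..ereal 1. Q t s * V t s)"
    by (rule interval_lebesgue_integral_mult_right)
  finally show ?thesis using int_QV[OF t] int_Q[OF t] unfolding zero_ereal_def one_ereal_def by simp
qed

end

subsection \<open>The initial data\<close>

lemma periodic1_set_integrable: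
  fixes f :: "real \<Rightarrow> real"
  assumes p: "periodic1 f" and f: "set_integrable lborel {0..1} f"
  shows "set_integrable lborel {a..b} f"
proof -
  have unit: "set_integrable lborel {real_of_int k..real_of_int k + 1} f" for k
  proof -
    have "(\<lambda>x. indicator {real_of_int k..real_of_int k + 1} (of_int k + 1 * x) *\<^sub>R f (of_int k + 1 * x))
       = (\<lambda>x. indicator {0..1} x *\<^sub>R f x)"
      using periodic1_add_int[OF p] by (auto simp: indicator_def fun_eq_iff add.commute)
    then show ?thesis
      using f lborel_integrable_real_affine_iff[of 1 "\<lambda>x. indicator {real_of_int k..real_of_int k + 1} x *\<^sub>R f x" "of_int k"]
      by (simp add: set_integrable_def)
  qed
  have sym: "set_integrable lborel {- real n..real n} f" for n
  proof (induction n)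
    case 0
    have "set_integrable lborel {0..0} f" by (rule set_integrable_subset[OF f]) auto
    then show ?case by simp
  next
    case (Suc n)
    have "{- real (Suc n)..real (Suc n)} = {- real n..real n} \<union>
        ({real_of_int (- int (Suc n))..real_of_int (- int (Suc n)) + 1} \<union> {real_of_int (int n)..real_of_int (int n) + 1})"
      by auto
    then show ?case
      using Suc unit[of "int n"] unit[of "- int (Suc n)"]
      by (simp only:) (intro set_integrable_Un; auto)
  qed
  obtain n :: nat where n: "max \<bar>a\<bar> \<bar>b\<bar> \<le> real n" using real_arch_simple by blast
  show ?thesis by (rule set_integrable_subset[OF sym[of n]]) (use n in auto)
qed

lemma periodic1_interval_integrable:
  fixes f :: "real \<Rightarrow> real" and a b :: real
  assumes "periodic1 f" "set_integrable lborel {0..1} f"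
  shows "interval_lebesgue_integrable lborel (ereal a) (ereal b) f"
  unfolding interval_lebesgue_integrable_def
  by (auto intro!: set_integrable_subset[OF periodic1_set_integrable[OF assms, of "min a b" "max a b"]] simp: einterval_iff)

lemma measure_eqI_Ioc:
  fixes \<mu> \<nu> :: "real measure"
  assumes sets: "sets \<mu> = sets borel" "sets \<nu> = sets borel"
    and eq: "\<And>a b. a \<le> b \<Longrightarrow> emeasure \<mu> {a<..b} = emeasure \<nu> {a<..b}"
    and fin: "\<And>a b. emeasure \<mu> {a<..b} \<noteq> \<infinity>"
  shows "\<mu> = \<nu>"
proof (rule measure_eqI_generator_eq[where E = "range (\<lambda>(a, b). {a<..b})" and \<Omega> = UNIV and A = "\<lambda>n. {- real n<..real n}"])
  show "Int_stable (range (\<lambda>(a::real, b). {a<..b}))"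
  proof (rule Int_stableI)
    fix X Y :: "real set"
    assume "X \<in> range (\<lambda>(a, b). {a<..b})" "Y \<in> range (\<lambda>(a, b). {a<..b})"
    then obtain a b c d where XY: "X = {a<..b}" "Y = {c<..d}" by auto
    have "X \<inter> Y = {max a c<..min b d}" unfolding XY by (rule Int_greaterThanAtMost)
    then show "X \<inter> Y \<in> range (\<lambda>(a, b). {a<..b})"
      by (intro image_eqI[where x = "(max a c, min b d)"]) auto
  qed
  show "emeasure \<mu> X = emeasure \<nu> X" if "X \<in> range (\<lambda>(a, b). {a<..b})" for X
  proof -
    obtain a b where X: "X = {a<..b}" using \<open>X \<in> _\<close> by auto
    show ?thesis using eq[of a b] unfolding X by (cases "a \<le> b") auto
  qed
  show "sets \<mu> = sigma_sets UNIV (range (\<lambda>(a, b). {a<..b}))" "sets \<nu> = sigma_sets UNIV (range (\<lambda>(a, b). {a<..b}))"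
    using sets unfolding borel_sigma_sets_Ioc by (simp_all add: sets_measure_of_conv)
  show "(\<Union>n. {- real n<..real n}) = UNIV"
  proof -
    have "\<exists>n. x \<in> {- real n<..real n}" for x
    proof -
      obtain n where "\<bar>x\<bar> < real n" using reals_Archimedean2 by blast
      then show ?thesis by (intro exI[of _ n]) auto
    qed
    then show ?thesis by blast
  qed
qed (use fin in auto)

text \<open>A crude stand-in for the Cauchy-Schwarz inequality: it makes square-integrable functions
  integrable on bounded intervals.\<close>

lemma abs_le_one_plus_square: "\<bar>r\<bar> \<le> 1 + r\<^sup>2" for r :: real
proof -
  have "(\<bar>r\<bar> - 1)\<^sup>2 = r\<^sup>2 - 2 * \<bar>r\<bar> + 1" by (simp add: power2_diff)
  then show ?thesis using zero_le_power2[of "\<bar>r\<bar> - 1"] zero_le_power2[of r] by linarith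
qed

lemma interval_integral_nonneg:
  assumes "a \<le> b" "\<And>x. 0 \<le> f x"
  shows "0 \<le> (LBINT x=a..b. f x :: real)"
  unfolding interval_lebesgue_integral_le_eq[OF assms(1)] set_lebesgue_integral_def
  by (rule integral_nonneg_AE) (simp add: assms(2))

locale initial_data =
  fixes u0 u0x y0 :: "real \<Rightarrow> real" and h :: real
  assumes u0_H1: "is_H1_deriv u0 u0x"
    and h_def: "h = (LBINT x=0..1. (u0x x)\<^sup>2)"
    and y0_def: "\<And>xi. y0 xi + (LBINT x=0..ereal (y0 xi). (u0x x)\<^sup>2) = (1 + h) * xi"
begin

lemma u0x: "periodic1 u0x" "u0x \<in> borel_measurable borel" "periodic1 (\<lambda>x. (u0x x)\<^sup>2)"
    "set_integrable lborel {0..1} (\<lambda>x. (u0x x)\<^sup>2)" "periodic1 u0"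
proof -
  have *: "periodic1 u0" "periodic1 u0x" "u0x \<in> borel_measurable lborel" "set_integrable lborel {0..1} (\<lambda>x. (u0x x)\<^sup>2)"
    using u0_H1 unfolding is_H1_deriv_def by blast+
  then show "periodic1 u0x" "u0x \<in> borel_measurable borel" "periodic1 (\<lambda>x. (u0x x)\<^sup>2)"
    "set_integrable lborel {0..1} (\<lambda>x. (u0x x)\<^sup>2)" "periodic1 u0"
    by (simp_all add: periodic1_def)
qed

lemma integrable_sq [simp, intro]: "interval_lebesgue_integrable lborel (ereal a) (ereal b) (\<lambda>x. (u0x x)\<^sup>2)"
  by (rule periodic1_interval_integrable) (use u0x in auto)

lemma integrable_u0x [simp, intro]: "interval_lebesgue_integrable lborel (ereal a) (ereal b) u0x"
proof (rule periodic1_interval_integrable)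
  show "set_integrable lborel {0..1} u0x"
  proof (rule set_integrable_bound)
    show "set_integrable lborel {0..1} (\<lambda>x. 1 + (u0x x)\<^sup>2)"
      by (intro set_integral_add(1) u0x(4) locbm_set_integrable locbm_const)
    show "set_borel_measurable lborel {0..1} u0x" using u0x(2) unfolding set_borel_measurable_def by measurable
    show "AE x in lborel. x \<in> {0..1} \<longrightarrow> norm (u0x x) \<le> norm (1 + (u0x x)\<^sup>2)"
    proof (intro AE_I2 impI)
      fix x
      show "norm (u0x x) \<le> norm (1 + (u0x x)\<^sup>2)"
        using abs_le_one_plus_square[of "u0x x"] unfolding real_norm_def by linarith
    qed
  qed
qed (use u0x in auto)

lemma h_nonneg: "0 \<le> h"
  unfolding h_def by (rule interval_integral_nonneg) auto

lemma u0_diff: "u0 b - u0 a = (LBINT x=ereal a..ereal b. u0x x)"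
proof -
  have "u0 b = u0 0 + (LBINT x=ereal 0..ereal b. u0x x)" "u0 a = u0 0 + (LBINT x=ereal 0..ereal a. u0x x)"
    using u0_H1 unfolding is_H1_deriv_def zero_ereal_def by blast+
  then show ?thesis using interval_integral_combine[OF integrable_u0x, of 0 a b] by simp
qed

text \<open>The strictly increasing map whose inverse, after scaling by 1 + h, is y0: the defining
  relation of y0 says M (y0 xi) = (1 + h) xi.\<close>

definition M :: "real \<Rightarrow> real" where "M x = x + (LBINT s=ereal 0..ereal x. (u0x s)\<^sup>2)"

lemma M_y0: "M (y0 x) = (1 + h) * x"
  using y0_def[of x] unfolding M_def zero_ereal_def .

lemma M_diff: "M b - M a = (LBINT x=ereal a..ereal b. 1 + (u0x x)\<^sup>2)"
proof -
  have "(LBINT x=ereal a..ereal b. 1 + (u0x x)\<^sup>2) = (LBINT x=ereal a..ereal b. 1) + (LBINT x=ereal a..ereal b. (u0x x)\<^sup>2)"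
    by (rule interval_lebesgue_integral_add(2)[OF locbm_interval_integrable[OF locbm_const] integrable_sq])
  then show ?thesis using interval_integral_combine[OF integrable_sq, of 0 a b] by (simp add: M_def)
qed

lemma M_less: "a < b \<Longrightarrow> M a < M b"
proof -
  assume ab: "a < b"
  have "0 \<le> (LBINT s=ereal a..ereal b. (u0x s)\<^sup>2)"
    using ab by (intro interval_integral_nonneg) auto
  then show ?thesis using ab interval_integral_combine[OF integrable_sq, of 0 a b] by (simp add: M_def)
qed

lemma M_less_iff: "M a < M b \<longleftrightarrow> a < b"
  using M_less[of a b] M_less[of b a] by (cases a b rule: linorder_cases) auto

text \<open>An order equivalence in place of an inverse of M: it yields the monotonicity and
  measurability of y0 and the preimages of intervals.\<close>

lemma y0_gt_iff: "a < y0 x \<longleftrightarrow> M a / (1 + h) < x"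
  using M_less_iff[of a "y0 x"] h_nonneg by (simp add: M_y0 divide_less_eq mult.commute)

lemma y0_mono_iff: "y0 x < y0 z \<longleftrightarrow> x < z"
  using y0_gt_iff[of "y0 x" z] h_nonneg by (simp add: M_y0)

lemma y0_measurable: "y0 \<in> borel_measurable borel"
proof (rule borel_measurable_mono)
  show "mono y0" by (auto intro!: monoI simp: y0_mono_iff not_less[symmetric])
qed

text \<open>The measure form of (1 + h) dxi = (1 + u0x^2) dx. Both measures give (a, b] the mass (M
  b - M a) / (1 + h), so no derivative of y0 has to be taken.\<close>

lemma y0_pushforward:
  "distr lborel borel y0 = density lborel (\<lambda>x. ennreal ((1 + (u0x x)\<^sup>2) / (1 + h)))"
proof (rule measure_eqI_Ioc)
  have m: "emeasure (distr lborel borel y0) {a<..b} = ennreal ((M b - M a) / (1 + h))" if "a \<le> b" for a b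
  proof -
    have "y0 -` {a<..b} = {M a / (1 + h)<..M b / (1 + h)}"
      using y0_gt_iff by (auto simp: not_less[symmetric])
    moreover have "M a / (1 + h) \<le> M b / (1 + h)"
      using that h_nonneg M_less_iff[of b a] by (intro divide_right_mono) auto
    ultimately show ?thesis
      using y0_measurable by (simp add: emeasure_distr diff_divide_distrib)
  qed
  show "emeasure (distr lborel borel y0) {a<..b} = emeasure (density lborel (\<lambda>x. ennreal ((1 + (u0x x)\<^sup>2) / (1 + h)))) {a<..b}"
    if ab: "a \<le> b" for a b
  proof -
    have i: "set_integrable lborel {a<..b} (\<lambda>x. (1 + (u0x x)\<^sup>2) / (1 + h))"
    proof -
      have "periodic1 (\<lambda>x. (1 + (u0x x)\<^sup>2) / (1 + h))" using u0x(1) by (simp add: periodic1_def)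
      moreover have "set_integrable lborel {0..1} (\<lambda>x. (1 + (u0x x)\<^sup>2) / (1 + h))"
        by (intro set_integrable_divide set_integral_add(1) u0x(4) locbm_set_integrable locbm_const)
      ultimately have "set_integrable lborel {a..b} (\<lambda>x. (1 + (u0x x)\<^sup>2) / (1 + h))"
        by (rule periodic1_set_integrable)
      then show ?thesis by (rule set_integrable_subset) auto
    qed
    have "emeasure (density lborel (\<lambda>x. ennreal ((1 + (u0x x)\<^sup>2) / (1 + h)))) {a<..b}
       = (\<integral>\<^sup>+x. ennreal (indicator {a<..b} x *\<^sub>R ((1 + (u0x x)\<^sup>2) / (1 + h))) \<partial>lborel)"
      using u0x(2) by (subst emeasure_density) (auto intro!: nn_integral_cong simp: indicator_def)
    also have "\<dots> = ennreal (LINT x|lborel. indicator {a<..b} x *\<^sub>R ((1 + (u0x x)\<^sup>2) / (1 + h)))"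
      using i h_nonneg unfolding set_integrable_def by (intro nn_integral_eq_integral) (auto simp: indicator_def)
    also have "(LINT x|lborel. indicator {a<..b} x *\<^sub>R ((1 + (u0x x)\<^sup>2) / (1 + h))) = (LBINT x=ereal a..ereal b. (1 + (u0x x)\<^sup>2) / (1 + h))"
      by (simp only: interval_integral_Ioc[OF ab] set_lebesgue_integral_def)
    also have "\<dots> = (M b - M a) / (1 + h)"
      unfolding M_diff by (rule interval_lebesgue_integral_divide)
    finally show ?thesis using m[OF ab] by simp
  qed
  show "emeasure (distr lborel borel y0) {a<..b} \<noteq> \<infinity>" for a b
    using m[of a b] by (cases "a \<le> b") auto
qed auto

text \<open>Substitution along the image measure: the factor 1 / (1 + u0x^2) cancels its density. It
  holds for every Borel k, as a function that is not integrable has integral 0 on both sides. The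
  choices k = 1 and k = \<open>u0x\<close> give the initial values of y and U.\<close>

lemma y0_substitution:
  assumes k: "k \<in> borel_measurable borel"
  shows "(LBINT s=ereal e..ereal x. (1 + h) * (k (y0 s) / (1 + (u0x (y0 s))\<^sup>2))) = (LBINT z=ereal (y0 e)..ereal (y0 x). k z)"
proof -
  have *: "(LBINT s=ereal e..ereal x. (1 + h) * (k (y0 s) / (1 + (u0x (y0 s))\<^sup>2))) = (LBINT z=ereal (y0 e)..ereal (y0 x). k z)"
    if ex: "e \<le> x" for e x
  proof -
    define g where "g z = indicator {y0 e<..y0 x} z * ((1 + h) * (k z / (1 + (u0x z)\<^sup>2)))" for z
    have [measurable]: "g \<in> borel_measurable borel" unfolding g_def using k u0x(2) by measurable
    have ye: "y0 e \<le> y0 x" using ex y0_mono_iff[of x e] by auto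
    have "(LBINT s=ereal e..ereal x. (1 + h) * (k (y0 s) / (1 + (u0x (y0 s))\<^sup>2)))
        = (LINT s|lborel. indicator {e<..x} s *\<^sub>R ((1 + h) * (k (y0 s) / (1 + (u0x (y0 s))\<^sup>2))))"
      using ex by (simp add: interval_integral_Ioc set_lebesgue_integral_def)
    also have "\<dots> = (LINT s|lborel. g (y0 s))"
      by (intro Bochner_Integration.integral_cong)
        (auto simp: g_def indicator_def y0_mono_iff not_less[symmetric])
    also have "\<dots> = (LINT z|distr lborel borel y0. g z)"
      using y0_measurable by (subst integral_distr) auto
    also have "\<dots> = (LINT z|lborel. ((1 + (u0x z)\<^sup>2) / (1 + h)) *\<^sub>R g z)"
      unfolding y0_pushforward using u0x(2) h_nonneg by (subst integral_density) auto
    also have "\<dots> = (LINT z|lborel. indicator {y0 e<..y0 x} z *\<^sub>R k z)"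
    proof (intro Bochner_Integration.integral_cong refl)
      fix z
      have "1 + (u0x z)\<^sup>2 \<noteq> 0" "1 + h \<noteq> 0" using h_nonneg zero_le_power2[of "u0x z"] by linarith+
      then show "((1 + (u0x z)\<^sup>2) / (1 + h)) *\<^sub>R g z = indicator {y0 e<..y0 x} z *\<^sub>R k z"
        by (simp add: g_def)
    qed
    also have "\<dots> = (LBINT z=ereal (y0 e)..ereal (y0 x). k z)"
      using ye by (simp add: interval_integral_Ioc set_lebesgue_integral_def)
    finally show ?thesis .
  qed
  show ?thesis
  proof (cases "e \<le> x")
    case False
    then have "(LBINT s=ereal x..ereal e. (1 + h) * (k (y0 s) / (1 + (u0x (y0 s))\<^sup>2))) = (LBINT z=ereal (y0 x)..ereal (y0 e). k z)"
      by (intro *) simp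
    then show ?thesis by (metis interval_integral_endpoints_reverse)
  qed (rule *)
qed

lemma y0_diff: "y0 x - y0 e = (LBINT s=ereal e..ereal x. (1 + h) * (1 / (1 + (u0x (y0 s))\<^sup>2)))"
  using y0_substitution[of "\<lambda>_. 1" e x] by simp

lemma U0_diff: "u0 (y0 x) - u0 (y0 e) = (LBINT s=ereal e..ereal x. (1 + h) * (u0x (y0 s) / (1 + (u0x (y0 s))\<^sup>2)))"
  using y0_substitution[OF u0x(2), of e x] by (simp add: u0_diff)

text \<open>Over one period M grows by 1 + h, which is also the change of (1 + h) xi, and M is
  injective.\<close>

lemma y0_shift: "y0 (x + 1) = y0 x + 1"
proof -
  have "(LBINT s=ereal (y0 x)..ereal (y0 x + 1). (u0x s)\<^sup>2) = h"
    unfolding h_def by (rule interval_integral_period[OF u0x(3) integrable_sq])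
  then have "M (y0 x + 1) = M (y0 x) + 1 + h"
    using interval_integral_combine[OF integrable_sq, of 0 "y0 x" "y0 x + 1"] by (simp add: M_def)
  also have "\<dots> = M (y0 (x + 1))" by (simp add: M_y0 algebra_simps)
  finally show ?thesis using M_less_iff[of "y0 x + 1" "y0 (x + 1)"] M_less_iff[of "y0 (x + 1)" "y0 x + 1"]
    by simp
qed

lemma density_pos: "0 < 1 + (u0x z)\<^sup>2"
  using zero_le_power2[of "u0x z"] by linarith

lemma V0_bounds: "0 \<le> 1 / (1 + (u0x z)\<^sup>2)" "1 / (1 + (u0x z)\<^sup>2) \<le> 1"
  using density_pos[of z] by auto

lemma W0_bound: "\<bar>u0x z / (1 + (u0x z)\<^sup>2)\<bar> \<le> 1"
proof -
  show ?thesis using abs_le_one_plus_square[of "u0x z"] density_pos[of z] by (simp add: abs_divide divide_le_eq)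
qed

lemma y0_lip: "\<bar>y0 x - y0 e\<bar> \<le> (1 + h) * \<bar>x - e\<bar>"
  unfolding y0_diff
proof (rule interval_integral_AE_bound)
  show "(\<lambda>s. (1 + h) * (1 / (1 + (u0x (y0 s))\<^sup>2))) \<in> borel_measurable borel"
    using y0_measurable u0x(2) by measurable
  show "AE s in lborel. s \<in> {min e x..max e x} \<longrightarrow> \<bar>(1 + h) * (1 / (1 + (u0x (y0 s))\<^sup>2))\<bar> \<le> 1 + h"
  proof (intro AE_I2 impI)
    fix s
    have "\<bar>1 / (1 + (u0x (y0 s))\<^sup>2)\<bar> \<le> 1" using V0_bounds[of "y0 s"] by linarith
    then show "\<bar>(1 + h) * (1 / (1 + (u0x (y0 s))\<^sup>2))\<bar> \<le> 1 + h"
      unfolding abs_mult using h_nonneg by (metis abs_of_nonneg add_nonneg_nonneg mult_left_le zero_le_one)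
  qed
qed

lemma U0_lip: "\<bar>u0 (y0 x) - u0 (y0 e)\<bar> \<le> (1 + h) * \<bar>x - e\<bar>"
  unfolding U0_diff
proof (rule interval_integral_AE_bound)
  show "(\<lambda>s. (1 + h) * (u0x (y0 s) / (1 + (u0x (y0 s))\<^sup>2))) \<in> borel_measurable borel"
    using y0_measurable u0x(2) by measurable
  show "AE s in lborel. s \<in> {min e x..max e x} \<longrightarrow> \<bar>(1 + h) * (u0x (y0 s) / (1 + (u0x (y0 s))\<^sup>2))\<bar> \<le> 1 + h"
  proof (intro AE_I2 impI)
    fix s
    show "\<bar>(1 + h) * (u0x (y0 s) / (1 + (u0x (y0 s))\<^sup>2))\<bar> \<le> 1 + h"
      unfolding abs_mult using W0_bound[of "y0 s"] h_nonneg
      by (metis abs_of_nonneg add_nonneg_nonneg mult_left_le zero_le_one)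
  qed
qed

lemma periodic_lipschitz_bmf:
  assumes p: "periodic1 f" and l: "\<And>x e. \<bar>f x - f e\<bar> \<le> L * \<bar>x - e\<bar>"
  shows "\<exists>F. bmf_app F = f"
proof -
  have "\<bar>f x\<bar> \<le> \<bar>f 0\<bar> + \<bar>L\<bar>" for x
  proof -
    have "\<bar>f (frac x) - f 0\<bar> \<le> L * \<bar>frac x - 0\<bar>" by (rule l)
    also have "\<dots> \<le> \<bar>L\<bar> * 1" using frac_lt_1[of x] by (intro mult_mono) auto
    finally show ?thesis using periodic1_frac[OF p, of x] by simp
  qed
  moreover have "f \<in> borel_measurable borel"
    by (intro borel_measurable_continuous_onI continuous_on_of_lipschitz_bound[where C = L] l)
  ultimately show ?thesis using Bmf_inverse[OF bmf_mem_I[OF p]] by blast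
qed

lemma initial_state:
  obtains Z0 :: state where
    "gam_of Z0 = (\<lambda>xi. y0 xi - xi)" "U_of Z0 = (\<lambda>xi. u0 (y0 xi))"
    "V_of Z0 = (\<lambda>xi. 1 / (1 + (u0x (y0 xi))\<^sup>2))"
    "W_of Z0 = (\<lambda>xi. u0x (y0 xi) / (1 + (u0x (y0 xi))\<^sup>2))"
    "Q_of Z0 = (\<lambda>xi. 1 + h)"
proof -
  have "\<exists>F. bmf_app F = (\<lambda>xi. y0 xi - xi)"
  proof (rule periodic_lipschitz_bmf)
    show "periodic1 (\<lambda>xi. y0 xi - xi)" by (simp add: periodic1_def y0_shift)
    show "\<bar>y0 x - x - (y0 e - e)\<bar> \<le> (2 + h) * \<bar>x - e\<bar>" for x e
    proof -
      have "(2 + h) * \<bar>x - e\<bar> = (1 + h) * \<bar>x - e\<bar> + \<bar>x - e\<bar>" by (simp add: algebra_simps)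
      then show ?thesis using y0_lip[of x e] by linarith
    qed
  qed
  then obtain G where "bmf_app G = (\<lambda>xi. y0 xi - xi)" by blast
  moreover have "\<exists>F. bmf_app F = (\<lambda>xi. u0 (y0 xi))"
    by (rule periodic_lipschitz_bmf[OF _ U0_lip]) (simp add: periodic1_def y0_shift periodic1_shift[OF u0x(5)])
  then obtain U where "bmf_app U = (\<lambda>xi. u0 (y0 xi))" by blast
  moreover have "\<exists>F. bmf_app F = (\<lambda>xi. 1 / (1 + (u0x (y0 xi))\<^sup>2))"
  proof (rule exI, rule Bmf_inverse, rule bmf_mem_I[where C = 1])
    show "(\<lambda>xi. 1 / (1 + (u0x (y0 xi))\<^sup>2)) \<in> borel_measurable borel"
      using u0x(2) y0_measurable by measurable
    show "\<bar>1 / (1 + (u0x (y0 xi))\<^sup>2)\<bar> \<le> 1" for xi using V0_bounds[of "y0 xi"] by linarith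
  qed (simp add: periodic1_def y0_shift periodic1_shift[OF u0x(1)])
  then obtain V where "bmf_app V = (\<lambda>xi. 1 / (1 + (u0x (y0 xi))\<^sup>2))" by blast
  moreover have "\<exists>F. bmf_app F = (\<lambda>xi. u0x (y0 xi) / (1 + (u0x (y0 xi))\<^sup>2))"
  proof (rule exI, rule Bmf_inverse, rule bmf_mem_I[where C = 1])
    show "(\<lambda>xi. u0x (y0 xi) / (1 + (u0x (y0 xi))\<^sup>2)) \<in> borel_measurable borel"
      using u0x(2) y0_measurable by measurable
    show "\<bar>u0x (y0 xi) / (1 + (u0x (y0 xi))\<^sup>2)\<bar> \<le> 1" for xi by (rule W0_bound)
  qed (simp add: periodic1_def y0_shift periodic1_shift[OF u0x(1)])
  then obtain W where "bmf_app W = (\<lambda>xi. u0x (y0 xi) / (1 + (u0x (y0 xi))\<^sup>2))" by blast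
  ultimately show ?thesis using that[of "(G, U, V, W, bmf_const (1 + h))"] by (auto simp: fun_eq_iff)
qed

text \<open>With u0x = tan(theta) the two values are cos^2(theta) and sin(theta) cos(theta).\<close>

lemma initial_circle: "(1 / (1 + (u0x z)\<^sup>2))\<^sup>2 + (u0x z / (1 + (u0x z)\<^sup>2))\<^sup>2 = 1 / (1 + (u0x z)\<^sup>2)"
proof -
  have "1 + (u0x z)\<^sup>2 \<noteq> 0" using density_pos[of z] by simp
  then show ?thesis by (simp add: power_divide add_divide_distrib[symmetric] power2_eq_square[of "1 + (u0x z)\<^sup>2"])
qed

end

subsection \<open>A priori bounds and global existence\<close>

lemma state_norms:
  "norm (cg Z) \<le> norm Z" "norm (cU Z) \<le> norm Z" "norm (cV Z) \<le> norm Z" "norm (cW Z) \<le> norm Z" "norm (cQ Z) \<le> norm Z"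
proof -
  have f: "norm (fst z) \<le> norm z" for z :: "'a::real_normed_vector \<times> 'b::real_normed_vector"
    using norm_fst_le[of "fst z" "snd z"] by simp
  have s: "norm (snd z) \<le> norm z" for z :: "'a::real_normed_vector \<times> 'b::real_normed_vector"
    using norm_snd_le[of "snd z" "fst z"] by simp
  show "norm (cg Z) \<le> norm Z" by (rule f)
  show "norm (cU Z) \<le> norm Z" by (rule order.trans[OF f s])
  show "norm (cV Z) \<le> norm Z" by (rule order.trans[OF f order.trans[OF s s]])
  show "norm (cW Z) \<le> norm Z" by (rule order.trans[OF f order.trans[OF s order.trans[OF s s]]])
  show "norm (cQ Z) \<le> norm Z" by (rule order.trans[OF s order.trans[OF s order.trans[OF s s]]])
qed

lemma state_norm_le:
  "norm Z \<le> norm (cg Z) + (norm (cU Z) + (norm (cV Z) + (norm (cW Z) + norm (cQ Z))))"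
proof -
  have f: "norm z \<le> norm (fst z) + norm (snd z)" for z :: "'a::real_normed_vector \<times> 'b::real_normed_vector"
    using norm_Pair_le[of "fst z" "snd z"] by simp
  show ?thesis
    using f[of Z] f[of "snd Z"] f[of "snd (snd Z)"] f[of "snd (snd (snd Z))"] by linarith
qed

lemma bounded_linear_components:
  "bounded_linear (\<lambda>Z. gam_of Z x)" "bounded_linear (\<lambda>Z. U_of Z x)"
  "bounded_linear (\<lambda>Z. V_of Z x)" "bounded_linear (\<lambda>Z. W_of Z x)"
  "bounded_linear (\<lambda>Z. Q_of Z x)"
  by (intro bounded_linear_compose[OF bounded_linear_bmf_app] bounded_linear_fst bounded_linear_snd
      bounded_linear_fst_comp bounded_linear_snd_comp bounded_linear_ident)+

lemma Kf_diff:
  assumes "locbm U" "locbm V" "locbm Q"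
  shows "Kf U V Q a x - Kf U V Q a e = Kf U V Q e x"
proof -
  have "locbm (\<lambda>e. 2 * U e * Q e * V e - U e * Q e)" by (intro locbm_intros assms)
  from locbm_integral_combine[OF this, of a e x] show ?thesis unfolding Kf_def by simp
qed

lemma rhs_U_diff:
  assumes "locbm U" "locbm V" "locbm Q"
  shows "rhs_U h g U V Q a x - rhs_U h g U V Q a e = Kf U V Q e x - P1 U V Q * (g x + x - (g e + e))"
  using Kf_diff[OF assms, of a x e] by (simp add: rhs_U_def algebra_simps)

text \<open>Replacing the base point of the primitive adds a constant to it, which the normalising
  integral removes because the weight 2QV - Q has mean 1 - h.\<close>

lemma rhs_U_base_point:
  assumes U: "locbm U" "locbm V" "locbm Q" and g: "locbm g" and h: "h \<noteq> 1"
    and w: "(LBINT s=0..1. 2 * Q s * V s - Q s) = 1 - h"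
  shows "rhs_U h g U V Q a x = rhs_U h g U V Q b x"
proof -
  let ?w = "\<lambda>e. 2 * Q e * V e - Q e"
  let ?k = "Kf U V Q"
  let ?p = "P1 U V Q"
  have k: "?k a e = ?k b e + ?k a b" for e
    using Kf_diff[OF U, of a e b] by simp
  have lo: "locbm (\<lambda>e. 2 * U e * Q e * V e - U e * Q e)" by (intro locbm_intros U)
  have lk: "locbm (?k b)" unfolding Kf_def
    by (intro locbm_cont continuous_on_indefinite_integral_locbm lo)
  have lw: "locbm ?w" by (intro locbm_intros U)
  have i1: "interval_lebesgue_integrable lborel (ereal 0) (ereal 1) (\<lambda>e. ?w e * (?k b e - ?p * (g e + e)))"
    by (intro locbm_intros lw lk g locbm_id)
  have i2: "interval_lebesgue_integrable lborel (ereal 0) (ereal 1) (\<lambda>e. ?k a b * ?w e)"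
    by (intro locbm_interval_integrable locbm_mult lw locbm_const)
  have "(LBINT e=ereal 0..ereal 1. ?w e * (?k a e - ?p * (g e + e)))
     = (LBINT e=ereal 0..ereal 1. ?w e * (?k b e - ?p * (g e + e)) + ?k a b * ?w e)"
    by (rule arg_cong[where f = "interval_lebesgue_integral lborel _ _"], rule ext, subst k, simp only: algebra_simps)
  also have "\<dots> = (LBINT e=ereal 0..ereal 1. ?w e * (?k b e - ?p * (g e + e))) + (LBINT e=ereal 0..ereal 1. ?k a b * ?w e)"
    by (rule interval_lebesgue_integral_add(2)[OF i1 i2])
  also have "(LBINT e=ereal 0..ereal 1. ?k a b * ?w e) = ?k a b * (LBINT e=ereal 0..ereal 1. ?w e)"
    by (rule interval_lebesgue_integral_mult_right)
  also have "(LBINT e=ereal 0..ereal 1. ?w e) = 1 - h"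
    using w unfolding zero_ereal_def one_ereal_def .
  finally have I: "(LBINT e=ereal 0..ereal 1. ?w e * (?k a e - ?p * (g e + e)))
     = (LBINT e=ereal 0..ereal 1. ?w e * (?k b e - ?p * (g e + e))) + ?k a b * (1 - h)" .
  show ?thesis
    unfolding rhs_U_def zero_ereal_def one_ereal_def I k[of x] using h by (simp add: field_simps)
qed

lemma continuous_on_lip_on_balls:
  assumes "lip_on_balls f" shows "continuous_on UNIV f"
proof -
  have "isCont f x" for x
  proof -
    obtain L where "L-lipschitz_on (cball 0 (norm x + 1)) f" using assms by (auto simp: lip_on_balls_def)
    then have "continuous_on (cball 0 (norm x + 1)) f" by (rule lipschitz_on_continuous_on)
    then have "continuous_on (ball 0 (norm x + 1)) f" by (rule continuous_on_subset) auto
    moreover have "x \<in> ball 0 (norm x + 1)" by simp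
    ultimately show ?thesis by (simp add: continuous_on_eq_continuous_at del: mem_ball_0)
  qed
  then show ?thesis by (simp add: continuous_on_eq_continuous_at)
qed

locale ivp = initial_data +
  fixes Z0 :: state
  assumes h_ne: "h \<noteq> 1"
    and Z0: "gam_of Z0 = (\<lambda>xi. y0 xi - xi)" "U_of Z0 = (\<lambda>xi. u0 (y0 xi))"
    "V_of Z0 = (\<lambda>xi. 1 / (1 + (u0x (y0 xi))\<^sup>2))"
    "W_of Z0 = (\<lambda>xi. u0x (y0 xi) / (1 + (u0x (y0 xi))\<^sup>2))"
    "Q_of Z0 = (\<lambda>xi. 1 + h)"
begin

text \<open>The exceptional set is empty, because differentiability in the supremum norm gives the
  equations at every point.\<close>

lemma flow_of_ode_sol:
  assumes Z: "ode_sol (vecfield h) Z0 T Z" and T: "0 \<le> T" and C: "\<forall>t\<in>{0..T}. norm (Z t) \<le> C"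
  shows "lagrangian_flow {} T C (\<lambda>t. gam_of (Z t)) (\<lambda>t. U_of (Z t)) (\<lambda>t. V_of (Z t))
    (\<lambda>t. W_of (Z t)) (\<lambda>t. Q_of (Z t)) h"
proof
  have d: "(Z has_vector_derivative vecfield h (Z t)) (at t within {0..T})" if "t \<in> {0..T}" for t
    using Z that by (auto simp: ode_sol_def)
  \<comment> \<open>Evaluation of a component at a point is bounded linear and so carries the
    derivative of Z to the derivative of the real function t.\<close>
  note comp = bounded_linear_components[THEN bounded_linear.has_vector_derivative, OF d,
      folded has_real_derivative_iff_has_vector_derivative, unfolded vecfield_app]
  show "0 \<le> C" using bspec[OF C, of 0] T by (auto intro: order.trans[OF norm_ge_zero])
  show "\<bar>gam_of (Z t) x\<bar> \<le> C" "\<bar>U_of (Z t) x\<bar> \<le> C" "\<bar>V_of (Z t) x\<bar> \<le> C"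
    "\<bar>W_of (Z t) x\<bar> \<le> C" "\<bar>Q_of (Z t) x\<bar> \<le> C" if "t \<in> {0..T}" for t x
    by (rule order.trans[OF abs_bmf_app_le order.trans[OF state_norms(1) bspec[OF C that]]]
        order.trans[OF abs_bmf_app_le order.trans[OF state_norms(2) bspec[OF C that]]]
        order.trans[OF abs_bmf_app_le order.trans[OF state_norms(3) bspec[OF C that]]]
        order.trans[OF abs_bmf_app_le order.trans[OF state_norms(4) bspec[OF C that]]]
        order.trans[OF abs_bmf_app_le order.trans[OF state_norms(5) bspec[OF C that]]])+
  fix t assume t: "t \<in> {0..T}"
  fix x
  show "((\<lambda>t. gam_of (Z t) x) has_real_derivative rhs_gamma (U_of (Z t)) x) (at t within {0..T})"
    by (rule comp(1)[OF t])
  show "((\<lambda>t. V_of (Z t) x) has_real_derivative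
      rhs_V (U_of (Z t)) (V_of (Z t)) (W_of (Z t)) (Q_of (Z t)) x) (at t within {0..T})"
    by (rule comp(3)[OF t])
  show "((\<lambda>t. W_of (Z t) x) has_real_derivative
      rhs_W (U_of (Z t)) (V_of (Z t)) (Q_of (Z t)) x) (at t within {0..T})"
    by (rule comp(4)[OF t])
  show "((\<lambda>t. Q_of (Z t) x) has_real_derivative
      rhs_Q (U_of (Z t)) (V_of (Z t)) (W_of (Z t)) (Q_of (Z t)) x) (at t within {0..T})"
    by (rule comp(5)[OF t])
  fix e
  show "((\<lambda>t. U_of (Z t) x - U_of (Z t) e) has_real_derivative
      Kf (U_of (Z t)) (V_of (Z t)) (Q_of (Z t)) e x -
      P1 (U_of (Z t)) (V_of (Z t)) (Q_of (Z t)) *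
      (gam_of (Z t) x + x - (gam_of (Z t) e + e))) (at t within {0..T})"
    using DERIV_diff[OF comp(2)[OF t, of x] comp(2)[OF t, of e]]
    by (simp only: rhs_U_diff[OF locbm_bmf_app locbm_bmf_app locbm_bmf_app])
next
  fix x e
  have Z_0: "Z 0 = Z0" using Z by (simp add: ode_sol_def)
  show "(V_of (Z 0) x)\<^sup>2 + (W_of (Z 0) x)\<^sup>2 = V_of (Z 0) x"
    unfolding Z_0 Z0 by (rule initial_circle)
  show "gam_of (Z 0) x + x - (gam_of (Z 0) e + e) = (LBINT s=ereal e..ereal x. Q_of (Z 0) s * V_of (Z 0) s)"
    unfolding Z_0 Z0 using y0_diff[of x e] by simp
  show "U_of (Z 0) x - U_of (Z 0) e = (LBINT s=ereal e..ereal x. Q_of (Z 0) s * W_of (Z 0) s)"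
    unfolding Z_0 Z0 by (rule U0_diff)
  have "(LBINT s=ereal 0..ereal 1. 1 + h) = 1 + h" by simp
  then show "(LBINT s=0..1. Q_of (Z 0) s) = 1 + h"
    unfolding Z_0 Z0 zero_ereal_def one_ereal_def .
qed (use T in auto)

lemma ode_sol_bounded:
  fixes Z :: "real \<Rightarrow> state"
  assumes Z: "ode_sol (vecfield h) Z0 T Z"
  shows "\<exists>C. \<forall>t\<in>{0..T}. norm (Z t) \<le> C"
proof -
  have "bounded (Z ` {0..T})"
    by (intro compact_imp_bounded compact_continuous_image ode_sol_continuous[OF Z]) auto
  then show ?thesis unfolding bounded_iff by blast
qed

text \<open>Since QW is the density of U, the two integrands are the densities of U^2/2 and U^3/3,
  whose increments over a period vanish. The product rule is applied twice, the second time to U and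
  U^2.\<close>

lemma moments_zero:
  assumes Z: "ode_sol (vecfield h) Z0 T Z" and t: "t \<in> {0..T}"
  shows "bmf_int (cU (Z t) * (cQ (Z t) * cW (Z t))) = 0"
    "bmf_int (cU (Z t) * (cU (Z t) * (cQ (Z t) * cW (Z t)))) = 0"
proof -
  obtain C where C: "\<forall>t\<in>{0..T}. norm (Z t) \<le> C" using ode_sol_bounded[OF Z] by blast
  have T: "0 \<le> T" using t by auto
  interpret lagrangian_flow "{}" T C "\<lambda>t. gam_of (Z t)" "\<lambda>t. U_of (Z t)" "\<lambda>t. V_of (Z t)"
    "\<lambda>t. W_of (Z t)" "\<lambda>t. Q_of (Z t)" h
    by (rule flow_of_ode_sol[OF Z T C])
  let ?U = "U_of (Z t)"
  let ?q = "bmf_app (cQ (Z t) * cW (Z t))"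
  let ?r = "bmf_app (cQ (Z t) * cW (Z t) * cU (Z t) + cU (Z t) * (cQ (Z t) * cW (Z t)))"
  define B where "B = max (norm (cQ (Z t) * cW (Z t))) (norm (cQ (Z t) * cW (Z t) * cU (Z t) + cU (Z t) * (cQ (Z t) * cW (Z t))))"
  have B: "0 \<le> B" "AE x in lborel. \<bar>?q x\<bar> \<le> B" "AE x in lborel. \<bar>?r x\<bar> \<le> B"
    by (auto simp: B_def le_max_iff_disj simp del: bmf_app_simps intro!: AE_I2 abs_bmf_app_le)
  have U: "?U y - ?U x = (LBINT s=ereal x..ereal y. ?q s)" for x y
    using U_diff[OF t, of y x] by simp
  have UU: "?U y * ?U y - ?U x * ?U x = (LBINT s=ereal x..ereal y. ?r s)" for x y
    unfolding plus_bmf.rep_eq times_bmf.rep_eq[of _ "cU (Z t)"] times_bmf.rep_eq[of "cU (Z t)"]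
    by (rule locbm_product_rule[OF B(1) bmf_app_props(2) B(2) bmf_app_props(2) B(2) U U])
  have UUU: "?U b * (?U b * ?U b) - ?U a * (?U a * ?U a) = (LBINT s=ereal a..ereal b. ?q s * (?U s * ?U s) + ?U s * ?r s)" for a b
    by (rule locbm_product_rule[OF B(1) bmf_app_props(2) B(2) bmf_app_props(2) B(3) U UU])
  have p: "?U 1 = ?U 0" using periodic1_shift[of ?U 0] by simp
  have "2 * bmf_int (cU (Z t) * (cQ (Z t) * cW (Z t))) = bmf_int (cQ (Z t) * cW (Z t) * cU (Z t) + cU (Z t) * (cQ (Z t) * cW (Z t)))"
    unfolding bmf_int_eq by (subst interval_lebesgue_integral_mult_right[symmetric])
      (rule arg_cong[where f = "interval_lebesgue_integral lborel _ _"], auto simp: algebra_simps)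
  also have "\<dots> = 0" using UU[of 1 0] p unfolding bmf_int_eq by simp
  finally show "bmf_int (cU (Z t) * (cQ (Z t) * cW (Z t))) = 0" by simp
  have "3 * bmf_int (cU (Z t) * (cU (Z t) * (cQ (Z t) * cW (Z t)))) = (LBINT s=ereal 0..ereal 1. ?q s * (?U s * ?U s) + ?U s * ?r s)"
    unfolding bmf_int_eq by (subst interval_lebesgue_integral_mult_right[symmetric])
      (rule arg_cong[where f = "interval_lebesgue_integral lborel _ _"], auto simp: algebra_simps)
  also have "\<dots> = 0" using UUU[of 1 0] p by simp
  finally show "bmf_int (cU (Z t) * (cU (Z t) * (cQ (Z t) * cW (Z t)))) = 0" by simp
qed

text \<open>P(1) is the integral of U times the weight w = 2QV - Q. The part int U_t w vanishes
  because the normalising integral in the equation of U removes the w-mean, w having mean 1 - h. In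
  the other part w_t = -4 U QW + 2 P(1) QW, so that int U w_t is a combination of the two vanishing
  moments.\<close>

lemma pf_conserved:
  assumes Z: "ode_sol (vecfield h) Z0 T Z" and t: "t \<in> {0..T}"
  shows "pf (Z t) = pf Z0"
proof -
  obtain C where C: "\<forall>t\<in>{0..T}. norm (Z t) \<le> C" using ode_sol_bounded[OF Z] by blast
  have T: "0 \<le> T" using t by auto
  interpret fl: lagrangian_flow "{}" T C "\<lambda>t. gam_of (Z t)" "\<lambda>t. U_of (Z t)" "\<lambda>t. V_of (Z t)"
    "\<lambda>t. W_of (Z t)" "\<lambda>t. Q_of (Z t)" h
    by (rule flow_of_ode_sol[OF Z T C])
  note lin = bounded_linear.linear[OF bounded_linear_bmf_int]
  have "\<exists>c. \<forall>t\<in>{0..T}. pf (Z t) = c"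
  proof (rule has_field_derivative_zero_constant)
    fix t assume t: "t \<in> {0..T}"
    define F where "F = vecfield h (Z t)"
    have d: "(Z has_vector_derivative F) (at t within {0..T})"
      using Z t by (auto simp: ode_sol_def F_def)
    have dU: "((\<lambda>t. cU (Z t)) has_vector_derivative cU F) (at t within {0..T})"
      by (intro bounded_linear.has_vector_derivative[OF bounded_linear_fst]
        bounded_linear.has_vector_derivative[OF bounded_linear_snd] d)
    have dV: "((\<lambda>t. cV (Z t)) has_vector_derivative cV F) (at t within {0..T})"
      by (intro bounded_linear.has_vector_derivative[OF bounded_linear_fst]
        bounded_linear.has_vector_derivative[OF bounded_linear_snd] d)
    have dQ: "((\<lambda>t. cQ (Z t)) has_vector_derivative cQ F) (at t within {0..T})"
      by (intro bounded_linear.has_vector_derivative[OF bounded_linear_snd] d)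
    define w' where "w' = 2 *\<^sub>R (cQ (Z t) * cV F + cQ F * cV (Z t)) - cQ F"
    have dw: "((\<lambda>t. wgt (Z t)) has_vector_derivative w') (at t within {0..T})"
      unfolding wgt_def w'_def
      by (intro has_vector_derivative_diff dQ bounded_linear.has_vector_derivative[OF bounded_linear_scaleR_right]
          has_vector_derivative_mult dV)
    have om: "omf Z = cU Z * wgt Z" for Z by (rule bmf_eqI) (simp add: algebra_simps)
    have "((\<lambda>t. pf (Z t)) has_vector_derivative bmf_int (cU (Z t) * w' + cU F * wgt (Z t))) (at t within {0..T})"
      unfolding pf_def om
      by (intro bounded_linear.has_vector_derivative[OF bounded_linear_bmf_int] has_vector_derivative_mult dU dw)
    moreover have "bmf_int (cU F * wgt (Z t)) = 0"
    proof -
      let ?c = "bmf_int (wgt (Z t) * Gf (Z t))"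
      have "cU F * wgt (Z t) = wgt (Z t) * Gf (Z t) - ((1 / (1 - h)) * ?c) *\<^sub>R wgt (Z t)"
        by (rule bmf_eqI) (simp add: F_def vecfield_def algebra_simps)
      then have "bmf_int (cU F * wgt (Z t)) = ?c - ((1 / (1 - h)) * ?c) * bmf_int (wgt (Z t))"
        by (simp only: lin[THEN linear_diff] lin[THEN linear_scale] real_scaleR_def)
      moreover have "bmf_int (wgt (Z t)) = 1 - h" using fl.int_w[OF t] by (simp add: bmf_int_def)
      ultimately show ?thesis using h_ne by simp
    qed
    moreover have "bmf_int (cU (Z t) * w') = 0"
    proof -
      have "cU (Z t) * w' = (-4) *\<^sub>R (cU (Z t) * (cU (Z t) * (cQ (Z t) * cW (Z t))))
          + (2 * pf (Z t)) *\<^sub>R (cU (Z t) * (cQ (Z t) * cW (Z t)))"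
        by (rule bmf_eqI) (simp add: w'_def F_def vecfield_def algebra_simps)
      then show ?thesis
        using moments_zero[OF Z t] by (simp only: lin[THEN linear_add] lin[THEN linear_scale] real_scaleR_def)
    qed
    ultimately show "((\<lambda>t. pf (Z t)) has_real_derivative 0) (at t within {0..T})"
      by (simp add: has_real_derivative_iff_has_vector_derivative lin[THEN linear_add])
  qed simp
  moreover have "Z 0 = Z0" using Z by (simp add: ode_sol_def)
  ultimately show ?thesis using t T by (metis atLeastAtMost_iff order_refl)
qed

lemma apriori_bound:
  "\<exists>\<beta>. \<forall>\<tau> Z. 0 \<le> \<tau> \<longrightarrow> \<tau> \<le> T \<longrightarrow> ode_sol (vecfield h) Z0 \<tau> Z \<longrightarrow> norm (Z \<tau>) \<le> \<beta>"
proof -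
  define p0 where "p0 = pf Z0"
  \<comment> \<open>Q satisfies Q' = -2 P(1) W Q with |W| at most 1/2 and P(1) constant, so it grows
    at most at the rate |p0| from its initial value 1 + h.\<close>
  define q where "q = (1 + h) * exp (\<bar>p0\<bar> * T)"
  \<comment> \<open>From (1 - h) U(x) = p0 + int w(e) (U(x) - U(e)) de over a period, where the
    weight and the oscillation of U are both at most q. Here h must differ from 1.\<close>
  define b where "b = (\<bar>p0\<bar> + q * q) / \<bar>1 - h\<bar>"
  have q: "0 \<le> q" using h_nonneg by (simp add: q_def)
  have b: "0 \<le> b" using q by (simp add: b_def)
  have "norm (Z \<tau>) \<le> (norm Z0 + b * b * T) + (b + (1 + (1 + q)))"
    if \<tau>: "0 \<le> \<tau>" "\<tau> \<le> T" and Z: "ode_sol (vecfield h) Z0 \<tau> Z" for \<tau> Z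
  proof -
    obtain C where C: "\<forall>t\<in>{0..\<tau>}. norm (Z t) \<le> C" using ode_sol_bounded[OF Z] by blast
    interpret lagrangian_flow "{}" \<tau> C "\<lambda>t. gam_of (Z t)" "\<lambda>t. U_of (Z t)" "\<lambda>t. V_of (Z t)"
      "\<lambda>t. W_of (Z t)" "\<lambda>t. Q_of (Z t)" h
      by (rule flow_of_ode_sol[OF Z \<tau>(1) C])
    have Z_0: "Z 0 = Z0" using Z by (simp add: ode_sol_def)
    have p: "P1 (U_of (Z t)) (V_of (Z t)) (Q_of (Z t)) = p0" if "t \<in> {0..\<tau>}" for t
      using pf_conserved[OF Z that] by (simp add: pf_eq p0_def)
    have Vb: "\<bar>V_of (Z t) x\<bar> \<le> 1" "\<bar>2 * V_of (Z t) x - 1\<bar> \<le> 1" "\<bar>W_of (Z t) x\<bar> \<le> 1/2" if "t \<in> {0..\<tau>}" for t x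
    proof -
      have "0 \<le> V_of (Z t) x" "V_of (Z t) x \<le> 1" "\<bar>W_of (Z t) x\<bar> \<le> 1/2"
        by (rule VW_bounds[OF that], simp)+
      then show "\<bar>V_of (Z t) x\<bar> \<le> 1" "\<bar>2 * V_of (Z t) x - 1\<bar> \<le> 1" "\<bar>W_of (Z t) x\<bar> \<le> 1/2"
        by linarith+
    qed
    have Qb: "\<bar>Q_of (Z t) x\<bar> \<le> q" if t: "t \<in> {0..\<tau>}" for t x
    proof -
      \<comment> \<open>Squaring avoids differentiating |Q|; the exponential offsets the growth rate
        2 |p0| of the square, so that the product decreases.\<close>
      let ?f = "\<lambda>t. (Q_of (Z t) x)\<^sup>2 * exp (- 2 * \<bar>p0\<bar> * t)"
      have df: "(?f has_real_derivative
          (Q_of (Z s) x)\<^sup>2 * exp (- 2 * \<bar>p0\<bar> * s) * (- 4 * W_of (Z s) x * p0 - 2 * \<bar>p0\<bar>)) (at s within {0..\<tau>})"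
        if s: "s \<in> {0..\<tau>}" for s
      proof -
        have "((\<lambda>t. exp (- 2 * \<bar>p0\<bar> * t)) has_real_derivative exp (- 2 * \<bar>p0\<bar> * s) * (- 2 * \<bar>p0\<bar>)) (at s within {0..\<tau>})"
          by (auto intro!: derivative_eq_intros)
        from DERIV_mult[OF DERIV_power[OF dQ[OF s, of x], of 2] this]
        show ?thesis
          by (rule DERIV_cong) (auto simp: rhs_Q_def p[OF s] algebra_simps power2_eq_square)
      qed
      have "?f t \<le> ?f 0"
      proof (rule DERIV_nonpos_imp_decreasing_open[of 0 t ?f])
        show "0 \<le> t" using t by simp
        fix s assume s: "0 < s" "s < t"
        then have s': "s \<in> {0..\<tau>}" using t by simp
        have "\<bar>2 * W_of (Z s) x * p0\<bar> \<le> 1 * \<bar>p0\<bar>"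
          unfolding abs_mult using Vb(3)[OF s', of x] by (intro mult_right_mono) auto
        then have "(Q_of (Z s) x)\<^sup>2 * exp (- 2 * \<bar>p0\<bar> * s) * (- 4 * W_of (Z s) x * p0 - 2 * \<bar>p0\<bar>) \<le> 0"
          by (intro mult_nonneg_nonpos mult_nonneg_nonneg zero_le_power2 exp_ge_zero) linarith
        moreover have at: "at s within {0..\<tau>} = at s" using s t by (intro at_within_Icc_at) auto
        ultimately show "\<exists>y. (?f has_real_derivative y) (at s) \<and> y \<le> 0"
          by (intro exI conjI) (rule df[OF s', unfolded at])
      next
        have "continuous_on {0..\<tau>} ?f" by (rule DERIV_continuous_on[OF df])
        then show "continuous_on {0..t} ?f" by (rule continuous_on_subset) (use t in auto)
      qed
      then have "(Q_of (Z t) x)\<^sup>2 * exp (- 2 * \<bar>p0\<bar> * t) \<le> (1 + h)\<^sup>2"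
        unfolding Z_0 Z0(5) by simp
      then have le: "(Q_of (Z t) x)\<^sup>2 * exp (- 2 * \<bar>p0\<bar> * t) * exp (2 * \<bar>p0\<bar> * t) \<le> (1 + h)\<^sup>2 * exp (2 * \<bar>p0\<bar> * t)"
        by (rule mult_right_mono) simp
      have e1: "exp (- 2 * \<bar>p0\<bar> * t) * exp (2 * \<bar>p0\<bar> * t) = 1"
        unfolding exp_add[symmetric] by simp
      have e2: "exp (2 * \<bar>p0\<bar> * t) = (exp (\<bar>p0\<bar> * t))\<^sup>2"
        unfolding exp_double[symmetric] by (simp only: mult.assoc)
      have "(Q_of (Z t) x)\<^sup>2 \<le> ((1 + h) * exp (\<bar>p0\<bar> * t))\<^sup>2"
        using le unfolding mult.assoc[of "(Q_of (Z t) x)\<^sup>2"] e1 unfolding e2 power_mult_distrib by simp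
      then have "\<bar>Q_of (Z t) x\<bar> \<le> \<bar>(1 + h) * exp (\<bar>p0\<bar> * t)\<bar>"
        by (simp only: abs_le_square_iff)
      also have "\<dots> = (1 + h) * exp (\<bar>p0\<bar> * t)" using h_nonneg by simp
      also have "\<dots> \<le> q" unfolding q_def using t \<tau> h_nonneg by (simp add: mult_left_mono)
      finally show ?thesis .
    qed
    have Ub: "\<bar>U_of (Z t) x\<bar> \<le> b" if t: "t \<in> {0..\<tau>}" for t x
    proof -
      let ?U = "U_of (Z t)"
      \<comment> \<open>The weight is integrated over [0,1]; with the reference point there too, the
        oscillation is taken over a length at most 1.\<close>
      let ?x = "frac x"
      let ?w = "bmf_app (wgt (Z t))"
      have x: "0 \<le> ?x" "?x \<le> 1" using frac_lt_1[of x] by auto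
      have wb: "\<bar>?w e\<bar> \<le> q" for e
      proof -
        have "?w e = Q_of (Z t) e * (2 * V_of (Z t) e - 1)" by (simp add: algebra_simps)
        also have "\<bar>\<dots>\<bar> \<le> q * 1" unfolding abs_mult using Qb[OF t] Vb[OF t] q by (intro mult_mono) auto
        finally show ?thesis by simp
      qed
      have osc: "\<bar>?U ?x - ?U e\<bar> \<le> q" if e: "e \<in> {0..1}" for e
      proof -
        have U_int: "?U ?x - ?U e = (LBINT s=ereal e..ereal ?x. Q_of (Z t) s * W_of (Z t) s)"
          by (rule U_diff[OF t]) auto
        have "\<bar>?U ?x - ?U e\<bar> \<le> q * \<bar>?x - e\<bar>"
          unfolding U_int
        proof (rule interval_integral_AE_bound)
          show "AE s in lborel. s \<in> {min e ?x..max e ?x} \<longrightarrow> \<bar>Q_of (Z t) s * W_of (Z t) s\<bar> \<le> q"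
          proof (intro AE_I2 impI)
            fix s
            have "\<bar>Q_of (Z t) s * W_of (Z t) s\<bar> \<le> q * 1"
              unfolding abs_mult using Qb[OF t, of s] Vb(3)[OF t, of s] q by (intro mult_mono) auto
            then show "\<bar>Q_of (Z t) s * W_of (Z t) s\<bar> \<le> q" by simp
          qed
        qed (use meas[OF t] in measurable)
        also have "q * \<bar>?x - e\<bar> \<le> q * 1"
        proof (rule mult_left_mono[OF _ q])
          show "\<bar>?x - e\<bar> \<le> 1" using e x unfolding atLeastAtMost_iff by linarith
        qed
        finally show ?thesis by simp
      qed
      have lw: "locbm ?w" and lU: "locbm ?U" by auto
      have w1: "(LBINT e=ereal 0..ereal 1. ?w e) = 1 - h"
        using int_w[OF t] unfolding zero_ereal_def one_ereal_def by simp
      have "(LBINT e=ereal 0..ereal 1. ?w e * ?U e) = p0"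
        using p[OF t] unfolding P1_def zero_ereal_def one_ereal_def
        by (simp add: algebra_simps)
      moreover have "(LBINT e=ereal 0..ereal 1. ?w e * (?U ?x - ?U e))
        = (LBINT e=ereal 0..ereal 1. ?w e * ?U ?x) - (LBINT e=ereal 0..ereal 1. ?w e * ?U e)"
        unfolding right_diff_distrib
        by (intro interval_lebesgue_integral_diff(2) locbm_interval_integrable locbm_mult lw lU locbm_const)
      moreover have "(LBINT e=ereal 0..ereal 1. ?w e * ?U ?x) = (1 - h) * ?U ?x"
        unfolding interval_lebesgue_integral_mult_left w1 ..
      moreover have "\<bar>LBINT e=ereal 0..ereal 1. ?w e * (?U ?x - ?U e)\<bar> \<le> q * q * \<bar>1 - 0\<bar>"
      proof (rule interval_integral_AE_bound)
        show "AE e in lborel. e \<in> {min 0 1..max 0 1} \<longrightarrow> \<bar>?w e * (?U ?x - ?U e)\<bar> \<le> q * q"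
        proof (intro AE_I2 impI)
          fix e :: real assume "e \<in> {min 0 1..max 0 1}"
          then show "\<bar>?w e * (?U ?x - ?U e)\<bar> \<le> q * q"
            unfolding abs_mult using wb[of e] osc[of e] q by (intro mult_mono) auto
        qed
        show "(\<lambda>e. ?w e * (?U ?x - ?U e)) \<in> borel_measurable borel"
          using bmf_app_props(2)[of "wgt (Z t)"] bmf_app_props(2)[of "cU (Z t)"] by measurable
      qed
      ultimately have "\<bar>(1 - h) * ?U ?x\<bar> \<le> \<bar>p0\<bar> + q * q"
        unfolding diff_zero abs_one mult_1_right by linarith
      then have "\<bar>?U ?x\<bar> \<le> b"
        using h_ne by (simp add: b_def abs_mult pos_le_divide_eq mult.commute)
      then show ?thesis by (simp add: periodic1_frac)
    qed
    have gb: "\<bar>gam_of (Z \<tau>) x\<bar> \<le> norm Z0 + b * b * T" for x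
    proof -
      have "norm (gam_of (Z \<tau>) x - gam_of (Z 0) x) \<le> b * b * norm (\<tau> - 0)"
      proof (rule field_differentiable_bound[where S = "{0..\<tau>}" and f' = "\<lambda>t. rhs_gamma (U_of (Z t)) x"])
        fix t assume t: "t \<in> {0..\<tau>}"
        show "((\<lambda>t. gam_of (Z t) x) has_real_derivative rhs_gamma (U_of (Z t)) x) (at t within {0..\<tau>})"
          by (rule dgam[OF t]) simp
        show "norm (rhs_gamma (U_of (Z t)) x) \<le> b * b"
        proof -
          have "\<bar>U_of (Z t) x\<bar> * \<bar>U_of (Z t) x\<bar> \<le> b * b"
            using Ub[OF t, of x] b by (intro mult_mono) auto
          then show ?thesis by (simp add: rhs_gamma_def power2_eq_square)
        qed
      qed (use \<tau> in auto)
      also have "\<dots> \<le> b * b * T" using \<tau> b by (intro mult_left_mono) auto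
      finally show ?thesis
        using order.trans[OF abs_bmf_app_le state_norms(1), of Z0 x] unfolding Z_0 real_norm_def by linarith
    qed
    have m: "\<tau> \<in> {0..\<tau>}" using \<tau> by simp
    have "norm (cg (Z \<tau>)) \<le> norm Z0 + b * b * T" by (rule norm_bmf_le[OF gb])
    moreover have "norm (cU (Z \<tau>)) \<le> b" by (rule norm_bmf_le[OF Ub[OF m]])
    moreover have "norm (cV (Z \<tau>)) \<le> 1" by (rule norm_bmf_le[OF Vb(1)[OF m]])
    moreover have "norm (cW (Z \<tau>)) \<le> 1" by (rule norm_bmf_le[OF order.trans[OF Vb(3)[OF m]]]) simp
    moreover have "norm (cQ (Z \<tau>)) \<le> q" by (rule norm_bmf_le[OF Qb[OF m]])
    ultimately show ?thesis using state_norm_le[of "Z \<tau>"] by linarith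
  qed
  then show ?thesis by blast
qed

lemma global_ode_sol: "\<exists>Z. \<forall>T. ode_sol (vecfield h) Z0 T Z"
  using lip_vecfield apriori_bound unfolding lip_on_balls_def by (intro ode_global_of_apriori_bound) blast+

end

section \<open>Integrated equations at a fixed point, and pointwise bounds from Sobolev
  bounds\<close>

lemma set_integrable_has_integral:
  fixes r :: "real \<Rightarrow> real"
  assumes r: "set_integrable lborel {0..T} r" and t: "t \<in> {0..T}"
  shows "(r has_integral (LBINT s=0..ereal t. r s)) {0..t}"
proof -
  have rt: "set_integrable lborel {0..t} r" by (rule set_integrable_subset[OF r]) (use t in auto)
  have "(LBINT s=ereal 0..ereal t. r s) = integral {0..t} r"
    by (rule interval_integral_eq_integral) (use t rt in auto)
  moreover have "r integrable_on {0..t}" using set_borel_integral_eq_integral(1)[OF rt] .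
  ultimately show ?thesis unfolding zero_ereal_def by (simp add: has_integral_integrable_integral)
qed

lemma has_integral_LBINT:
  fixes r :: "real \<Rightarrow> real"
  assumes r: "set_integrable lborel {0..T} r" and t: "t \<in> {0..T}" and i: "(r has_integral I) {0..t}"
  shows "(LBINT s=0..ereal t. r s) = I"
  using has_integral_unique[OF set_integrable_has_integral[OF r t] i] .

lemma mild_continuous:
  fixes f r :: "real \<Rightarrow> real"
  assumes "\<And>t. t \<in> {0..T} \<Longrightarrow> (r has_integral f t - c) {0..t}" "0 \<le> T"
  shows "continuous_on {0..T} f"
proof -
  have "r integrable_on {0..T}" using assms by (auto simp: integrable_on_def)
  then have "continuous_on {0..T} (\<lambda>t. c + integral {0..t} r)"
    by (intro continuous_intros indefinite_integral_continuous_1)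
  moreover have "c + integral {0..t} r = f t" if "t \<in> {0..T}" for t
    using integral_unique[OF assms(1)[OF that]] by simp
  ultimately show ?thesis by (rule continuous_on_eq)
qed

text \<open>Second half of a bootstrap: the integrated equations first make the unknowns continuous
  in time, which makes the right-hand side r continuous, and then the equation holds in
  differentiated form.\<close>

lemma mild_derivative:
  fixes f r :: "real \<Rightarrow> real"
  assumes "\<And>t. t \<in> {0..T} \<Longrightarrow> (r has_integral f t - c) {0..t}" "continuous_on {0..T} r" "t \<in> {0..T}"
  shows "(f has_real_derivative r t) (at t within {0..T})"
proof -
  have "((\<lambda>t. c + integral {0..t} r) has_real_derivative 0 + r t) (at t within {0..T})"
    by (intro DERIV_add DERIV_const integral_has_real_derivative assms)
  then have "((\<lambda>t. c + integral {0..t} r) has_real_derivative r t) (at t within {0..T})" by simp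
  then show ?thesis
  proof (rule has_field_derivative_transform_within[OF _ zero_less_one assms(3)])
    fix s assume "s \<in> {0..T}"
    then show "c + integral {0..s} r = f s" using integral_unique[OF assms(1)] by simp
  qed
qed

text \<open>The oscillation on [0,1] is at most int |g|, hence at most 1 + int g^2 and so 1 + C.
  Comparing f(x) with f(y) and averaging over y bounds f(x)^2, and |f| is at most 1 + f^2. The bound
  holds at every point, as f is continuous.\<close>

lemma H1_bdd_props:
  assumes "H1_bdd C f"
  shows "periodic1 f" "f \<in> borel_measurable borel" "\<bar>f x\<bar> \<le> 1 + 2 * C + 2 * (1 + C)\<^sup>2"
proof -
  obtain g where g: "is_H1_deriv f g" and bd: "(LBINT x=0..1. (f x)\<^sup>2 + (g x)\<^sup>2) \<le> C"
    using assms unfolding H1_bdd_def by blast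
  have p: "periodic1 f" "periodic1 g" and gm: "g \<in> borel_measurable borel"
    and gi: "set_integrable lborel {0..1} (\<lambda>x. (g x)\<^sup>2)"
    using g unfolding is_H1_deriv_def by auto
  have f: "f x = f 0 + (LBINT s=ereal 0..ereal x. g s)" for x
    using g unfolding is_H1_deriv_def zero_ereal_def by blast
  have ci: "set_integrable lborel {a..b} (\<lambda>x. 1 :: real)" for a b :: real
    by (intro locbm_set_integrable locbm_const)
  have gi1: "set_integrable lborel {0..1} g"
  proof (rule set_integrable_bound[OF set_integral_add(1)[OF ci gi]])
    show "set_borel_measurable lborel {0..1} g" using gm unfolding set_borel_measurable_def by measurable
    show "AE x in lborel. x \<in> {0..1} \<longrightarrow> norm (g x) \<le> norm (1 + (g x)\<^sup>2)"
    proof (intro AE_I2 impI)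
      fix x
      show "norm (g x) \<le> norm (1 + (g x)\<^sup>2)"
        using abs_le_one_plus_square[of "g x"] unfolding real_norm_def by linarith
    qed
  qed
  have gab: "set_integrable lborel {a..b} g" for a b by (rule periodic1_set_integrable[OF p(2) gi1])
  have iab: "interval_lebesgue_integrable lborel (ereal a) (ereal b) g" for a b
    by (rule periodic1_interval_integrable[OF p(2) gi1])
  have cf: "continuous_on UNIV f"
    by (rule continuous_on_eq[OF continuous_on_add[OF continuous_on_const[of _ "f 0"] continuous_on_indefinite_LBINT[OF gab, of 0]]])
      (rule f[symmetric])
  show "periodic1 f" by (rule p)
  show "f \<in> borel_measurable borel" by (rule borel_measurable_continuous_onI[OF cf])
  have fi: "set_integrable lborel {0..1} (\<lambda>x. (f x)\<^sup>2)"
    by (intro locbm_set_integrable locbm_power locbm_cont cf)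
  have "(LINT x:{0..1}|lborel. (f x)\<^sup>2) + (LINT x:{0..1}|lborel. (g x)\<^sup>2) \<le> C"
  proof -
    have "(LBINT x=ereal 0..ereal 1. (f x)\<^sup>2 + (g x)\<^sup>2) = (LINT x:{0..1}|lborel. (f x)\<^sup>2 + (g x)\<^sup>2)"
      by (rule interval_integral_Icc) simp
    then show ?thesis using bd set_integral_add(2)[OF fi gi] unfolding zero_ereal_def one_ereal_def by simp
  qed
  moreover have "0 \<le> (LINT x:{0..1}|lborel. (f x)\<^sup>2)" "0 \<le> (LINT x:{0..1}|lborel. (g x)\<^sup>2)"
    unfolding set_lebesgue_integral_def by (auto intro!: integral_nonneg_AE)
  ultimately have F: "(LINT x:{0..1}|lborel. (f x)\<^sup>2) \<le> C" and G: "(LINT x:{0..1}|lborel. (g x)\<^sup>2) \<le> C" and C: "0 \<le> C"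
    by linarith+
  have c1: "(LINT x:{0..1::real}|lborel. c) = c" for c :: real
  proof -
    have "(LBINT x=ereal 0..ereal 1. c) = c" by simp
    then show ?thesis using interval_integral_Icc[of 0 1 "\<lambda>_. c"] by simp
  qed
  have osc: "\<bar>f x - f y\<bar> \<le> 1 + C" if "x \<in> {0..1}" "y \<in> {0..1}" "y \<le> x" for x y
  proof -
    have "\<bar>f x - f y\<bar> = \<bar>LBINT s=ereal y..ereal x. g s\<bar>"
      using f[of x] f[of y] interval_integral_combine[OF iab, of 0 y x] by simp
    also have "\<dots> = norm (LINT s:{y..x}|lborel. g s)" using that by (simp add: interval_integral_Icc)
    also have "\<dots> \<le> (LINT s:{y..x}|lborel. norm (g s))" by (rule set_integral_norm_bound[OF gab])
    also have "\<dots> \<le> (LINT s:{0..1}|lborel. norm (g s))"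
      using set_integrable_norm[OF gab[of y x]] set_integrable_norm[OF gi1] that
      unfolding set_lebesgue_integral_def set_integrable_def
      by (intro integral_mono) (auto simp: indicator_def)
    also have "\<dots> \<le> (LINT s:{0..1}|lborel. 1 + (g s)\<^sup>2)"
      by (rule set_integral_mono[OF set_integrable_norm[OF gi1] set_integral_add(1)[OF ci gi]])
        (simp add: abs_le_one_plus_square)
    also have "\<dots> = 1 + (LINT s:{0..1}|lborel. (g s)\<^sup>2)" using set_integral_add(2)[OF ci gi] c1[of 1] by simp
    finally show ?thesis using G by simp
  qed
  have osc': "(f x - f y)\<^sup>2 \<le> (1 + C)\<^sup>2" if "x \<in> {0..1}" "y \<in> {0..1}" for x y
  proof -
    have "\<bar>f x - f y\<bar> \<le> 1 + C" using osc[of x y] osc[of y x] that by (cases "y \<le> x") auto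
    then have "\<bar>f x - f y\<bar>\<^sup>2 \<le> (1 + C)\<^sup>2" by (rule power_mono) simp
    then show ?thesis by simp
  qed
  have sq: "(f x)\<^sup>2 \<le> 2 * C + 2 * (1 + C)\<^sup>2" if x: "x \<in> {0..1}" for x
  proof -
    have i2: "set_integrable lborel {0..1} (\<lambda>y. 2 * (f y)\<^sup>2)" using set_integrable_mult_right[OF fi] by simp
    have ci2: "set_integrable lborel {0..1} (\<lambda>y::real. c)" for c :: real by (intro locbm_set_integrable locbm_const)
    have "(f x)\<^sup>2 = (LINT y:{0..1::real}|lborel. (f x)\<^sup>2)" by (rule c1[symmetric])
    also have "\<dots> \<le> (LINT y:{0..1}|lborel. 2 * (f y)\<^sup>2 + 2 * (1 + C)\<^sup>2)"
    proof (rule set_integral_mono[OF ci2 set_integral_add(1)[OF i2 ci2]])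
      fix y :: real assume y: "y \<in> {0..1}"
      \<comment> \<open>Expanded, this square is 2 f(y)^2 + 2 (f(x) - f(y))^2 - f(x)^2.\<close>
      have "0 \<le> (f x - 2 * f y)\<^sup>2" by simp
      then have "(f x)\<^sup>2 \<le> 2 * (f y)\<^sup>2 + 2 * (f x - f y)\<^sup>2" by (simp add: power2_eq_square algebra_simps)
      then show "(f x)\<^sup>2 \<le> 2 * (f y)\<^sup>2 + 2 * (1 + C)\<^sup>2" using osc'[OF x y] by linarith
    qed
    also have "\<dots> = (LINT y:{0..1}|lborel. 2 * (f y)\<^sup>2) + (LINT y:{0..1::real}|lborel. 2 * (1 + C)\<^sup>2)"
      by (rule set_integral_add(2)[OF i2 ci2])
    also have "\<dots> = 2 * (LINT y:{0..1}|lborel. (f y)\<^sup>2) + 2 * (1 + C)\<^sup>2" unfolding c1 by simp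
    finally show ?thesis using F by linarith
  qed
  have "\<bar>f x\<bar> = \<bar>f (frac x)\<bar>" by (simp add: periodic1_frac[OF p(1)])
  also have "\<dots> \<le> 1 + (f (frac x))\<^sup>2" by (rule abs_le_one_plus_square)
  also have "(f (frac x))\<^sup>2 \<le> 2 * C + 2 * (1 + C)\<^sup>2" by (rule sq) (use frac_lt_1[of x] in \<open>auto intro: less_imp_le\<close>)
  finally show "\<bar>f x\<bar> \<le> 1 + 2 * C + 2 * (1 + C)\<^sup>2" by simp
qed

text \<open>Supplies both regularity requirements on gamma and U: the Sobolev bound of a solution on
  [0,T], and Lipschitz continuity, which stands for membership in W^{1,infinity}.\<close>

lemma H1_bdd_of_bounded_derivative:
  assumes p: "periodic1 f" "periodic1 g" and gm: "g \<in> borel_measurable borel"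
    and fB: "\<And>x. \<bar>f x\<bar> \<le> B" and gB: "\<And>x. \<bar>g x\<bar> \<le> B"
    and fg: "\<And>a b. f b - f a = (LBINT s=ereal a..ereal b. g s)"
  shows "H1_bdd (2 * B\<^sup>2) f" "B-lipschitz_on UNIV f"
proof -
  have lg: "locbm g" using gm gB by (auto intro!: locbm_I)
  have lip: "\<bar>f b - f a\<bar> \<le> B * \<bar>b - a\<bar>" for a b
    unfolding fg by (rule interval_integral_AE_bound[OF gm]) (simp add: gB)
  have B: "0 \<le> B" using fB[of 0] by simp
  show "B-lipschitz_on UNIV f" by (rule lipschitz_onI) (use lip B in \<open>auto simp: dist_real_def\<close>)
  have fm: "f \<in> borel_measurable borel"
    by (intro borel_measurable_continuous_onI continuous_on_of_lipschitz_bound[OF lip])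
  have "is_H1_deriv f g"
    unfolding is_H1_deriv_def
  proof (intro conjI allI)
    show "set_integrable lborel {0..1} (\<lambda>x. (g x)\<^sup>2)" by (intro locbm_set_integrable locbm_power lg)
    show "f x = f 0 + (LBINT s=0..ereal x. g s)" for x using fg[of x 0] unfolding zero_ereal_def by simp
  qed (use p gm in auto)
  moreover have "(LBINT x=0..1. (f x)\<^sup>2 + (g x)\<^sup>2) \<le> 2 * B\<^sup>2"
  proof -
    have "\<bar>LBINT x=ereal 0..ereal 1. (f x)\<^sup>2 + (g x)\<^sup>2\<bar> \<le> 2 * B\<^sup>2 * \<bar>1 - 0\<bar>"
    proof (rule interval_integral_AE_bound)
      show "(\<lambda>x. (f x)\<^sup>2 + (g x)\<^sup>2) \<in> borel_measurable borel" using fm gm by measurable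
      show "AE x in lborel. x \<in> {min 0 1..max 0 1} \<longrightarrow> \<bar>(f x)\<^sup>2 + (g x)\<^sup>2\<bar> \<le> 2 * B\<^sup>2"
      proof (intro AE_I2 impI)
        fix x
        have "(f x)\<^sup>2 \<le> B\<^sup>2" "(g x)\<^sup>2 \<le> B\<^sup>2"
          using fB[of x] gB[of x] B by (simp_all add: abs_le_square_iff[symmetric])
        then show "\<bar>(f x)\<^sup>2 + (g x)\<^sup>2\<bar> \<le> 2 * B\<^sup>2" by simp
      qed
    qed
    then show ?thesis unfolding zero_ereal_def one_ereal_def by simp
  qed
  ultimately show "H1_bdd (2 * B\<^sup>2) f" unfolding H1_bdd_def by blast
qed

section \<open>From the differential equation to a global solution\<close>

context ivp
begin

text \<open>The invariants of the flow enter twice: the increments of y and U give the regularity,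
  and the mean of 2QV - Q gives the equation with the prescribed base point.\<close>

lemma global_sol_of_ode_sol:
  assumes Z: "\<And>T. ode_sol (vecfield h) Z0 T Z"
  obtains xi0 where "global_sol h (gam_of Z0) (U_of Z0) (V_of Z0) (W_of Z0) (Q_of Z0)
     (\<lambda>t. gam_of (Z t)) (\<lambda>t. U_of (Z t)) (\<lambda>t. V_of (Z t)) (\<lambda>t. W_of (Z t))
     (\<lambda>t. Q_of (Z t)) xi0"
proof -
  let ?g = "\<lambda>t. gam_of (Z t)" and ?U = "\<lambda>t. U_of (Z t)" and ?V = "\<lambda>t. V_of (Z t)"
    and ?W = "\<lambda>t. W_of (Z t)" and ?Q = "\<lambda>t. Q_of (Z t)"
  \<comment> \<open>C is taken at least 1 so that QV - 1 and QW, the densities of gamma and U, are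
    bounded by C^2 + C, which also dominates C.\<close>
  have fl: "\<exists>C\<ge>1. (\<forall>t\<in>{0..T}. norm (Z t) \<le> C) \<and> lagrangian_flow {} T C ?g ?U ?V ?W ?Q h" if T: "0 \<le> T" for T
  proof -
    obtain C where C: "\<forall>t\<in>{0..T}. norm (Z t) \<le> C" using ode_sol_bounded[OF Z] by blast
    then have C': "\<forall>t\<in>{0..T}. norm (Z t) \<le> max 1 C" by auto
    show ?thesis by (rule exI[of _ "max 1 C"]) (use C' flow_of_ode_sol[OF Z T C'] in auto)
  qed
  have reg: "H1_bdd (2 * (C\<^sup>2 + C)\<^sup>2) (?g t) \<and> H1_bdd (2 * (C\<^sup>2 + C)\<^sup>2) (?U t) \<and>
      Linf_bdd (2 * (C\<^sup>2 + C)\<^sup>2) (?V t) \<and> Linf_bdd (2 * (C\<^sup>2 + C)\<^sup>2) (?W t) \<and> Linf_bdd (2 * (C\<^sup>2 + C)\<^sup>2) (?Q t)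
      \<and> (C\<^sup>2 + C)-lipschitz_on UNIV (?g t) \<and> (C\<^sup>2 + C)-lipschitz_on UNIV (?U t)"
    if Cb: "1 \<le> C" "norm (Z t) \<le> C" and lf: "lagrangian_flow {} T C ?g ?U ?V ?W ?Q h" and t: "t \<in> {0..T}" for C t T
  proof -
    interpret lagrangian_flow "{}" T C ?g ?U ?V ?W ?Q h by (rule lf)
    have CC: "C \<le> C\<^sup>2 + C" "1 \<le> C\<^sup>2 + C"
      using Cb(1) zero_le_power2[of C] by (simp_all, linarith)
    have C2: "C \<le> 2 * (C\<^sup>2 + C)\<^sup>2"
    proof -
      have "C\<^sup>2 + C \<le> (C\<^sup>2 + C)\<^sup>2" using CC(2) by (rule self_le_power) simp
      then show ?thesis using CC by linarith
    qed
    have b: "\<bar>bmf_app f x * bmf_app g x\<bar> \<le> C\<^sup>2" if "norm f \<le> C" "norm g \<le> C" for f g x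
      unfolding abs_mult power2_eq_square using that Cb(1)
      by (intro mult_mono order.trans[OF abs_bmf_app_le]) auto
    note n = state_norms[of "Z t", THEN order.trans, OF Cb(2)]
    have le: "\<bar>bmf_app f x\<bar> \<le> C" if "norm f \<le> C" for f x using order.trans[OF abs_bmf_app_le that] .
    have gy: "?g t b - ?g t a = (LBINT s=ereal a..ereal b. bmf_app (cQ (Z t) * cV (Z t) - bmf_const 1) s)" for a b
    proof -
      have "?g t b - ?g t a = (LBINT s=ereal a..ereal b. ?Q t s * ?V t s) - (LBINT s=ereal a..ereal b. 1)"
        using y_diff[OF t, of b a] by simp
      also have "\<dots> = (LBINT s=ereal a..ereal b. bmf_app (cQ (Z t) * cV (Z t) - bmf_const 1) s)"
        unfolding bmf_app_simps bmf_const_app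
        by (intro interval_lebesgue_integral_diff(2)[symmetric] locbm_intros locbm_bmf_app)
      finally show ?thesis .
    qed
    have gb: "\<bar>bmf_app (cQ (Z t) * cV (Z t) - bmf_const 1) x\<bar> \<le> C\<^sup>2 + C" for x
      using b[OF n(5,3), of x] Cb(1) by simp
    have Ub: "\<bar>bmf_app (cQ (Z t) * cW (Z t)) x\<bar> \<le> C\<^sup>2 + C" for x
      using b[OF n(5,4), of x] Cb(1) by simp
    have Uy: "?U t b - ?U t a = (LBINT s=ereal a..ereal b. bmf_app (cQ (Z t) * cW (Z t)) s)" for a b
      using U_diff[OF t, of b a] by simp
    have L: "Linf_bdd (2 * (C\<^sup>2 + C)\<^sup>2) (bmf_app f)" if "norm f \<le> C" for f
      unfolding Linf_bdd_def using order.trans[OF le[OF that] C2] by auto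
    show ?thesis
      by (intro conjI L n H1_bdd_of_bounded_derivative[OF bmf_app_props(1,1,2) order.trans[OF le[OF n(1)] CC(1)] gb gy]
          H1_bdd_of_bounded_derivative[OF bmf_app_props(1,1,2) order.trans[OF le[OF n(2)] CC(1)] Ub Uy])
  qed
  \<comment> \<open>As |gamma| is at most C, the continuous function y changes sign on
    [-C, C].\<close>
  have "\<exists>x. 0 \<le> t \<longrightarrow> ?g t x + x = 0" for t
  proof (cases "0 \<le> t")
    case True
    obtain C where Cb: "C \<ge> 1" "\<forall>t\<in>{0..t}. norm (Z t) \<le> C" "lagrangian_flow {} t C ?g ?U ?V ?W ?Q h"
      using fl[OF True] by blast
    have t: "t \<in> {0..t}" using True by simp
    have nC: "norm (Z t) \<le> C" using Cb(2) t by blast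
    have "(C\<^sup>2 + C)-lipschitz_on UNIV (?g t)" using reg[OF Cb(1) nC Cb(3) t] by blast
    then have "continuous_on {-C..C} (?g t)"
      by (meson continuous_on_subset lipschitz_on_continuous_on subset_UNIV)
    then have "continuous_on {-C..C} (\<lambda>x. ?g t x + x)" by (intro continuous_intros)
    moreover have "\<bar>?g t x\<bar> \<le> C" for x
      by (rule order.trans[OF abs_bmf_app_le order.trans[OF state_norms(1) nC]])
    then have "?g t (-C) + - C \<le> 0" "0 \<le> ?g t C + C"
      using abs_le_D1[of "?g t (-C)" C] abs_le_D2[of "?g t C" C] by auto
    ultimately have "\<exists>x\<ge>-C. x \<le> C \<and> ?g t x + x = 0" using Cb(1) by (intro IVT') auto
    then show ?thesis by blast
  qed simp
  then obtain xi0 where xi0: "\<And>t. 0 \<le> t \<Longrightarrow> ?g t (xi0 t) + xi0 t = 0" by metis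
  have cF: "continuous_on {0..T} (\<lambda>s. vecfield h (Z s))" for T
    by (rule continuous_on_compose2[OF continuous_on_lip_on_balls[OF lip_vecfield] ode_sol_continuous[OF Z]]) auto
  \<comment> \<open>Any bounded linear functional may be applied to the integrated equation in the
    state space; the point evaluations give the five scalar equations at every xi.\<close>
  have comp: "set_integrable lborel {0..T} (\<lambda>s. L (vecfield h (Z s)))
      \<and> (\<forall>t\<in>{0..T}. L (Z t) = L Z0 + (LBINT s=0..ereal t. L (vecfield h (Z s))))"
    if L: "bounded_linear L" for L :: "state \<Rightarrow> real" and T
  proof (intro conjI ballI)
    show i: "set_integrable lborel {0..T} (\<lambda>s. L (vecfield h (Z s)))"
      by (intro borel_integrable_atLeastAtMost' bounded_linear.continuous_on[OF L] cF)
    fix t assume t: "t \<in> {0..T}"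
    have "((\<lambda>s. L (vecfield h (Z s))) has_integral L (Z t - Z0)) {0..t}"
      using has_integral_linear[OF ode_sol_has_integral[OF Z t] L] by (simp add: comp_def)
    from has_integral_LBINT[OF i t this] show "L (Z t) = L Z0 + (LBINT s=0..ereal t. L (vecfield h (Z s)))"
      by (simp add: bounded_linear.linear[OF L, THEN linear_diff])
  qed
  note comps = comp[OF bounded_linear_components(1), unfolded vecfield_app] comp[OF bounded_linear_components(2), unfolded vecfield_app]
    comp[OF bounded_linear_components(3), unfolded vecfield_app] comp[OF bounded_linear_components(4), unfolded vecfield_app]
    comp[OF bounded_linear_components(5), unfolded vecfield_app]
  have sol: "sol_on h T (gam_of Z0) (U_of Z0) (V_of Z0) (W_of Z0) (Q_of Z0) ?g ?U ?V ?W ?Q xi0"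
    if T: "0 < T" for T
  proof -
    have T0: "0 \<le> T" using T by simp
    obtain C where Cb: "C \<ge> 1" "\<forall>t\<in>{0..T}. norm (Z t) \<le> C" "lagrangian_flow {} T C ?g ?U ?V ?W ?Q h"
      using fl[OF T0] by blast
    interpret lagrangian_flow "{}" T C ?g ?U ?V ?W ?Q h by (rule Cb(3))
    \<comment> \<open>The differential equation was solved with base point 0; the mean of 2QV - Q
      allows the exchange for the zero \<open>xi0\<close> of y.\<close>
    have base: "rhs_U h (?g s) (?U s) (?V s) (?Q s) (xi0 s) x = rhs_U h (?g s) (?U s) (?V s) (?Q s) 0 x"
      if "s \<in> {0..T}" for s x
      by (rule rhs_U_base_point[OF _ _ _ _ h_ne int_w[OF that]]) (rule locbm_bmf_app)+
    have U: "set_integrable lborel {0..T} (\<lambda>s. rhs_U h (?g s) (?U s) (?V s) (?Q s) (xi0 s) x)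
      \<and> (\<forall>t\<in>{0..T}. ?U t x = U_of Z0 x + (LBINT s=0..ereal t. rhs_U h (?g s) (?U s) (?V s) (?Q s) (xi0 s) x))" for x
    proof (intro conjI ballI)
      have i: "set_integrable lborel {0..T} (\<lambda>s. rhs_U h (?g s) (?U s) (?V s) (?Q s) 0 x)"
        using comps(2)[of T x] by blast
      show "set_integrable lborel {0..T} (\<lambda>s. rhs_U h (?g s) (?U s) (?V s) (?Q s) (xi0 s) x)"
        by (rule set_integrable_cong[OF refl refl, THEN iffD1, OF _ i]) (simp add: base)
      fix t assume t: "t \<in> {0..T}"
      have "(LBINT s=ereal 0..ereal t. rhs_U h (?g s) (?U s) (?V s) (?Q s) (xi0 s) x)
         = (LBINT s=ereal 0..ereal t. rhs_U h (?g s) (?U s) (?V s) (?Q s) 0 x)"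
        by (rule interval_integral_cong) (use t in \<open>auto simp: base einterval_iff min_def max_def split: if_splits\<close>)
      then show "?U t x = U_of Z0 x + (LBINT s=0..ereal t. rhs_U h (?g s) (?U s) (?V s) (?Q s) (xi0 s) x)"
        using comps(2)[of T x] t unfolding zero_ereal_def by simp
    qed
    show ?thesis
      unfolding sol_on_def
    proof (intro conjI AE_I2)
      show "\<exists>C. \<forall>t\<in>{0..T}. H1_bdd C (?g t) \<and> H1_bdd C (?U t) \<and> Linf_bdd C (?V t) \<and> Linf_bdd C (?W t) \<and> Linf_bdd C (?Q t)"
        using reg[OF Cb(1) _ Cb(3)] Cb(2) by blast
      show "\<forall>t\<in>{0..T}. ?g t (xi0 t) + xi0 t = 0" using xi0 by simp
    qed (use U comps in blast)+
  qed
  have "global_sol h (gam_of Z0) (U_of Z0) (V_of Z0) (W_of Z0) (Q_of Z0) ?g ?U ?V ?W ?Q xi0"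
    unfolding global_sol_def
  proof (intro conjI allI impI)
    fix T :: real assume "0 < T" then show "sol_on h T (gam_of Z0) (U_of Z0) (V_of Z0) (W_of Z0) (Q_of Z0) ?g ?U ?V ?W ?Q xi0"
      by (rule sol)
  next
    fix t :: real assume t: "0 \<le> t"
    obtain C where Cb: "C \<ge> 1" "\<forall>t\<in>{0..t}. norm (Z t) \<le> C" "lagrangian_flow {} t C ?g ?U ?V ?W ?Q h"
      using fl[OF t] by blast
    note r = reg[OF Cb(1) bspec[OF Cb(2)] Cb(3), of t]
    show "\<exists>L. L-lipschitz_on UNIV (?g t)" "\<exists>L. L-lipschitz_on UNIV (?U t)" "\<exists>C. Linf_bdd C (?V t)"
      "\<exists>C. Linf_bdd C (?W t)" "\<exists>C. Linf_bdd C (?Q t)"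
      using r t by auto
  qed
  then show ?thesis by (rule that)
qed

end

subsection \<open>Uniqueness\<close>

lemma P1_cong_AE:
  assumes "locbm U" "locbm V" "locbm Q" "locbm U'" "locbm V'" "locbm Q'"
    and "AE x in lborel. U x = U' x \<and> V x = V' x \<and> Q x = Q' x"
  shows "P1 U V Q = P1 U' V' Q'"
  unfolding P1_def
proof (rule interval_integral_cong_AE_lborel)
  show "AE z in lborel. 2 * U z * Q z * V z - U z * Q z = 2 * U' z * Q' z * V' z - U' z * Q' z"
    using assms(7) by eventually_elim simp
qed (intro locbm_intros assms)+

lemma Kf_cong_AE:
  assumes "locbm U" "locbm V" "locbm Q" "locbm U'" "locbm V'" "locbm Q'"
    and "AE x in lborel. U x = U' x \<and> V x = V' x \<and> Q x = Q' x"
  shows "Kf U V Q a x = Kf U' V' Q' a x"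
  unfolding Kf_def
proof (rule interval_integral_cong_AE_lborel)
  show "AE z in lborel. 2 * U z * Q z * V z - U z * Q z = 2 * U' z * Q' z * V' z - U' z * Q' z"
    using assms(7) by eventually_elim simp
qed (intro locbm_intros assms)+

lemma locbm_Kf:
  assumes "locbm U" "locbm V" "locbm Q"
  shows "locbm (Kf U V Q a)"
  unfolding Kf_def by (intro locbm_cont continuous_on_indefinite_integral_locbm locbm_intros assms)

text \<open>Apart from integrals, which ignore null sets, the right-hand side contains the value of
  gamma at the point x itself, hence the pointwise hypothesis.\<close>

lemma rhs_U_cong_AE:
  assumes l: "locbm U" "locbm V" "locbm Q" "locbm U'" "locbm V'" "locbm Q'" and g: "locbm g" "locbm g'"
    and eq: "AE x in lborel. U x = U' x \<and> V x = V' x \<and> Q x = Q' x" "AE x in lborel. g x = g' x"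
    and x: "g x = g' x"
  shows "rhs_U h g U V Q a x = rhs_U h g' U' V' Q' a x"
proof -
  note P = P1_cong_AE[OF l eq(1)] and K = Kf_cong_AE[OF l eq(1)]
  have "(LBINT e=0..1. (2 * Q e * V e - Q e) * (Kf U V Q a e - P1 U V Q * (g e + e)))
     = (LBINT e=0..1. (2 * Q' e * V' e - Q' e) * (Kf U' V' Q' a e - P1 U' V' Q' * (g' e + e)))"
  proof (rule interval_integral_cong_AE_lborel)
    show "AE e in lborel. (2 * Q e * V e - Q e) * (Kf U V Q a e - P1 U V Q * (g e + e))
       = (2 * Q' e * V' e - Q' e) * (Kf U' V' Q' a e - P1 U' V' Q' * (g' e + e))"
      using eq by eventually_elim (simp add: P K)
  qed (intro locbm_intros l g locbm_id locbm_Kf)+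
  then show ?thesis by (simp add: rhs_U_def P K x)
qed

lemma P1_eq_Kf: "P1 U V Q = Kf U V Q 0 1"
  unfolding P1_def Kf_def zero_ereal_def one_ereal_def ..

text \<open>A numerical index lets one Gronwall family run over pairs of a component and a point.
  Every index from 4 on stands for Q.\<close>

definition component :: "nat \<Rightarrow> state \<Rightarrow> bmf" where
  "component k Z = (if k = 0 then cg Z else if k = 1 then cU Z else if k = 2 then cV Z else if k = 3 then cW Z else cQ Z)"

lemma bounded_linear_component: "bounded_linear (\<lambda>Z. bmf_app (component k Z) x)"
  by (cases "k = 0"; cases "k = 1"; cases "k = 2"; cases "k = 3")
    (simp_all add: component_def bounded_linear_components)

lemma norm_component: "norm (component k Z) \<le> norm Z"
  unfolding component_def using state_norms by simp

text \<open>The exceptional set is invariant under the unit translation, so that altering periodic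
  functions on it keeps them periodic.\<close>

locale local_solution = ivp + bounded_family +
  fixes xi0 :: "real \<Rightarrow> real"
  assumes shift: "\<And>x. x + 1 \<in> N \<longleftrightarrow> x \<in> N"
    and mild:
      "\<And>t x. t \<in> {0..T} \<Longrightarrow> x \<notin> N \<Longrightarrow> ((\<lambda>s. rhs_gamma (U s) x) has_integral gam t x - gam_of Z0 x) {0..t}"
      "\<And>t x. t \<in> {0..T} \<Longrightarrow> x \<notin> N \<Longrightarrow>
        ((\<lambda>s. rhs_U h (gam s) (U s) (V s) (Q s) (xi0 s) x) has_integral U t x - U_of Z0 x) {0..t}"
      "\<And>t x. t \<in> {0..T} \<Longrightarrow> x \<notin> N \<Longrightarrow>
        ((\<lambda>s. rhs_V (U s) (V s) (W s) (Q s) x) has_integral V t x - V_of Z0 x) {0..t}"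
      "\<And>t x. t \<in> {0..T} \<Longrightarrow> x \<notin> N \<Longrightarrow>
        ((\<lambda>s. rhs_W (U s) (V s) (Q s) x) has_integral W t x - W_of Z0 x) {0..t}"
      "\<And>t x. t \<in> {0..T} \<Longrightarrow> x \<notin> N \<Longrightarrow>
        ((\<lambda>s. rhs_Q (U s) (V s) (W s) (Q s) x) has_integral Q t x - Q_of Z0 x) {0..t}"
begin

lemma continuous_in_time:
  assumes "x \<notin> N"
  shows "continuous_on {0..T} (\<lambda>t. gam t x)" "continuous_on {0..T} (\<lambda>t. U t x)" "continuous_on {0..T} (\<lambda>t. V t x)"
    "continuous_on {0..T} (\<lambda>t. W t x)" "continuous_on {0..T} (\<lambda>t. Q t x)"
  using mild_continuous[OF mild(1)[OF _ assms]] mild_continuous[OF mild(2)[OF _ assms]] mild_continuous[OF mild(3)[OF _ assms]]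
    mild_continuous[OF mild(4)[OF _ assms]] mild_continuous[OF mild(5)[OF _ assms]] T by auto

lemma initial:
  assumes "x \<notin> N"
  shows "gam 0 x = gam_of Z0 x" "U 0 x = U_of Z0 x" "V 0 x = V_of Z0 x"
    "W 0 x = W_of Z0 x" "Q 0 x = Q_of Z0 x"
proof -
  have z: "a = c" if "(r has_integral a - c) {0..0}" for r :: "real \<Rightarrow> real" and a c
    using integral_unique[OF that] by simp
  have T0: "0 \<in> {0..T}" using T by simp
  show "gam 0 x = gam_of Z0 x" "U 0 x = U_of Z0 x" "V 0 x = V_of Z0 x"
    "W 0 x = W_of Z0 x" "Q 0 x = Q_of Z0 x"
    by (rule z[OF mild(1)[OF T0 assms]] z[OF mild(2)[OF T0 assms]] z[OF mild(3)[OF T0 assms]]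
        z[OF mild(4)[OF T0 assms]] z[OF mild(5)[OF T0 assms]])+
qed

text \<open>The nonlocal terms of the equations are continuous in time by dominated convergence,
  although continuity in time is known only pointwise off N.\<close>

lemma continuous_Kf: "continuous_on {0..T} (\<lambda>t. Kf (U t) (V t) (Q t) e x)"
  unfolding Kf_def
proof (rule continuous_on_param_integral[where C = "2 * C * C * C + C * C"])
  show "(\<lambda>e. 2 * U t e * Q t e * V t e - U t e * Q t e) \<in> borel_measurable borel" if "t \<in> {0..T}" for t
    using meas[OF that] by measurable
  show "AE s in lborel. continuous_on {0..T} (\<lambda>t. 2 * U t s * Q t s * V t s - U t s * Q t s)"
    using AE_N by eventually_elim (intro continuous_intros continuous_in_time)
  show "AE s in lborel. s \<in> {min e x..max e x} \<longrightarrow> (\<forall>t\<in>{0..T}. \<bar>2 * U t s * Q t s * V t s - U t s * Q t s\<bar> \<le> 2 * C * C * C + C * C)"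
    using AE_N by eventually_elim (use omega_bound in blast)
qed

text \<open>The zeros \<open>xi0\<close> are an arbitrary choice and need not be continuous in time,
  so differentiability of U itself is not yet available. In differences of U the base point drops
  out and the right-hand side is continuous in time.\<close>

lemma flow: "lagrangian_flow N T C gam U V W Q h"
proof
  have cp: "continuous_on {0..T} (\<lambda>t. P1 (U t) (V t) (Q t))" unfolding P1_eq_Kf by (rule continuous_Kf)
  fix t x assume t: "t \<in> {0..T}" and x: "x \<notin> N"
  note c = continuous_in_time[OF x] cp
  show "((\<lambda>t. gam t x) has_real_derivative rhs_gamma (U t) x) (at t within {0..T})"
    by (rule mild_derivative[OF mild(1)[OF _ x] _ t]) (auto simp: rhs_gamma_def intro!: continuous_intros c)
  show "((\<lambda>t. V t x) has_real_derivative rhs_V (U t) (V t) (W t) (Q t) x) (at t within {0..T})"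
    by (rule mild_derivative[OF mild(3)[OF _ x] _ t]) (auto simp: rhs_V_def intro!: continuous_intros c)
  show "((\<lambda>t. W t x) has_real_derivative rhs_W (U t) (V t) (Q t) x) (at t within {0..T})"
    by (rule mild_derivative[OF mild(4)[OF _ x] _ t]) (auto simp: rhs_W_def intro!: continuous_intros c)
  show "((\<lambda>t. Q t x) has_real_derivative rhs_Q (U t) (V t) (W t) (Q t) x) (at t within {0..T})"
    by (rule mild_derivative[OF mild(5)[OF _ x] _ t]) (auto simp: rhs_Q_def intro!: continuous_intros c)
  fix e assume e: "e \<notin> N"
  show "((\<lambda>t. U t x - U t e) has_real_derivative Kf (U t) (V t) (Q t) e x - P1 (U t) (V t) (Q t) * (gam t x + x - (gam t e + e)))
      (at t within {0..T})"
  proof (rule mild_derivative[where c = "U_of Z0 x - U_of Z0 e", OF _ _ t])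
    show "continuous_on {0..T} (\<lambda>t. Kf (U t) (V t) (Q t) e x - P1 (U t) (V t) (Q t) * (gam t x + x - (gam t e + e)))"
      by (intro continuous_intros continuous_Kf c continuous_in_time[OF e])
    fix t assume t: "t \<in> {0..T}"
    have "((\<lambda>s. rhs_U h (gam s) (U s) (V s) (Q s) (xi0 s) x - rhs_U h (gam s) (U s) (V s) (Q s) (xi0 s) e)
        has_integral U t x - U_of Z0 x - (U t e - U_of Z0 e)) {0..t}"
      by (intro has_integral_diff mild t x e)
    then have "((\<lambda>s. rhs_U h (gam s) (U s) (V s) (Q s) (xi0 s) x - rhs_U h (gam s) (U s) (V s) (Q s) (xi0 s) e)
        has_integral U t x - U t e - (U_of Z0 x - U_of Z0 e)) {0..t}"
      by (simp add: algebra_simps)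
    then show "((\<lambda>t. Kf (U t) (V t) (Q t) e x - P1 (U t) (V t) (Q t) * (gam t x + x - (gam t e + e)))
        has_integral U t x - U t e - (U_of Z0 x - U_of Z0 e)) {0..t}"
      by (rule has_integral_eq[rotated]) (use t locbm in \<open>auto intro!: rhs_U_diff\<close>)
  qed
next
  fix x assume x: "x \<notin> N"
  show "(V 0 x)\<^sup>2 + (W 0 x)\<^sup>2 = V 0 x" unfolding initial[OF x] Z0 by (rule initial_circle)
  have T0: "0 \<in> {0..T}" using T by simp
  have I: "(LBINT s=ereal a..ereal b. Q 0 s * F 0 s) = (LBINT s=ereal a..ereal b. Q_of Z0 s * bmf_app f s)"
    if "\<And>x. x \<notin> N \<Longrightarrow> F 0 x = bmf_app f x" "locbm (F 0)" for a b F f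
  proof (rule interval_integral_cong_AE_lborel)
    show "AE s in lborel. Q 0 s * F 0 s = Q_of Z0 s * bmf_app f s"
      using AE_N by eventually_elim (simp add: initial that)
  qed (intro locbm_intros locbm_bmf_app locbm[OF T0] that)+
  fix e assume e: "e \<notin> N"
  show "gam 0 x + x - (gam 0 e + e) = (LBINT s=ereal e..ereal x. Q 0 s * V 0 s)"
  proof -
    have "(LBINT s=ereal e..ereal x. Q 0 s * V 0 s) = (LBINT s=ereal e..ereal x. Q_of Z0 s * V_of Z0 s)"
      by (rule I) (auto simp: initial intro: locbm[OF T0])
    also have "\<dots> = y0 x - y0 e" unfolding Z0 by (rule y0_diff[symmetric])
    finally show ?thesis by (simp add: initial[OF x] initial[OF e] Z0)
  qed
  show "U 0 x - U 0 e = (LBINT s=ereal e..ereal x. Q 0 s * W 0 s)"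
  proof -
    have "(LBINT s=ereal e..ereal x. Q 0 s * W 0 s) = (LBINT s=ereal e..ereal x. Q_of Z0 s * W_of Z0 s)"
      by (rule I) (auto simp: initial intro: locbm[OF T0])
    also have "\<dots> = u0 (y0 x) - u0 (y0 e)" unfolding Z0 by (rule U0_diff[symmetric])
    finally show ?thesis by (simp add: initial[OF x] initial[OF e] Z0)
  qed
next
  have T0: "0 \<in> {0..T}" using T by simp
  have "(LBINT s=ereal 0..ereal 1. Q 0 s) = (LBINT s=ereal 0..ereal 1. Q_of Z0 s)"
  proof (rule interval_integral_cong_AE_lborel)
    show "AE s in lborel. Q 0 s = Q_of Z0 s" using AE_N by eventually_elim (simp add: initial)
  qed (intro locbm_bmf_app locbm[OF T0])+
  also have "\<dots> = 1 + h" unfolding Z0 by simp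
  finally show "(LBINT s=0..1. Q 0 s) = 1 + h" unfolding zero_ereal_def one_ereal_def .
qed

text \<open>On the exceptional set the values are taken from the global solution, so that the
  modified state differs from it only where the equations hold.\<close>

lemma bmf_modification:
  assumes "periodic1 f" "f \<in> borel_measurable borel" "\<And>x. x \<notin> N \<Longrightarrow> \<bar>f x\<bar> \<le> C"
  shows "\<exists>F. bmf_app F = (\<lambda>x. if x \<in> N then bmf_app G x else f x)"
proof (rule exI, rule Bmf_inverse, rule bmf_mem_I[where C = "max C (norm G)"])
  show "periodic1 (\<lambda>x. if x \<in> N then bmf_app G x else f x)"
    unfolding periodic1_def using shift periodic1_shift[OF assms(1)] periodic1_shift[OF bmf_app_props(1)] by simp
  have [measurable]: "N \<in> sets borel" using null by (auto simp: null_sets_def)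
  have [measurable]: "f \<in> borel_measurable borel" by (rule assms)
  show "(\<lambda>x. if x \<in> N then bmf_app G x else f x) \<in> borel_measurable borel"
    using bmf_app_props(2)[of G] by measurable
  show "\<bar>if x \<in> N then bmf_app G x else f x\<bar> \<le> max C (norm G)" for x
    using assms(3)[of x] abs_bmf_app_le[of G x] by auto
qed

text \<open>Altered on N, the solution becomes a family of states Y that satisfies the integrated
  equation off N and equals Z on N. The Lipschitz bound of the field, which is one in the supremum
  norm, can therefore be fed by estimates off N alone.\<close>

lemma agrees_with_ode_sol:
  assumes Z: "ode_sol (vecfield h) Z0 T Z" and t: "t \<in> {0..T}" and x: "x \<notin> N"
  shows "gam t x = gam_of (Z t) x" "U t x = U_of (Z t) x" "V t x = V_of (Z t) x"
    "W t x = W_of (Z t) x" "Q t x = Q_of (Z t) x"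
proof -
  interpret fl: lagrangian_flow N T C gam U V W Q h by (rule flow)
  define mods where "mods t Y \<longleftrightarrow> gam_of Y = (\<lambda>x. if x \<in> N then gam_of (Z t) x else gam t x) \<and>
      U_of Y = (\<lambda>x. if x \<in> N then U_of (Z t) x else U t x) \<and>
      V_of Y = (\<lambda>x. if x \<in> N then V_of (Z t) x else V t x) \<and>
      W_of Y = (\<lambda>x. if x \<in> N then W_of (Z t) x else W t x) \<and>
      Q_of Y = (\<lambda>x. if x \<in> N then Q_of (Z t) x else Q t x)" for t and Y :: state
  have "\<exists>Y. mods t Y" if t: "t \<in> {0..T}" for t
  proof -
    obtain a where "bmf_app a = (\<lambda>x. if x \<in> N then gam_of (Z t) x else gam t x)"
      using bmf_modification[OF per(1)[OF t] meas(1)[OF t] bd(1)[OF t]] by blast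
    moreover obtain b where "bmf_app b = (\<lambda>x. if x \<in> N then U_of (Z t) x else U t x)"
      using bmf_modification[OF per(2)[OF t] meas(2)[OF t] bd(2)[OF t]] by blast
    moreover obtain c where "bmf_app c = (\<lambda>x. if x \<in> N then V_of (Z t) x else V t x)"
      using bmf_modification[OF per(3)[OF t] meas(3)[OF t] bd(3)[OF t]] by blast
    moreover obtain d where "bmf_app d = (\<lambda>x. if x \<in> N then W_of (Z t) x else W t x)"
      using bmf_modification[OF per(4)[OF t] meas(4)[OF t] bd(4)[OF t]] by blast
    moreover obtain e where "bmf_app e = (\<lambda>x. if x \<in> N then Q_of (Z t) x else Q t x)"
      using bmf_modification[OF per(5)[OF t] meas(5)[OF t] bd(5)[OF t]] by blast
    ultimately show ?thesis unfolding mods_def by (intro exI[of _ "(a, b, c, d, e)"]) simp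
  qed
  then have "\<exists>Y. \<forall>t\<in>{0..T}. mods t (Y t)" by (intro bchoice) blast
  then obtain Y where mods: "\<And>t. t \<in> {0..T} \<Longrightarrow> mods t (Y t)" by blast
  have Y:
      "\<And>t. t \<in> {0..T} \<Longrightarrow> gam_of (Y t) = (\<lambda>x. if x \<in> N then gam_of (Z t) x else gam t x)"
      "\<And>t. t \<in> {0..T} \<Longrightarrow> U_of (Y t) = (\<lambda>x. if x \<in> N then U_of (Z t) x else U t x)"
      "\<And>t. t \<in> {0..T} \<Longrightarrow> V_of (Y t) = (\<lambda>x. if x \<in> N then V_of (Z t) x else V t x)"
      "\<And>t. t \<in> {0..T} \<Longrightarrow> W_of (Y t) = (\<lambda>x. if x \<in> N then W_of (Z t) x else W t x)"
      "\<And>t. t \<in> {0..T} \<Longrightarrow> Q_of (Y t) = (\<lambda>x. if x \<in> N then Q_of (Z t) x else Q t x)"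
    using mods unfolding mods_def by blast+
  \<comment> \<open>Integrals do not see the change on N, and the mean of 2QV - Q makes base point 0
    equivalent to \<open>xi0\<close>; the field at Y thus equals the original right-hand sides off
    N.\<close>
  have F: "gam_of (vecfield h (Y s)) x = rhs_gamma (U s) x"
      "U_of (vecfield h (Y s)) x = rhs_U h (gam s) (U s) (V s) (Q s) (xi0 s) x"
      "V_of (vecfield h (Y s)) x = rhs_V (U s) (V s) (W s) (Q s) x"
      "W_of (vecfield h (Y s)) x = rhs_W (U s) (V s) (Q s) x"
      "Q_of (vecfield h (Y s)) x = rhs_Q (U s) (V s) (W s) (Q s) x"
    if s: "s \<in> {0..T}" and x: "x \<notin> N" for s x
  proof -
    have eq: "AE x in lborel. U_of (Y s) x = U s x \<and> V_of (Y s) x = V s x \<and> Q_of (Y s) x = Q s x"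
      "AE x in lborel. gam_of (Y s) x = gam s x"
      using AE_N by (eventually_elim, simp add: Y[OF s])+
    have P: "P1 (U_of (Y s)) (V_of (Y s)) (Q_of (Y s)) = P1 (U s) (V s) (Q s)"
      by (rule P1_cong_AE[OF _ _ _ _ _ _ eq(1)]) (intro locbm_bmf_app locbm[OF s])+
    have "rhs_U h (gam_of (Y s)) (U_of (Y s)) (V_of (Y s)) (Q_of (Y s)) 0 x
        = rhs_U h (gam s) (U s) (V s) (Q s) 0 x"
      by (rule rhs_U_cong_AE[OF locbm_bmf_app locbm_bmf_app locbm_bmf_app locbm(2,3,5)[OF s] locbm_bmf_app locbm(1)[OF s] eq])
        (use x in \<open>simp add: Y[OF s]\<close>)
    also have "\<dots> = rhs_U h (gam s) (U s) (V s) (Q s) (xi0 s) x"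
      by (rule rhs_U_base_point[OF _ _ _ _ h_ne fl.int_w[OF s]]) (rule locbm[OF s])+
    finally show "U_of (vecfield h (Y s)) x = rhs_U h (gam s) (U s) (V s) (Q s) (xi0 s) x"
      by (simp only: vecfield_app)
    show "gam_of (vecfield h (Y s)) x = rhs_gamma (U s) x"
      "V_of (vecfield h (Y s)) x = rhs_V (U s) (V s) (W s) (Q s) x"
      "W_of (vecfield h (Y s)) x = rhs_W (U s) (V s) (Q s) x"
      "Q_of (vecfield h (Y s)) x = rhs_Q (U s) (V s) (W s) (Q s) x"
      unfolding vecfield_app rhs_gamma_def rhs_V_def rhs_W_def rhs_Q_def P using x by (simp_all add: Y[OF s])
  qed
  have Yint: "((\<lambda>s. bmf_app (component k (vecfield h (Y s))) x) has_integral
      bmf_app (component k (Y t)) x - bmf_app (component k Z0) x) {0..t}"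
    if t: "t \<in> {0..T}" and x: "x \<notin> N" for k t x
  proof -
    have sT: "s \<in> {0..T}" if "s \<in> {0..t}" for s using that t by auto
    have 0: "((\<lambda>s. gam_of (vecfield h (Y s)) x) has_integral gam_of (Y t) x - gam_of Z0 x) {0..t}"
      by (rule has_integral_eq[OF F(1)[OF sT x, symmetric]]) (use mild(1)[OF t x] x in \<open>simp_all add: Y[OF t]\<close>)
    have 1: "((\<lambda>s. U_of (vecfield h (Y s)) x) has_integral U_of (Y t) x - U_of Z0 x) {0..t}"
      by (rule has_integral_eq[OF F(2)[OF sT x, symmetric]]) (use mild(2)[OF t x] x in \<open>simp_all add: Y[OF t]\<close>)
    have 2: "((\<lambda>s. V_of (vecfield h (Y s)) x) has_integral V_of (Y t) x - V_of Z0 x) {0..t}"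
      by (rule has_integral_eq[OF F(3)[OF sT x, symmetric]]) (use mild(3)[OF t x] x in \<open>simp_all add: Y[OF t]\<close>)
    have 3: "((\<lambda>s. W_of (vecfield h (Y s)) x) has_integral W_of (Y t) x - W_of Z0 x) {0..t}"
      by (rule has_integral_eq[OF F(4)[OF sT x, symmetric]]) (use mild(4)[OF t x] x in \<open>simp_all add: Y[OF t]\<close>)
    have 4: "((\<lambda>s. Q_of (vecfield h (Y s)) x) has_integral Q_of (Y t) x - Q_of Z0 x) {0..t}"
      by (rule has_integral_eq[OF F(5)[OF sT x, symmetric]]) (use mild(5)[OF t x] x in \<open>simp_all add: Y[OF t]\<close>)
    show ?thesis unfolding component_def using 0 1 2 3 4 by (cases "k = 0"; cases "k = 1"; cases "k = 2"; cases "k = 3") simp_all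
  qed
  have Zint: "((\<lambda>s. bmf_app (component k (vecfield h (Z s))) x) has_integral
      bmf_app (component k (Z t)) x - bmf_app (component k Z0) x) {0..t}" if t: "t \<in> {0..T}" for k t x
    using has_integral_linear[OF ode_sol_has_integral[OF Z t] bounded_linear_component[of k x]]
    by (simp add: comp_def bounded_linear.linear[OF bounded_linear_component, THEN linear_diff])
  obtain CZ where CZ: "\<forall>t\<in>{0..T}. norm (Z t) \<le> CZ" using ode_sol_bounded[OF Z] by blast
  \<comment> \<open>The norm of a state is at most the sum of the norms of its five
    components.\<close>
  define R where "R = 5 * max C CZ"
  have YN: "bmf_app (component k (Y t)) x = bmf_app (component k (Z t)) x" if "t \<in> {0..T}" "x \<in> N" for k t x
    using that by (simp add: component_def Y)
  have YR: "norm (Y t) \<le> R" if t: "t \<in> {0..T}" for t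
  proof -
    have "\<bar>bmf_app (component k (Y t)) x\<bar> \<le> max C CZ" for k x
    proof (cases "x \<in> N")
      case True
      then show ?thesis
        using YN[OF t True, of k] order.trans[OF abs_bmf_app_le[of "component k (Z t)" x] order.trans[OF norm_component bspec[OF CZ t]]]
        by simp
    next
      case False
      then show ?thesis using bd[OF t False] by (simp add: component_def Y[OF t] le_max_iff_disj)
    qed
    then have "norm (component k (Y t)) \<le> max C CZ" for k by (rule norm_bmf_le)
    from this[of 0] this[of 1] this[of 2] this[of 3] this[of 4] show ?thesis
      using state_norm_le[of "Y t"] by (simp add: component_def R_def)
  qed
  have ZR: "norm (Z t) \<le> R" if "t \<in> {0..T}" for t
    using bspec[OF CZ that] C by (simp add: R_def max_def)
  obtain L where L: "0 \<le> L" "\<forall>x y. norm x \<le> R \<longrightarrow> norm y \<le> R \<longrightarrow> norm (vecfield h x - vecfield h y) \<le> L * norm (x - y)"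
    using lip_on_ballsD[OF lip_vecfield, of R h] by blast
  \<comment> \<open>The difference of two states has norm at most five times the common bound on its
    components, whence the constant 5 L.\<close>
  have zero: "bmf_app (component k (Y t)) x - bmf_app (component k (Z t)) x = 0" for k
  proof (rule gronwall_family[where S = "{z. snd z \<notin> N}" and i = "(k, x)" and T = T and t = t and C = "5 * L" and M = "2 * R"
      and \<phi> = "\<lambda>z t. bmf_app (component (fst z) (Y t)) (snd z) - bmf_app (component (fst z) (Z t)) (snd z)"
      and \<psi> = "\<lambda>z t. bmf_app (component (fst z) (vecfield h (Y t))) (snd z) - bmf_app (component (fst z) (vecfield h (Z t))) (snd z)", simplified fst_conv snd_conv])
    show "0 \<le> 5 * L" using L by simp
    show "(k, x) \<in> {z. snd z \<notin> N}" using x by simp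
    show "t \<in> {0..T}" by (rule t)
    fix z :: "nat \<times> real" and t assume z: "z \<in> {z. snd z \<notin> N}" and t: "t \<in> {0..T}"
    show "((\<lambda>t. bmf_app (component (fst z) (vecfield h (Y t))) (snd z) - bmf_app (component (fst z) (vecfield h (Z t))) (snd z)) has_integral
        bmf_app (component (fst z) (Y t)) (snd z) - bmf_app (component (fst z) (Z t)) (snd z)) {0..t}"
      using has_integral_diff[OF Yint[OF t, of "snd z" "fst z"] Zint[OF t, of "fst z" "snd z"]] z by simp
    show "norm (bmf_app (component (fst z) (Y t)) (snd z) - bmf_app (component (fst z) (Z t)) (snd z)) \<le> 2 * R"
      using order.trans[OF abs_bmf_app_le order.trans[OF norm_component YR[OF t]], of "fst z" "snd z"]
        order.trans[OF abs_bmf_app_le order.trans[OF norm_component ZR[OF t]], of "fst z" "snd z"]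
      unfolding real_norm_def by linarith
  next
    fix t b and z :: "nat \<times> real"
    assume t: "t \<in> {0..T}" and z: "z \<in> {z. snd z \<notin> N}"
      and b: "\<And>z. z \<in> {z. snd z \<notin> N} \<Longrightarrow> norm (bmf_app (component (fst z) (Y t)) (snd z) - bmf_app (component (fst z) (Z t)) (snd z)) \<le> b"
    have b0: "0 \<le> b" using order.trans[OF norm_ge_zero b[OF z]] .
    have cd: "component k (Y t - Z t) = component k (Y t) - component k (Z t)" for k by (simp add: component_def)
    \<comment> \<open>Y and Z agree on N by construction, so a bound off N is a bound in the
      supremum norm.\<close>
    have "norm (component k (Y t - Z t)) \<le> b" for k
    proof (rule norm_bmf_le)
      fix x
      show "\<bar>bmf_app (component k (Y t - Z t)) x\<bar> \<le> b"
        using b[of "(k, x)"] YN[OF t, of x k] b0 by (cases "x \<in> N") (simp_all add: cd)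
    qed
    from this[of 0] this[of 1] this[of 2] this[of 3] this[of 4] have YZ: "norm (Y t - Z t) \<le> 5 * b"
      using state_norm_le[of "Y t - Z t"] by (simp add: component_def)
    have "\<bar>bmf_app (component (fst z) (vecfield h (Y t) - vecfield h (Z t))) (snd z)\<bar> \<le> norm (vecfield h (Y t) - vecfield h (Z t))"
      by (rule order.trans[OF abs_bmf_app_le norm_component])
    also have "\<dots> \<le> L * norm (Y t - Z t)" using L(2) YR[OF t] ZR[OF t] by blast
    also have "\<dots> \<le> L * (5 * b)" using YZ L(1) by (rule mult_left_mono)
    finally show "norm (bmf_app (component (fst z) (vecfield h (Y t))) (snd z) - bmf_app (component (fst z) (vecfield h (Z t))) (snd z)) \<le> 5 * L * b"
      by (simp add: bounded_linear.linear[OF bounded_linear_component, THEN linear_diff])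
  qed
  show "gam t x = gam_of (Z t) x" "U t x = U_of (Z t) x" "V t x = V_of (Z t) x"
    "W t x = W_of (Z t) x" "Q t x = Q_of (Z t) x"
    using zero[of 0] zero[of 1] zero[of 2] zero[of 3] zero[of 4] x by (simp_all add: component_def Y[OF t])
qed

end

context ivp
begin

text \<open>The exceptional set of the bounds depends on the time; continuity in time off the exceptional set
  of the equations reduces them to a countable dense set of times.\<close>

lemma local_solution_of_sol_on:
  assumes sol: "sol_on h T (gam_of Z0) (U_of Z0) (V_of Z0) (W_of Z0) (Q_of Z0) gam U V W Q xi0"
    and T: "0 < T"
  shows "\<exists>N C. local_solution u0 u0x y0 h Z0 N T C gam U V W Q xi0"
proof -
  obtain C where C: "\<forall>t\<in>{0..T}. H1_bdd C (gam t) \<and> H1_bdd C (U t) \<and> Linf_bdd C (V t) \<and> Linf_bdd C (W t) \<and> Linf_bdd C (Q t)"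
    using sol unfolding sol_on_def by blast
  define mildset where "mildset x \<longleftrightarrow>
        set_integrable lborel {0..T} (\<lambda>s. rhs_gamma (U s) x) \<and>
        set_integrable lborel {0..T} (\<lambda>s. rhs_U h (gam s) (U s) (V s) (Q s) (xi0 s) x) \<and>
        set_integrable lborel {0..T} (\<lambda>s. rhs_V (U s) (V s) (W s) (Q s) x) \<and>
        set_integrable lborel {0..T} (\<lambda>s. rhs_W (U s) (V s) (Q s) x) \<and>
        set_integrable lborel {0..T} (\<lambda>s. rhs_Q (U s) (V s) (W s) (Q s) x) \<and>
        (\<forall>t\<in>{0..T}.
           gam t x = gam_of Z0 x + (LBINT s=0..ereal t. rhs_gamma (U s) x) \<and>
           U t x = U_of Z0 x + (LBINT s=0..ereal t. rhs_U h (gam s) (U s) (V s) (Q s) (xi0 s) x) \<and>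
           V t x = V_of Z0 x + (LBINT s=0..ereal t. rhs_V (U s) (V s) (W s) (Q s) x) \<and>
           W t x = W_of Z0 x + (LBINT s=0..ereal t. rhs_W (U s) (V s) (Q s) x) \<and>
           Q t x = Q_of Z0 x + (LBINT s=0..ereal t. rhs_Q (U s) (V s) (W s) (Q s) x))" for x
  have ms: "AE x in lborel. mildset x" using sol unfolding sol_on_def mildset_def by blast
  obtain D where D: "countable D" "D \<subseteq> {0..T}" "{0..T} \<subseteq> closure D" by (rule separable)
  have clD: "closure D = {0..T}" using D closure_minimal[OF D(2) closed_atLeastAtMost] by blast
  have "AE x in lborel. \<forall>t\<in>D. \<bar>V t x\<bar> \<le> C \<and> \<bar>W t x\<bar> \<le> C \<and> \<bar>Q t x\<bar> \<le> C"
    using C D(2) by (intro AE_ball_countable' D(1)) (auto simp: Linf_bdd_def)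
  with ms have "AE x in lborel. mildset x \<and> (\<forall>t\<in>D. \<bar>V t x\<bar> \<le> C \<and> \<bar>W t x\<bar> \<le> C \<and> \<bar>Q t x\<bar> \<le> C)"
    by eventually_elim blast
  then obtain N1 where N1: "\<And>x. x \<in> space lborel - N1 \<Longrightarrow> mildset x \<and> (\<forall>t\<in>D. \<bar>V t x\<bar> \<le> C \<and> \<bar>W t x\<bar> \<le> C \<and> \<bar>Q t x\<bar> \<le> C)"
    and N1null: "N1 \<in> null_sets lborel"
    by (rule AE_E3) blast
  \<comment> \<open>The union of all integer translates is still null and is invariant under the
    unit translation.\<close>
  define N where "N = (\<Union>k::int. {x. x - of_int k \<in> N1})"
  have null: "N \<in> null_sets lborel"
    unfolding N_def by (intro null_sets_UN null_sets_translation N1null)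
  have shift: "x + 1 \<in> N \<longleftrightarrow> x \<in> N" for x
  proof
    assume "x + 1 \<in> N"
    then obtain k where "x + 1 - of_int k \<in> N1" unfolding N_def by blast
    then have "x - of_int (k - 1) \<in> N1" by (simp add: algebra_simps)
    then show "x \<in> N" unfolding N_def by blast
  next
    assume "x \<in> N"
    then obtain k where "x - of_int k \<in> N1" unfolding N_def by blast
    then have "x + 1 - of_int (k + 1) \<in> N1" by (simp add: algebra_simps)
    then show "x + 1 \<in> N" unfolding N_def by blast
  qed
  have good: "mildset x" "\<And>t. t \<in> D \<Longrightarrow> \<bar>V t x\<bar> \<le> C" "\<And>t. t \<in> D \<Longrightarrow> \<bar>W t x\<bar> \<le> C" "\<And>t. t \<in> D \<Longrightarrow> \<bar>Q t x\<bar> \<le> C"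
    if "x \<notin> N" for x
  proof -
    have "x \<notin> N1"
    proof
      assume "x \<in> N1"
      then have "x - of_int 0 \<in> N1" by simp
      then show False using that unfolding N_def by blast
    qed
    then show "mildset x" "\<And>t. t \<in> D \<Longrightarrow> \<bar>V t x\<bar> \<le> C" "\<And>t. t \<in> D \<Longrightarrow> \<bar>W t x\<bar> \<le> C" "\<And>t. t \<in> D \<Longrightarrow> \<bar>Q t x\<bar> \<le> C"
      using N1[of x] by auto
  qed
  have mild: "((\<lambda>s. rhs_gamma (U s) x) has_integral gam t x - gam_of Z0 x) {0..t}"
      "((\<lambda>s. rhs_U h (gam s) (U s) (V s) (Q s) (xi0 s) x) has_integral U t x - U_of Z0 x) {0..t}"
      "((\<lambda>s. rhs_V (U s) (V s) (W s) (Q s) x) has_integral V t x - V_of Z0 x) {0..t}"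
      "((\<lambda>s. rhs_W (U s) (V s) (Q s) x) has_integral W t x - W_of Z0 x) {0..t}"
      "((\<lambda>s. rhs_Q (U s) (V s) (W s) (Q s) x) has_integral Q t x - Q_of Z0 x) {0..t}"
    if t: "t \<in> {0..T}" and x: "x \<notin> N" for t x
  proof -
    note m = good(1)[OF x, unfolded mildset_def]
    have e: "(r has_integral b - a) {0..t}" if "set_integrable lborel {0..T} r" "b = a + (LBINT s=0..ereal t. r s)" for r :: "real \<Rightarrow> real" and a b
      using set_integrable_has_integral[OF that(1) t] that(2) by simp
    show "((\<lambda>s. rhs_gamma (U s) x) has_integral gam t x - gam_of Z0 x) {0..t}" by (rule e) (use m t in blast)+
    show "((\<lambda>s. rhs_U h (gam s) (U s) (V s) (Q s) (xi0 s) x) has_integral U t x - U_of Z0 x) {0..t}" by (rule e) (use m t in blast)+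
    show "((\<lambda>s. rhs_V (U s) (V s) (W s) (Q s) x) has_integral V t x - V_of Z0 x) {0..t}" by (rule e) (use m t in blast)+
    show "((\<lambda>s. rhs_W (U s) (V s) (Q s) x) has_integral W t x - W_of Z0 x) {0..t}" by (rule e) (use m t in blast)+
    show "((\<lambda>s. rhs_Q (U s) (V s) (W s) (Q s) x) has_integral Q t x - Q_of Z0 x) {0..t}" by (rule e) (use m t in blast)+
  qed
  have T0: "0 \<le> T" using T by simp
  have dense: "\<bar>f t\<bar> \<le> C" if "continuous_on {0..T} f" "\<And>t. t \<in> D \<Longrightarrow> \<bar>f t\<bar> \<le> C" "t \<in> {0..T}" for f t
    using continuous_on_closure_norm_le[of D f C t] that unfolding clD by simp
  \<comment> \<open>The first summand covers the essential bounds on V, W and Q, the second the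
    pointwise bound on gamma and U that follows from their Sobolev bound.\<close>
  define C' where "C' = \<bar>C\<bar> + \<bar>1 + 2 * C + 2 * (1 + C)\<^sup>2\<bar>"
  have C': "C \<le> C'" "1 + 2 * C + 2 * (1 + C)\<^sup>2 \<le> C'" "0 \<le> C'" by (auto simp: C'_def)
  have "local_solution u0 u0x y0 h Z0 N T C' gam U V W Q xi0"
  proof
    show "N \<in> null_sets lborel" "\<And>x. (x + 1 \<in> N) = (x \<in> N)" "0 \<le> T" "0 \<le> C'" by (rule null, rule shift, rule T0, rule C')
    fix t assume t: "t \<in> {0..T}"
    note Ct = bspec[OF C t]
    show "gam t \<in> borel_measurable borel" "U t \<in> borel_measurable borel" "V t \<in> borel_measurable borel"
      "W t \<in> borel_measurable borel" "Q t \<in> borel_measurable borel"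
      using Ct H1_bdd_props(2) by (auto simp: Linf_bdd_def)
    show "periodic1 (gam t)" "periodic1 (U t)" "periodic1 (V t)" "periodic1 (W t)" "periodic1 (Q t)"
      using Ct H1_bdd_props(1) by (auto simp: Linf_bdd_def)
    fix x assume x: "x \<notin> N"
    show "\<bar>gam t x\<bar> \<le> C'" "\<bar>U t x\<bar> \<le> C'"
      using Ct H1_bdd_props(3)[of C _ x] C'(2) by (blast intro: order.trans)+
    show "\<bar>V t x\<bar> \<le> C'" by (rule order.trans[OF dense[OF mild_continuous[OF mild(3)[OF _ x] T0] good(2)[OF x] t] C'(1)])
    show "\<bar>W t x\<bar> \<le> C'" by (rule order.trans[OF dense[OF mild_continuous[OF mild(4)[OF _ x] T0] good(3)[OF x] t] C'(1)])
    show "\<bar>Q t x\<bar> \<le> C'" by (rule order.trans[OF dense[OF mild_continuous[OF mild(5)[OF _ x] T0] good(4)[OF x] t] C'(1)])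
    show "((\<lambda>s. rhs_gamma (U s) x) has_integral gam t x - gam_of Z0 x) {0..t}"
      "((\<lambda>s. rhs_U h (gam s) (U s) (V s) (Q s) (xi0 s) x) has_integral U t x - U_of Z0 x) {0..t}"
      "((\<lambda>s. rhs_V (U s) (V s) (W s) (Q s) x) has_integral V t x - V_of Z0 x) {0..t}"
      "((\<lambda>s. rhs_W (U s) (V s) (Q s) x) has_integral W t x - W_of Z0 x) {0..t}"
      "((\<lambda>s. rhs_Q (U s) (V s) (W s) (Q s) x) has_integral Q t x - Q_of Z0 x) {0..t}"
      by (rule mild[OF t x])+
  qed
  then show ?thesis by blast
qed

end

theorem theorem3p2:
  fixes u0 u0x y0 :: "real \<Rightarrow> real" and h :: real
  assumes u0_H1: "is_H1_deriv u0 u0x"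
    and h_def: "h = (LBINT x=0..1. (u0x x)\<^sup>2)"
    and h_ne: "h \<noteq> 1"
    and y0_def: "\<forall>xi. y0 xi + (LBINT x=0..ereal (y0 xi). (u0x x)\<^sup>2) = (1 + h) * xi"
  defines "gam0 \<equiv> (\<lambda>xi. y0 xi - xi)"
    and "U0 \<equiv> (\<lambda>xi. u0 (y0 xi))"
    and "V0 \<equiv> (\<lambda>xi. 1 / (1 + (u0x (y0 xi))\<^sup>2))"
    and "W0 \<equiv> (\<lambda>xi. u0x (y0 xi) / (1 + (u0x (y0 xi))\<^sup>2))"
    and "Q0 \<equiv> (\<lambda>xi. 1 + h)"
  shows "(\<exists>gam U V W Q xi0. global_sol h gam0 U0 V0 W0 Q0 gam U V W Q xi0) \<and>
         (\<forall>T>0. \<forall>gam U V W Q xi0. sol_on h T gam0 U0 V0 W0 Q0 gam U V W Q xi0 \<longrightarrow>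
            (\<exists>gam' U' V' W' Q' xi0'. global_sol h gam0 U0 V0 W0 Q0 gam' U' V' W' Q' xi0' \<and>
               (\<forall>t\<in>{0..T}. AE xi in lborel. gam' t xi = gam t xi \<and> U' t xi = U t xi \<and>
                   V' t xi = V t xi \<and> W' t xi = W t xi \<and> Q' t xi = Q t xi)))"
proof -
  interpret initial_data u0 u0x y0 h
    by standard (rule u0_H1, rule h_def, rule y0_def[rule_format])
  obtain Z0 where Zeq: "gam_of Z0 = gam0" "U_of Z0 = U0" "V_of Z0 = V0" "W_of Z0 = W0"
      "Q_of Z0 = Q0"
    unfolding gam0_def U0_def V0_def W0_def Q0_def by (rule initial_state)
  interpret ivp u0 u0x y0 h Z0
    by standard (simp_all add: h_ne Zeq gam0_def U0_def V0_def W0_def Q0_def)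
  obtain Z where "\<forall>T. ode_sol (vecfield h) Z0 T Z" using global_ode_sol by blast
  then have Z: "ode_sol (vecfield h) Z0 T Z" for T by blast
  obtain xi where glob: "global_sol h gam0 U0 V0 W0 Q0 (\<lambda>t. gam_of (Z t)) (\<lambda>t. U_of (Z t))
      (\<lambda>t. V_of (Z t)) (\<lambda>t. W_of (Z t)) (\<lambda>t. Q_of (Z t)) xi"
    using global_sol_of_ode_sol[OF Z, unfolded Zeq] .
  \<comment> \<open>One and the same global solution extends every local one, whatever zeros of y
    the latter uses as base points.\<close>
  have agree: "\<forall>t\<in>{0..T}. AE x in lborel. gam_of (Z t) x = gam t x \<and> U_of (Z t) x = U t x \<and>
      V_of (Z t) x = V t x \<and> W_of (Z t) x = W t x \<and> Q_of (Z t) x = Q t x"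
    if T: "0 < T" and sol: "sol_on h T gam0 U0 V0 W0 Q0 gam U V W Q xi0" for T gam U V W Q xi0
  proof
    fix t assume t: "t \<in> {0..T}"
    obtain N C where "local_solution u0 u0x y0 h Z0 N T C gam U V W Q xi0"
      using local_solution_of_sol_on[OF _ T, unfolded Zeq, OF sol] by blast
    then interpret local_solution u0 u0x y0 h Z0 N T C gam U V W Q xi0 .
    show "AE x in lborel. gam_of (Z t) x = gam t x \<and> U_of (Z t) x = U t x \<and>
      V_of (Z t) x = V t x \<and> W_of (Z t) x = W t x \<and> Q_of (Z t) x = Q t x"
      using AE_N by eventually_elim (simp add: agrees_with_ode_sol[OF Z t])
  qed
  show ?thesis
  proof (intro conjI allI impI)
    show "\<exists>gam U V W Q xi0. global_sol h gam0 U0 V0 W0 Q0 gam U V W Q xi0"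
      by (intro exI) (rule glob)
    fix T :: real and gam U V W Q xi0
    assume "0 < T" "sol_on h T gam0 U0 V0 W0 Q0 gam U V W Q xi0"
    from agree[OF this] glob
    show "\<exists>gam' U' V' W' Q' xi0'. global_sol h gam0 U0 V0 W0 Q0 gam' U' V' W' Q' xi0' \<and>
        (\<forall>t\<in>{0..T}. AE xi in lborel. gam' t xi = gam t xi \<and> U' t xi = U t xi \<and>
          V' t xi = V t xi \<and> W' t xi = W t xi \<and> Q' t xi = Q t xi)"
      by (intro exI conjI)
  qed
qed

end
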